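(* Let $M$ be an $m$-dimensional Riemannian manifold, let $D\subset M$ be a bounded domain, and let $f_0,f_1:D\to\mathbb{R}^n$ be minimal maps with the same boundary data, i.e. $f_0|_{\partial D}=f_1|_{\partial D}$. For each $x\in D$ and each of the maps $f\in\{f_0,f_1\}$ let $\lambda_1\ge\cdots\ge\lambda_m\ge0$ denote the singular values of $df$ at $x$. Then $f_0=f_1$ if any one of the following conditions holds: (i) $f_0$ and $f_1$ are both length non-increasing, i.e. at every point of $D$ all singular values of $df_0$ and of $df_1$ are at most $1$; (ii) at every point of $D$ the singular values of $df_0$ and those of $df_1$ satisfy $\sum_{i=1}^m\lambda_i\le 2$; (iii) at every point of $D$ the singular values of $df_0$ and those of $df_1$ satisfy $\sum_{i=1}^m\lambda_i^2\le 2$; (iv) at every point of $D$ the singular values of $df_0$ and those of $df_1$ satisfy $\sum_{i=1}^m(1+\lambda_i^2)^{1/2}\le 2$.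
   Context: A bounded domain $D\subset M$ is a connected open subset with compact closure $\overline{D}$; its boundary $\partial D$ is assumed nonempty. Maps $f:D\to\mathbb{R}^n$ are smooth up to the boundary (i.e. $f$ is the restriction of a smooth map defined on a neighbourhood of $\overline{D}$), so that $f|_{\partial D}$ makes sense. A smooth map $f:D\to\mathbb{R}^n$ is called a minimal map if its graph $\{(x,f(x)):x\in D\}$ is a minimal submanifold (zero mean curvature) of the Riemannian product $D\times\mathbb{R}^n$, where $\mathbb{R}^n$ carries the Euclidean metric. For $x\in D$, the singular values of the linear map $df:T_xM\to\mathbb{R}^n$ (with respect to the metric $g_M$ of $M$ on $T_xM$ and the Euclidean metric on $\mathbb{R}^n$) are the $m$ numbers $\lambda_1\ge\cdots\ge\lambda_m\ge 0$ such that $\lambda_1^2,\dots,\lambda_m^2$ are the eigenvalues, counted with multiplicity, of the quadratic form $v\mapsto\langle df(v),df(v)\rangle$ with respect to $g_M$ (so $\lambda_i=0$ for $i>\operatorname{rank} df$). *)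

theory Defs
  imports "HOL-Analysis.Analysis"
begin

section \<open>Smooth maps between open subsets of Euclidean spaces\<close>

fun times_differentiable_on ::
    "nat \<Rightarrow> 'a::real_normed_vector set \<Rightarrow> ('a \<Rightarrow> 'b::real_normed_vector) \<Rightarrow> bool" where
  "times_differentiable_on 0 S f \<longleftrightarrow> continuous_on S f"
| "times_differentiable_on (Suc k) S f \<longleftrightarrow>
     (\<forall>x\<in>S. f differentiable (at x)) \<and>
     (\<forall>v. times_differentiable_on k S (\<lambda>x. frechet_derivative f (at x) v))"

definition smooth_on :: "'a::real_normed_vector set \<Rightarrow> ('a \<Rightarrow> 'b::real_normed_vector) \<Rightarrow> bool" where
  "smooth_on S f \<longleftrightarrow> (\<forall>k. times_differentiable_on k S f)"


section \<open>Riemannian manifolds\<close>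

text \<open>
  A Riemannian structure is given by a smooth atlas in which every chart carries the
  coordinate expression of the metric: for a chart \<open>c\<close> and a coordinate point \<open>z\<close>,
  \<open>chart_metric c z\<close> is the bilinear form \<open>(u, v) \<mapsto> \<Sum>\<^sub>i\<^sub>j g\<^sub>i\<^sub>j(z) u\<^sub>i v\<^sub>j\<close>.
  The tangent space at \<open>p\<close> is thereby identified, through a chart around \<open>p\<close>, with the model
  space \<open>'e\<close>; two charts around \<open>p\<close> are related by the derivative of the change of coordinates.
  Values of \<open>chart_map c\<close> outside \<open>chart_dom c\<close>, and of \<open>chart_metric c\<close> outside the image of the
  chart, are irrelevant.
\<close>

datatype ('a, 'e) riem_chart =
  RChart (chart_dom: "'a set") (chart_map: "'a \<Rightarrow> 'e") (chart_metric: "'e \<Rightarrow> 'e \<Rightarrow> 'e \<Rightarrow> real")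

definition chart_image :: "('a, 'e) riem_chart \<Rightarrow> 'e set" where
  "chart_image c = chart_map c ` chart_dom c"

definition chart_inv :: "('a, 'e) riem_chart \<Rightarrow> 'e \<Rightarrow> 'a" where
  "chart_inv c = inv_into (chart_dom c) (chart_map c)"

definition riemannian_metric_on :: "'e::euclidean_space set \<Rightarrow> ('e \<Rightarrow> 'e \<Rightarrow> 'e \<Rightarrow> real) \<Rightarrow> bool" where
  "riemannian_metric_on S h \<longleftrightarrow>
     (\<forall>z\<in>S. bilinear (h z) \<and> (\<forall>u v. h z u v = h z v u) \<and> (\<forall>u. u \<noteq> 0 \<longrightarrow> h z u u > 0)) \<and>
     (\<forall>u v. smooth_on S (\<lambda>z. h z u v))"

definition riem_chart :: "('a::topological_space, 'e::euclidean_space) riem_chart \<Rightarrow> bool" where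
  "riem_chart c \<longleftrightarrow>
     open (chart_dom c) \<and> open (chart_image c) \<and>
     homeomorphism (chart_dom c) (chart_image c) (chart_map c) (chart_inv c) \<and>
     riemannian_metric_on (chart_image c) (chart_metric c)"

definition riem_compatible ::
    "('a::topological_space, 'e::euclidean_space) riem_chart \<Rightarrow> ('a, 'e) riem_chart \<Rightarrow> bool" where
  "riem_compatible c d \<longleftrightarrow>
     (let \<tau> = chart_map d \<circ> chart_inv c; S = chart_map c ` (chart_dom c \<inter> chart_dom d) in
      smooth_on S \<tau> \<and>
      (\<forall>z\<in>S. \<forall>u v. chart_metric c z u v =
         chart_metric d (\<tau> z) (frechet_derivative \<tau> (at z) u) (frechet_derivative \<tau> (at z) v)))"

text \<open>
  The manifold is the whole type \<open>'a\<close>; its dimension is that of \<open>'e\<close>.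
\<close>

definition riemannian_manifold ::
    "('a::{t2_space, second_countable_topology}, 'e::euclidean_space) riem_chart set \<Rightarrow> bool" where
  "riemannian_manifold A \<longleftrightarrow>
     (\<Union>c\<in>A. chart_dom c) = UNIV \<and>
     (\<forall>c\<in>A. riem_chart c) \<and>
     (\<forall>c\<in>A. \<forall>d\<in>A. riem_compatible c d)"

definition restrict_manifold :: "'a set \<Rightarrow> ('a, 'e) riem_chart set \<Rightarrow> ('a, 'e) riem_chart set" where
  "restrict_manifold D A = (\<lambda>c. RChart (chart_dom c \<inter> D) (chart_map c) (chart_metric c)) ` A"

definition product_with_euclidean ::
    "('a, 'e::real_vector) riem_chart set \<Rightarrow> ('a \<times> 'n::euclidean_space, 'e \<times> 'n) riem_chart set" where
  "product_with_euclidean A =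
     (\<lambda>c. RChart (chart_dom c \<times> UNIV) (\<lambda>(x, y). (chart_map c x, y))
        (\<lambda>(z, y) (u, a) (v, b). chart_metric c z u v + a \<bullet> b)) ` A"

definition smooth_map_on ::
    "('a::topological_space, 'e::euclidean_space) riem_chart set \<Rightarrow> 'a set \<Rightarrow> ('a \<Rightarrow> 'n::real_normed_vector) \<Rightarrow> bool" where
  "smooth_map_on A W f \<longleftrightarrow>
     (\<forall>c\<in>A. smooth_on (chart_map c ` (chart_dom c \<inter> W)) (f \<circ> chart_inv c))"


section \<open>Minimal submanifolds\<close>

text \<open>
  The Levi-Civita connection in coordinates:
  \<open>christoffel h x u v\<close> is \<open>\<Sum>\<^sub>i\<^sub>j\<^sub>k \<Gamma>\<^sup>k\<^sub>i\<^sub>j(x) u\<^sup>i v\<^sup>j e\<^sub>k\<close>, here determined by the Koszul formula for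
  constant coordinate vector fields.
\<close>

definition christoffel :: "('e::euclidean_space \<Rightarrow> 'e \<Rightarrow> 'e \<Rightarrow> real) \<Rightarrow> 'e \<Rightarrow> 'e \<Rightarrow> 'e \<Rightarrow> 'e" where
  "christoffel h x u v = (THE w. \<forall>z. 2 * h x w z =
       frechet_derivative (\<lambda>y. h y v z) (at x) u
     + frechet_derivative (\<lambda>y. h y u z) (at x) v
     - frechet_derivative (\<lambda>y. h y u v) (at x) z)"

definition normal_part :: "('e::real_vector \<Rightarrow> 'e \<Rightarrow> real) \<Rightarrow> 'e set \<Rightarrow> 'e \<Rightarrow> 'e" where
  "normal_part b T w = (THE n. w - n \<in> T \<and> (\<forall>t\<in>T. b n t = 0))"

text \<open>
  In the next three definitions \<open>F\<close> is a parametrised submanifold of an open subset of \<open>'e\<close>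
  with metric \<open>h\<close>. The second fundamental form is the normal part of the covariant derivative of
  \<open>dF(v)\<close> in the direction \<open>dF(u)\<close>, i.e. of \<open>\<partial>\<^sub>u\<partial>\<^sub>v F + \<Gamma>(dF(u), dF(v))\<close>, and the mean curvature vector is
  its trace with respect to the induced metric (not divided by the dimension).
\<close>

definition second_fundamental_form ::
    "('e::euclidean_space \<Rightarrow> 'e \<Rightarrow> 'e \<Rightarrow> real) \<Rightarrow> ('d::euclidean_space \<Rightarrow> 'e) \<Rightarrow> 'd \<Rightarrow> 'd \<Rightarrow> 'd \<Rightarrow> 'e" where
  "second_fundamental_form h F z u v =
     (let dF = frechet_derivative F (at z) in
      normal_part (h (F z)) (range dF)
        (frechet_derivative (\<lambda>y. frechet_derivative F (at y) v) (at z) u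
         + christoffel h (F z) (dF u) (dF v)))"

definition induced_gram ::
    "('e::euclidean_space \<Rightarrow> 'e \<Rightarrow> 'e \<Rightarrow> real) \<Rightarrow> (real^'m \<Rightarrow> 'e) \<Rightarrow> real^'m \<Rightarrow> real^'m^'m" where
  "induced_gram h F z = (\<chi> i j. h (F z) (frechet_derivative F (at z) (axis i 1))
                                        (frechet_derivative F (at z) (axis j 1)))"

definition mean_curvature_vector ::
    "('e::euclidean_space \<Rightarrow> 'e \<Rightarrow> 'e \<Rightarrow> real) \<Rightarrow> (real^'m \<Rightarrow> 'e) \<Rightarrow> real^'m \<Rightarrow> 'e" where
  "mean_curvature_vector h F z =
     (\<Sum>i\<in>UNIV. \<Sum>j\<in>UNIV. (matrix_inv (induced_gram h F z) $ i $ j)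
        *\<^sub>R second_fundamental_form h F z (axis i 1) (axis j 1))"

text \<open>
  \<open>F\<close> on \<open>\<Omega>\<close> is a local parametrisation of the subset \<open>S\<close> of the manifold \<open>B\<close>: a smooth immersion that
  is a homeomorphism onto a relatively open subset of \<open>S\<close>.
\<close>

definition local_parametrisation ::
    "('b::topological_space, 'e::euclidean_space) riem_chart set \<Rightarrow> 'b set
      \<Rightarrow> (real^'m) set \<Rightarrow> (real^'m \<Rightarrow> 'b) \<Rightarrow> bool" where
  "local_parametrisation B S \<Omega> F \<longleftrightarrow>
     open \<Omega> \<and> openin (top_of_set S) (F ` \<Omega>) \<and> (\<exists>G. homeomorphism \<Omega> (F ` \<Omega>) F G) \<and>
     (\<forall>c\<in>B. smooth_on {z\<in>\<Omega>. F z \<in> chart_dom c} (chart_map c \<circ> F) \<and>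
        (\<forall>z\<in>\<Omega>. F z \<in> chart_dom c \<longrightarrow> inj (frechet_derivative (chart_map c \<circ> F) (at z))))"

text \<open>
  The type argument fixes the dimension of the submanifold.
\<close>

definition minimal_submanifold ::
    "'m::finite itself \<Rightarrow> ('b::topological_space, 'e::euclidean_space) riem_chart set \<Rightarrow> 'b set \<Rightarrow> bool" where
  "minimal_submanifold _ B S \<longleftrightarrow>
     S \<subseteq> (\<Union>c\<in>B. chart_dom c) \<and>
     (\<forall>p\<in>S. \<exists>\<Omega> (F :: real^'m \<Rightarrow> 'b). local_parametrisation B S \<Omega> F \<and> p \<in> F ` \<Omega>) \<and>
     (\<forall>\<Omega> (F :: real^'m \<Rightarrow> 'b). local_parametrisation B S \<Omega> F \<longrightarrow>
        (\<forall>c\<in>B. \<forall>z\<in>\<Omega>. F z \<in> chart_dom c \<longrightarrow>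
           mean_curvature_vector (chart_metric c) (chart_map c \<circ> F) z = 0))"


section \<open>Minimal maps on bounded domains and singular values\<close>

definition bounded_domain :: "'a::topological_space set \<Rightarrow> bool" where
  "bounded_domain D \<longleftrightarrow> open D \<and> connected D \<and> compact (closure D) \<and> frontier D \<noteq> {}"

text \<open>
  A map on \<open>D\<close> is represented by a function on the whole type of which only the values on
  \<open>closure D\<close> matter; its values on \<open>frontier D\<close> are those of a smooth extension.
\<close>

definition smooth_up_to_boundary ::
    "('a::topological_space, 'e::euclidean_space) riem_chart set \<Rightarrow> 'a set \<Rightarrow> ('a \<Rightarrow> 'n::real_normed_vector) \<Rightarrow> bool" where
  "smooth_up_to_boundary A D f \<longleftrightarrow>
     (\<exists>W f'. open W \<and> closure D \<subseteq> W \<and> smooth_map_on A W f' \<and> (\<forall>x\<in>closure D. f x = f' x))"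

definition minimal_map ::
    "('a::topological_space, real^'m) riem_chart set \<Rightarrow> 'a set \<Rightarrow> ('a \<Rightarrow> real^'n) \<Rightarrow> bool" where
  "minimal_map A D f \<longleftrightarrow>
     smooth_up_to_boundary A D f \<and>
     minimal_submanifold TYPE('m) (product_with_euclidean (restrict_manifold D A)) {(x, f x) | x. x \<in> D}"

definition differential :: "('a, 'e::euclidean_space) riem_chart \<Rightarrow> ('a \<Rightarrow> 'n::real_normed_vector) \<Rightarrow> 'a \<Rightarrow> 'e \<Rightarrow> 'n" where
  "differential c f x = frechet_derivative (f \<circ> chart_inv c) (at (chart_map c x))"

text \<open>
  The multiplicity of \<open>\<mu>\<close> as an eigenvalue of the quadratic form \<open>v \<mapsto> \<langle>df(v), df(v)\<rangle>\<close> with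
  respect to the metric is the dimension of its eigenspace, read in a chart \<open>c\<close> around \<open>x\<close>.
\<close>

definition eigen_multiplicity ::
    "('a, 'e::euclidean_space) riem_chart \<Rightarrow> ('a \<Rightarrow> 'n::real_inner) \<Rightarrow> 'a \<Rightarrow> real \<Rightarrow> nat" where
  "eigen_multiplicity c f x \<mu> =
     dim {v. \<forall>w. differential c f x v \<bullet> differential c f x w = \<mu> * chart_metric c (chart_map c x) v w}"

text \<open>
  The list \<open>[\<lambda>\<^sub>1, \<dots>, \<lambda>\<^sub>m]\<close>; it exists and is unique by the spectral theorem, and does not depend on
  the chart since coordinate changes are isometries.
\<close>

definition singular_values ::
    "('a, 'e::euclidean_space) riem_chart set \<Rightarrow> ('a \<Rightarrow> 'n::real_inner) \<Rightarrow> 'a \<Rightarrow> real list" where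
  "singular_values A f x = (THE ls.
     length ls = DIM('e) \<and> sorted_wrt (\<ge>) ls \<and> (\<forall>l\<in>set ls. 0 \<le> l) \<and>
     (\<forall>c\<in>A. x \<in> chart_dom c \<longrightarrow>
        (\<forall>\<mu>. count_list (map (\<lambda>l. l\<^sup>2) ls) \<mu> = eigen_multiplicity c f x \<mu>)))"

end

theory Submission
  imports Defs
begin

text \<open>
  Write \<open>V(L) = sqrt (det (g + L\<^sup>T L))\<close> for the area integrand. In a \<open>g\<close>-orthonormal basis diagonalising
  \<open>L\<^sup>T L\<close>, the second derivative of \<open>V\<close> is a sum of explicit quadratic forms, nonnegative for the
  spectra allowed by (i)-(iv). Each of the four conditions is preserved along the segment from
  \<open>df\<^sub>0\<close> to \<open>df\<^sub>1\<close>, so \<open>DV(df\<^sub>1)(du) - DV(df\<^sub>0)(du) \<ge> 0\<close> for \<open>u = f\<^sub>1 - f\<^sub>0\<close>, and equality forces \<open>du = 0\<close>: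
  a degenerate direction at a contraction pushes some singular value above \<open>1\<close> nearby on the segment,
  where the Hessian is definite.

  Minimality makes \<open>DV(df)\<close> divergence free. Testing with truncations of \<open>u\<close> that vanish near \<open>\<partial>D\<close> and
  passing to the limit shows that the nonnegative density above integrates to zero over \<open>{u \<noteq> 0}\<close>.
  Hence \<open>du = 0\<close> wherever \<open>u \<noteq> 0\<close>, and \<open>|u|\<close> cannot have a positive maximum on the connected set \<open>D\<close>.
\<close>


section \<open>Derivatives of determinant and inverse\<close>

text \<open>The area integrand is not convex on all linear maps: where two distinct singular values
  have a product above \<open>1\<close>, the pair form in \<open>hessian_form_eq\<close> is
  indefinite. Convexity is therefore used only along the segment, and the hypotheses act through the
  sets they describe: (i), (ii), (iii) bound the operator, nuclear and Frobenius norm, whose balls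
  are convex. Under (ii) and (iii) one singular value may exceed \<open>1\<close>; the square of the
  trace term then has to pay for a negative diagonal entry, which is the origin of
  \<open>convex_spectrum\<close>. The other obstacle is the domain: its frontier is a bare
  topological one, with no normal and no Stokes formula. The test map is cut off by the size of
  \<open>u\<close> itself, because the points of the closure with \<open>|u|^2 \<ge> 1/n\<close>
  form a compact subset of \<open>D\<close>. Nor is a volume measure on the manifold constructed: a
  density is a family of chart functions that transform by the absolute Jacobian determinant, and
  its integral is a sum of Lebesgue integrals over chart images, weighted by a partition of
  unity.\<close>

lemma matrix_inv_mult:
  fixes A :: "real^'n^'n"
  assumes "det A \<noteq> 0"
  shows "A ** matrix_inv A = mat 1" "matrix_inv A ** A = mat 1"
proof -
  have "\<exists>B. A ** B = mat 1 \<and> B ** A = mat 1"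
    using assms invertible_det_nz[of A] unfolding invertible_def by blast
  then have "A ** matrix_inv A = mat 1 \<and> matrix_inv A ** A = mat 1"
    unfolding matrix_inv_def by (rule someI_ex)
  then show "A ** matrix_inv A = mat 1" "matrix_inv A ** A = mat 1" by auto
qed

lemma matrix_inv_eqI:
  fixes A :: "real^'n^'n"
  assumes "A ** B = mat 1"
  shows "matrix_inv A = B"
proof -
  have d: "det A \<noteq> 0"
    using assms det_mul[of A B] by (auto simp: det_I)
  have "matrix_inv A = matrix_inv A ** (A ** B)" using assms by simp
  also have "\<dots> = B" by (simp add: matrix_mul_assoc matrix_inv_mult[OF d])
  finally show ?thesis .
qed

lemma transpose_matrix_inv:
  fixes A :: "real^'n^'n"
  assumes "det A \<noteq> 0"
  shows "transpose (matrix_inv A) = matrix_inv (transpose A)"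
proof -
  have "transpose A ** transpose (matrix_inv A) = mat 1"
    using matrix_transpose_mul[of "matrix_inv A" A] matrix_inv_mult(2)[OF assms] by (simp add: transpose_mat)
  from matrix_inv_eqI[OF this] show ?thesis by simp
qed

text \<open>Cramer's rule for rows: \<open>c\<close> is the combination of the rows of
  \<open>A\<close> with coefficients \<open>c v* matrix_inv A\<close>, and putting it in place of
  row \<open>i\<close> keeps only the coefficient of that row.\<close>

lemma det_replace_row:
  fixes A :: "real^'n^'n"
  assumes "det A \<noteq> 0"
  shows "det (\<chi> k. if k = i then c else A $ k) = det A * (\<Sum>j\<in>UNIV. c $ j * matrix_inv A $ j $ i)"
proof -
  define x where "x = c v* matrix_inv A"
  have "x v* A = c"
    unfolding x_def by (simp add: vector_matrix_mul_assoc matrix_inv_mult[OF assms])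
  then have c: "c = (\<Sum>l\<in>UNIV. x $ l *s row l A)"
    by (auto simp: vec_eq_iff vector_matrix_mult_def row_def mult.commute)
  have r: "row k A = A $ k" for k by (simp add: row_def vec_eq_iff)
  have "det (\<chi> k. if k = i then c else row k A) = x $ i * det A"
    using cramer_lemma_transpose[of i x A] by (subst c) (simp cong: if_cong)
  also have "x $ i = (\<Sum>j\<in>UNIV. c $ j * matrix_inv A $ j $ i)"
    by (simp add: x_def vector_matrix_mult_def mult.commute)
  finally show ?thesis by (simp add: r mult.commute cong: if_cong)
qed

text \<open>Jacobi's formula. The product rule on the Leibniz expansion yields, for each row, the
  determinant with that row replaced by its derivative, to which \<open>det_replace_row\<close>
  applies.\<close>

lemma has_derivative_det:
  fixes A :: "'a::real_normed_vector \<Rightarrow> real^'n^'n"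
  assumes A: "(A has_derivative A') (at x within S)" and d: "det (A x) \<noteq> 0"
  shows "((\<lambda>y. det (A y)) has_derivative (\<lambda>v. det (A x) * trace (matrix_inv (A x) ** A' v))) (at x within S)"
proof -
  have e: "((\<lambda>y. A y $ i $ j) has_derivative (\<lambda>v. A' v $ i $ j)) (at x within S)" for i j
    by (intro bounded_linear.has_derivative[OF bounded_linear_vec_nth] A)
  let ?P = "{p. p permutes (UNIV::'n set)}"
  have "((\<lambda>y. \<Sum>p\<in>?P. of_int (sign p) * (\<Prod>i\<in>UNIV. A y $ i $ p i)) has_derivative
      (\<lambda>v. \<Sum>p\<in>?P. of_int (sign p) * (\<Sum>i\<in>UNIV. A' v $ i $ p i * (\<Prod>j\<in>UNIV - {i}. A x $ j $ p j))))
      (at x within S)"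
    by (auto intro!: derivative_eq_intros e)
  moreover have "(\<Sum>p\<in>?P. of_int (sign p) * (\<Sum>i\<in>UNIV. A' v $ i $ p i * (\<Prod>j\<in>UNIV - {i}. A x $ j $ p j)))
     = det (A x) * trace (matrix_inv (A x) ** A' v)" for v
  proof -
    have "(\<Prod>k\<in>UNIV. (\<chi> k. if k = i then A' v $ i else A x $ k) $ k $ p k)
        = A' v $ i $ p i * (\<Prod>j\<in>UNIV - {i}. A x $ j $ p j)" for p i
      by (subst prod.remove[of UNIV i]) (auto intro!: prod.cong)
    then have "det (\<chi> k. if k = i then A' v $ i else A x $ k)
       = (\<Sum>p\<in>?P. of_int (sign p) * (A' v $ i $ p i * (\<Prod>j\<in>UNIV - {i}. A x $ j $ p j)))" for i
      unfolding det_def by simp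
    then have "(\<Sum>p\<in>?P. of_int (sign p) * (\<Sum>i\<in>UNIV. A' v $ i $ p i * (\<Prod>j\<in>UNIV - {i}. A x $ j $ p j)))
       = (\<Sum>i\<in>UNIV. det (\<chi> k. if k = i then A' v $ i else A x $ k))"
      by (simp add: sum_distrib_left) (rule sum.swap)
    also have "\<dots> = det (A x) * (\<Sum>i\<in>UNIV. \<Sum>j\<in>UNIV. A' v $ i $ j * matrix_inv (A x) $ j $ i)"
      by (simp add: det_replace_row[OF d] sum_distrib_left)
    also have "(\<Sum>i\<in>UNIV. \<Sum>j\<in>UNIV. A' v $ i $ j * matrix_inv (A x) $ j $ i)
      = trace (matrix_inv (A x) ** A' v)"
      by (subst sum.swap) (simp add: trace_def matrix_matrix_mult_def mult.commute)
    finally show ?thesis .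
  qed
  ultimately show ?thesis unfolding det_def by simp
qed

lemma bounded_bilinear_matrix_mult:
  "bounded_bilinear ((**) :: real^'n^'m \<Rightarrow> real^'k^'n \<Rightarrow> real^'k^'m)"
proof -
  have "bilinear ((**) :: real^'n^'m \<Rightarrow> real^'k^'n \<Rightarrow> real^'k^'m)"
    unfolding bilinear_def
    by (auto intro!: linearI simp: matrix_matrix_mult_def vec_eq_iff algebra_simps sum.distrib sum_distrib_left)
  then show ?thesis using bilinear_conv_bounded_bilinear by blast
qed

text \<open>Cramer's rule again, here to exhibit the entries of the inverse as quotients of
  determinants, so that differentiability is known before the derivative is.\<close>

lemma matrix_inv_entry:
  fixes A :: "real^'n^'n"
  assumes "det A \<noteq> 0"
  shows "matrix_inv A $ i $ j = det (\<chi> p q. if q = i then axis j 1 $ p else A $ p $ q) / det A"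
proof -
  have "A *v (matrix_inv A *v axis j 1) = axis j 1"
    by (simp add: matrix_vector_mul_assoc matrix_inv_mult[OF assms])
  then have "matrix_inv A *v axis j 1
      = (\<chi> k. det (\<chi> p q. if q = k then axis j 1 $ p else A $ p $ q) / det A)"
    using cramer[OF assms] by blast
  then have "(matrix_inv A *v axis j 1) $ i = det (\<chi> p q. if q = i then axis j 1 $ p else A $ p $ q) / det A"
    by simp
  then show ?thesis
    by (simp add: matrix_vector_mult_basis column_def)
qed

lemma has_derivative_matrixI:
  fixes A :: "'a::real_normed_vector \<Rightarrow> real^'n^'m"
  assumes "\<And>i j. ((\<lambda>y. A y $ i $ j) has_derivative (\<lambda>v. A' v $ i $ j)) (at x within S)"
  shows "(A has_derivative A') (at x within S)"
  by (subst has_derivative_componentwise_within) (auto simp: Basis_vec_def inner_axis assms)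

text \<open>Differentiability comes from the quotients of determinants; differentiating
  \<open>matrix_inv (A y) ** A y = mat 1\<close> then determines the derivative.\<close>

lemma has_derivative_matrix_inv:
  fixes A :: "'a::real_normed_vector \<Rightarrow> real^'n^'n"
  assumes A: "(A has_derivative A') (at x)" and d: "det (A x) \<noteq> 0"
  shows "((\<lambda>y. matrix_inv (A y)) has_derivative
           (\<lambda>v. - (matrix_inv (A x) ** A' v ** matrix_inv (A x)))) (at x)"
proof -
  have e: "(\<lambda>y. A y $ i $ j) differentiable (at x)" for i j
    using A bounded_linear.has_derivative[OF bounded_linear_vec_nth bounded_linear.has_derivative[OF bounded_linear_vec_nth A]]
    unfolding differentiable_def by blast
  have det_diff: "(\<lambda>y. det (\<chi> p q. B p q y)) differentiable (at x)"
    if "\<And>p q. B p q differentiable (at x)" for B :: "'n \<Rightarrow> 'n \<Rightarrow> 'a \<Rightarrow> real"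
  proof -
    have B': "(B p q has_derivative frechet_derivative (B p q) (at x)) (at x)" for p q
      using that frechet_derivative_works by blast
    have "(\<lambda>y. \<Prod>i\<in>UNIV. B i (p i) y) differentiable (at x)" for p
      unfolding differentiable_def by (rule exI, rule has_derivative_prod, rule B')
    then show ?thesis
      unfolding det_def by (auto intro!: differentiable_sum differentiable_mult simp: finite_permutations)
  qed
  have dd: "(\<lambda>y. det (A y)) differentiable (at x)"
    using has_derivative_det[OF A d] unfolding differentiable_def by blast
  have "isCont (\<lambda>y. det (A y)) x" using dd by (simp add: differentiable_imp_continuous_within)
  then have ev: "eventually (\<lambda>y. det (A y) \<noteq> 0) (at x)"
    using d by (simp add: isCont_def tendsto_imp_eventually_ne)
  then have ev': "eventually (\<lambda>y. det (A y) \<noteq> 0) (nhds x)"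
    using d by (simp add: eventually_nhds_conv_at)
  have "(\<lambda>y. matrix_inv (A y) $ i $ j) differentiable (at x)" for i j
  proof -
    have "(\<lambda>y. det (\<chi> p q. if q = i then axis j 1 $ p else A y $ p $ q) / det (A y)) differentiable (at x)"
      by (intro differentiable_divide det_diff dd d) (case_tac "q = i"; simp add: e)
    then obtain D where D: "((\<lambda>y. det (\<chi> p q. if q = i then axis j 1 $ p else A y $ p $ q) / det (A y)) has_derivative D) (at x)"
      unfolding differentiable_def by blast
    have "((\<lambda>y. matrix_inv (A y) $ i $ j) has_derivative D) (at x)"
      by (rule has_derivative_transform_eventually[OF D])
        (use ev d in \<open>auto simp: matrix_inv_entry elim: eventually_mono\<close>)
    then show ?thesis unfolding differentiable_def by blast
  qed
  then have "(\<lambda>y. matrix_inv (A y)) differentiable (at x)"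
    by (subst differentiable_componentwise_within) (auto simp: Basis_vec_def inner_axis)
  then obtain D where D: "((\<lambda>y. matrix_inv (A y)) has_derivative D) (at x)"
    unfolding differentiable_def by blast
  have P: "((\<lambda>y. matrix_inv (A y) ** A y) has_derivative
      (\<lambda>v. matrix_inv (A x) ** A' v + D v ** A x)) (at x)"
    by (rule bounded_bilinear.FDERIV[OF bounded_bilinear_matrix_mult D A])
  \<comment> \<open>The product is known to be the identity only where the determinant is nonzero,
    hence on a neighbourhood of \<open>x\<close>, which suffices.\<close>
  have "((\<lambda>y. mat 1) has_derivative (\<lambda>v. matrix_inv (A x) ** A' v + D v ** A x)) (at x)"
    by (rule has_derivative_transform_eventually[OF P])
      (use ev d in \<open>auto simp: matrix_inv_mult elim: eventually_mono\<close>)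
  from has_derivative_unique[OF this has_derivative_const]
  have "matrix_inv (A x) ** A' v + D v ** A x = 0" for v
    by (rule fun_cong)
  then have z: "D v ** A x = - (matrix_inv (A x) ** A' v)" for v
    by (metis add.commute eq_neg_iff_add_eq_0)
  have "D v = - (matrix_inv (A x) ** A' v ** matrix_inv (A x))" for v
  proof -
    have "D v = D v ** A x ** matrix_inv (A x)"
      by (simp add: matrix_mul_assoc[symmetric] matrix_inv_mult[OF d])
    also have "\<dots> = - (matrix_inv (A x) ** A' v ** matrix_inv (A x))"
      unfolding z by (simp add: matrix_matrix_mult_def vec_eq_iff sum_negf)
    finally show ?thesis .
  qed
  then have "D = (\<lambda>v. - (matrix_inv (A x) ** A' v ** matrix_inv (A x)))" by blast
  with D show ?thesis by simp
qed


section \<open>The second variation in singular coordinates\<close>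

text \<open>Let \<open>y\<close> be the part of the first sum outside \<open>k\<close>. Completing
  the square in \<open>x k\<close> leaves \<open>-((l k)^2 - 1) y^2\<close> as the only negative
  contribution, and Cauchy-Schwarz bounds \<open>y^2\<close>. Hypothesis \<open>c\<close> says
  exactly that the remaining coefficients stay positive.\<close>

lemma weighted_diagonal_form:
  fixes l x :: "'i::finite \<Rightarrow> real"
  assumes k: "l k > 1" and c: "\<And>i. i \<noteq> k \<Longrightarrow> ((l k)\<^sup>2 - 1) * (\<Sum>j\<in>UNIV - {k}. (l j)\<^sup>2) < 1 - (l i)\<^sup>2"
  shows "(\<Sum>i\<in>UNIV. l i * x i)\<^sup>2 + (\<Sum>i\<in>UNIV. (1 - (l i)\<^sup>2) * (x i)\<^sup>2) \<ge> 0"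
    and "(\<Sum>i\<in>UNIV. l i * x i)\<^sup>2 + (\<Sum>i\<in>UNIV. (1 - (l i)\<^sup>2) * (x i)\<^sup>2) = 0 \<Longrightarrow> x i = 0"
proof -
  let ?J = "UNIV - {k}"
  define S where "S = (\<Sum>j\<in>?J. (l j)\<^sup>2)"
  define y where "y = (\<Sum>i\<in>?J. l i * x i)"
  define e where "e = ((l k)\<^sup>2 - 1) * S"
  have lk: "(l k)\<^sup>2 - 1 > 0" using k by (simp add: one_less_power)
  have y2: "y\<^sup>2 \<le> S * (\<Sum>i\<in>?J. (x i)\<^sup>2)"
    unfolding y_def S_def by (rule Cauchy_Schwarz_ineq_sum)
  have s1: "(\<Sum>i\<in>UNIV. l i * x i) = l k * x k + y"
    unfolding y_def by (simp add: sum.remove[of UNIV k])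
  have s2: "(\<Sum>i\<in>UNIV. (1 - (l i)\<^sup>2) * (x i)\<^sup>2) = (1 - (l k)\<^sup>2) * (x k)\<^sup>2 + (\<Sum>i\<in>?J. (1 - (l i)\<^sup>2) * (x i)\<^sup>2)"
    by (simp add: sum.remove[of UNIV k])
  have "((l k)\<^sup>2 - 1) * y\<^sup>2 \<le> ((l k)\<^sup>2 - 1) * (S * (\<Sum>i\<in>?J. (x i)\<^sup>2))"
    using y2 lk by (intro mult_left_mono) auto
  also have "\<dots> = (\<Sum>i\<in>?J. e * (x i)\<^sup>2)"
    by (simp add: e_def sum_distrib_left mult.assoc)
  finally have b: "((l k)\<^sup>2 - 1) * y\<^sup>2 \<le> (\<Sum>i\<in>?J. e * (x i)\<^sup>2)" .
  have id: "(l k * x k + y)\<^sup>2 + (1 - (l k)\<^sup>2) * (x k)\<^sup>2 = (x k + l k * y)\<^sup>2 - ((l k)\<^sup>2 - 1) * y\<^sup>2"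
    by (simp add: power2_eq_square algebra_simps)
  have "(\<Sum>i\<in>UNIV. l i * x i)\<^sup>2 + (\<Sum>i\<in>UNIV. (1 - (l i)\<^sup>2) * (x i)\<^sup>2)
      \<ge> (x k + l k * y)\<^sup>2 + (\<Sum>i\<in>?J. (1 - (l i)\<^sup>2) * (x i)\<^sup>2) - (\<Sum>i\<in>?J. e * (x i)\<^sup>2)"
    unfolding s1 s2 using id b by linarith
  also have "(x k + l k * y)\<^sup>2 + (\<Sum>i\<in>?J. (1 - (l i)\<^sup>2) * (x i)\<^sup>2) - (\<Sum>i\<in>?J. e * (x i)\<^sup>2)
      = (x k + l k * y)\<^sup>2 + (\<Sum>i\<in>?J. (1 - (l i)\<^sup>2 - e) * (x i)\<^sup>2)"
    by (simp add: sum_subtractf sum.distrib algebra_simps)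
  finally have main: "(x k + l k * y)\<^sup>2 + (\<Sum>i\<in>?J. (1 - (l i)\<^sup>2 - e) * (x i)\<^sup>2)
     \<le> (\<Sum>i\<in>UNIV. l i * x i)\<^sup>2 + (\<Sum>i\<in>UNIV. (1 - (l i)\<^sup>2) * (x i)\<^sup>2)" .
  have ce: "1 - (l i)\<^sup>2 - e > 0" if "i \<noteq> k" for i using c[OF that] by (simp add: e_def S_def)
  have tn: "(\<Sum>i\<in>?J. (1 - (l i)\<^sup>2 - e) * (x i)\<^sup>2) \<ge> 0"
    using ce by (intro sum_nonneg mult_nonneg_nonneg) (auto intro: less_imp_le)
  show "(\<Sum>i\<in>UNIV. l i * x i)\<^sup>2 + (\<Sum>i\<in>UNIV. (1 - (l i)\<^sup>2) * (x i)\<^sup>2) \<ge> 0"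
    using main tn zero_le_power2[of "x k + l k * y"] by linarith
  assume z: "(\<Sum>i\<in>UNIV. l i * x i)\<^sup>2 + (\<Sum>i\<in>UNIV. (1 - (l i)\<^sup>2) * (x i)\<^sup>2) = 0"
  have z1: "(\<Sum>i\<in>?J. (1 - (l i)\<^sup>2 - e) * (x i)\<^sup>2) = 0" "(x k + l k * y)\<^sup>2 = 0"
    using main tn zero_le_power2[of "x k + l k * y"] z by linarith+
  have "\<forall>i\<in>?J. (1 - (l i)\<^sup>2 - e) * (x i)\<^sup>2 = 0"
    using z1(1) by (subst (asm) sum_nonneg_eq_0_iff) (use ce in \<open>auto intro!: mult_nonneg_nonneg simp: less_imp_le\<close>)
  then have xj: "x i = 0" if "i \<noteq> k" for i using ce[OF that] that by auto
  then have "y = 0" unfolding y_def by (intro sum.neutral) auto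
  with z1(2) have "x k = 0" by simp
  with xj show "x i = 0" by (cases "i = k") auto
qed

text \<open>The second derivative of the area integrand divided by the integrand, in a frame of
  singular vectors: \<open>h i\<close> are the eigenvalues of the inverse Gram matrix,
  \<open>n i j\<close> is the component of the varied \<open>j\<close>-th frame vector along the
  \<open>i\<close>-th left singular vector, and \<open>r j\<close> its full squared length. The
  argument \<open>r\<close> is separate because the left singular vectors need not span the
  target.\<close>

definition hessian_form :: "('i::finite \<Rightarrow> real) \<Rightarrow> ('i \<Rightarrow> 'i \<Rightarrow> real) \<Rightarrow> ('i \<Rightarrow> real) \<Rightarrow> real" where
  "hessian_form l n r = (let h = (\<lambda>i. 1 / (1 + (l i)\<^sup>2)) in
     (\<Sum>i\<in>UNIV. h i * (l i * n i i))\<^sup>2 + (\<Sum>j\<in>UNIV. h j * r j)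
     - (\<Sum>i\<in>UNIV. \<Sum>j\<in>UNIV. h i * h j * ((l i * n i j + l j * n j i) * (l j * n j i))))"

text \<open>Inserting \<open>1 = h i * (1 + (l i)\<^sup>2)\<close> brings the quadratic terms to the
  common weight \<open>h i * h j\<close>. What remains is a square, the Bessel defects of the
  columns of \<open>n\<close>, and one binary quadratic form in \<open>n i j\<close> and
  \<open>n j i\<close> for each pair.\<close>

lemma hessian_form_eq:
  fixes l r :: "'i::finite \<Rightarrow> real"
  defines "h \<equiv> \<lambda>i. 1 / (1 + (l i)\<^sup>2)"
  shows "hessian_form l n r = (\<Sum>i\<in>UNIV. l i * (h i * n i i))\<^sup>2 + (\<Sum>j\<in>UNIV. h j * (r j - (\<Sum>i\<in>UNIV. (n i j)\<^sup>2)))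
     + (\<Sum>i\<in>UNIV. \<Sum>j\<in>UNIV. h i * h j * (((n i j)\<^sup>2 + (n j i)\<^sup>2 - 2 * (l i * l j) * n i j * n j i) / 2))"
proof -
  have hp: "1 + (l i)\<^sup>2 > 0" for i by (simp add: add_pos_nonneg)
  have a: "(\<Sum>j\<in>UNIV. h j * (\<Sum>i\<in>UNIV. (n i j)\<^sup>2)) = (\<Sum>i\<in>UNIV. \<Sum>j\<in>UNIV. h i * h j * ((1 + (l i)\<^sup>2) * (n i j)\<^sup>2))"
    apply (subst sum.swap)
    apply (simp add: sum_distrib_left)
    apply (intro sum.cong refl)
    using hp by (simp add: h_def less_imp_neq[symmetric])
  have b: "(\<Sum>i\<in>UNIV. \<Sum>j\<in>UNIV. h i * h j * ((l j)\<^sup>2 * (n j i)\<^sup>2)) = (\<Sum>i\<in>UNIV. \<Sum>j\<in>UNIV. h i * h j * ((l i)\<^sup>2 * (n i j)\<^sup>2))"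
    by (subst sum.swap) (simp add: mult.commute)
  have c: "(\<Sum>i\<in>UNIV. \<Sum>j\<in>UNIV. h i * h j * (n j i)\<^sup>2) = (\<Sum>i\<in>UNIV. \<Sum>j\<in>UNIV. h i * h j * (n i j)\<^sup>2)"
    by (subst sum.swap) (simp add: mult.commute)
  define Z where "Z = (\<Sum>i\<in>UNIV. \<Sum>j\<in>UNIV. h i * h j * (l i * l j * n i j * n j i))"
  define W where "W = (\<Sum>i\<in>UNIV. \<Sum>j\<in>UNIV. h i * h j * (n i j)\<^sup>2)"
  define X where "X = (\<Sum>i\<in>UNIV. \<Sum>j\<in>UNIV. h i * h j * ((l i)\<^sup>2 * (n i j)\<^sup>2))"
  have d: "(\<Sum>i\<in>UNIV. \<Sum>j\<in>UNIV. h i * h j * ((l i * n i j + l j * n j i) * (l j * n j i))) = Z + X"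
    unfolding X_def b[symmetric] Z_def sum.distrib[symmetric]
    by (intro sum.cong refl) (simp add: power2_eq_square algebra_simps)
  have e: "(\<Sum>j\<in>UNIV. h j * (\<Sum>i\<in>UNIV. (n i j)\<^sup>2)) = W + X"
    unfolding a X_def W_def sum.distrib[symmetric]
    by (intro sum.cong refl) (simp add: algebra_simps)
  have f: "(\<Sum>i\<in>UNIV. \<Sum>j\<in>UNIV. h i * h j * (((n i j)\<^sup>2 + (n j i)\<^sup>2 - 2 * (l i * l j) * n i j * n j i) / 2)) = W - Z"
  proof -
    have "(\<Sum>i\<in>UNIV. \<Sum>j\<in>UNIV. h i * h j * (((n i j)\<^sup>2 + (n j i)\<^sup>2 - 2 * (l i * l j) * n i j * n j i) / 2))
      = (\<Sum>i\<in>UNIV. \<Sum>j\<in>UNIV. h i * h j * (n i j)\<^sup>2) / 2 + (\<Sum>i\<in>UNIV. \<Sum>j\<in>UNIV. h i * h j * (n j i)\<^sup>2) / 2 - Z"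
      unfolding Z_def sum_divide_distrib sum.distrib[symmetric] sum_subtractf[symmetric]
      by (intro sum.cong refl) (simp add: field_simps)
    then show ?thesis unfolding c W_def by simp
  qed
  have g: "(\<Sum>j\<in>UNIV. h j * (r j - (\<Sum>i\<in>UNIV. (n i j)\<^sup>2))) = (\<Sum>j\<in>UNIV. h j * r j) - (W + X)"
    unfolding e[symmetric] by (simp add: right_diff_distrib sum_subtractf)
  have k: "(\<Sum>i\<in>UNIV. l i * (h i * n i i)) = (\<Sum>i\<in>UNIV. h i * (l i * n i i))"
    by (intro sum.cong refl) simp
  show ?thesis
    unfolding hessian_form_def Let_def h_def[symmetric] d f g k by simp
qed

text \<open>The form is the convex combination of \<open>(a - b)^2\<close> and
  \<open>a^2 + b^2\<close> with weights \<open>c\<close> and \<open>1 - c\<close>, from which both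
  claims can be read off.\<close>

lemma pair_form_nonneg:
  fixes a b c :: real
  assumes "0 \<le> c" "c \<le> 1"
  shows "a\<^sup>2 + b\<^sup>2 - 2 * c * a * b \<ge> 0"
    and "a\<^sup>2 + b\<^sup>2 - 2 * c * a * b = 0 \<Longrightarrow> a = b \<and> (c < 1 \<longrightarrow> a = 0)"
proof -
  have e: "a\<^sup>2 + b\<^sup>2 - 2 * c * a * b = c * (a - b)\<^sup>2 + (1 - c) * (a\<^sup>2 + b\<^sup>2)"
    by (simp add: power2_eq_square algebra_simps)
  have p: "c * (a - b)\<^sup>2 \<ge> 0" "(1 - c) * (a\<^sup>2 + b\<^sup>2) \<ge> 0" using assms by auto
  then show "a\<^sup>2 + b\<^sup>2 - 2 * c * a * b \<ge> 0" using e by linarith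
  assume "a\<^sup>2 + b\<^sup>2 - 2 * c * a * b = 0"
  with e p have z: "c * (a - b)\<^sup>2 = 0" "(1 - c) * (a\<^sup>2 + b\<^sup>2) = 0" by linarith+
  show "a = b \<and> (c < 1 \<longrightarrow> a = 0)"
  proof (cases "c < 1")
    case True
    then have "a\<^sup>2 + b\<^sup>2 = 0" using z(2) by simp
    then show ?thesis by (simp add: sum_power2_eq_zero_iff)
  next
    case False
    then show ?thesis using z(1) assms by auto
  qed
qed

text \<open>All products \<open>l i * l j\<close> are at most \<open>1\<close>, so every summand of
  \<open>hessian_form_eq\<close> is nonnegative by itself. The form is only semidefinite: in the
  null case a symmetric block between directions of singular value \<open>1\<close> can
  survive.\<close>

lemma hessian_form_contraction:
  fixes l r :: "'i::finite \<Rightarrow> real"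
  assumes l: "\<And>i. 0 \<le> l i" "\<And>i. l i \<le> 1" and r: "\<And>j. (\<Sum>i\<in>UNIV. (n i j)\<^sup>2) \<le> r j"
  shows "hessian_form l n r \<ge> 0"
    and "hessian_form l n r = 0 \<Longrightarrow> n i j = n j i \<and> (l i * l j < 1 \<longrightarrow> n i j = 0) \<and> r j = (\<Sum>i\<in>UNIV. (n i j)\<^sup>2)"
proof -
  define h where "h i = 1 / (1 + (l i)\<^sup>2)" for i
  have hp: "h i > 0" for i by (simp add: h_def add_pos_nonneg)
  define e where "e i j = (n i j)\<^sup>2 + (n j i)\<^sup>2 - 2 * (l i * l j) * n i j * n j i" for i j
  have ll: "0 \<le> l i * l j" "l i * l j \<le> 1" for i j using l by (auto intro: mult_le_one)
  have eq: "hessian_form l n r = (\<Sum>i\<in>UNIV. l i * (h i * n i i))\<^sup>2 + (\<Sum>j\<in>UNIV. h j * (r j - (\<Sum>i\<in>UNIV. (n i j)\<^sup>2)))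
     + (\<Sum>i\<in>UNIV. \<Sum>j\<in>UNIV. h i * h j * (e i j / 2))"
    unfolding h_def e_def by (rule hessian_form_eq)
  have en: "e i j \<ge> 0" for i j unfolding e_def by (rule pair_form_nonneg[OF ll])
  have t2: "h j * (r j - (\<Sum>i\<in>UNIV. (n i j)\<^sup>2)) \<ge> 0" for j
    using hp[of j] r[of j] by simp
  have t3: "h i * h j * (e i j / 2) \<ge> 0" for i j using hp[of i] hp[of j] en[of i j] by simp
  have s2: "(\<Sum>j\<in>UNIV. h j * (r j - (\<Sum>i\<in>UNIV. (n i j)\<^sup>2))) \<ge> 0" by (intro sum_nonneg t2)
  have s3: "(\<Sum>i\<in>UNIV. \<Sum>j\<in>UNIV. h i * h j * (e i j / 2)) \<ge> 0" by (intro sum_nonneg t3)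
  show "hessian_form l n r \<ge> 0" unfolding eq using s2 s3 zero_le_power2 by (simp add: add_nonneg_nonneg)
  assume "hessian_form l n r = 0"
  with eq s2 s3 zero_le_power2[of "\<Sum>i\<in>UNIV. l i * (h i * n i i)"]
  have z2: "(\<Sum>j\<in>UNIV. h j * (r j - (\<Sum>i\<in>UNIV. (n i j)\<^sup>2))) = 0"
    and z3: "(\<Sum>i\<in>UNIV. \<Sum>j\<in>UNIV. h i * h j * (e i j / 2)) = 0" by linarith+
  have "h j * (r j - (\<Sum>i\<in>UNIV. (n i j)\<^sup>2)) = 0"
    using z2 t2 by (subst (asm) sum_nonneg_eq_0_iff) auto
  then have rj: "r j = (\<Sum>i\<in>UNIV. (n i j)\<^sup>2)" using hp[of j] by simp
  have "(\<Sum>j\<in>UNIV. h i * h j * (e i j / 2)) = 0"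
    using z3 t3 by (subst (asm) sum_nonneg_eq_0_iff) (auto intro: sum_nonneg)
  then have "h i * h j * (e i j / 2) = 0"
    using t3 by (subst (asm) sum_nonneg_eq_0_iff) auto
  then have "e i j = 0" using hp[of i] hp[of j] by simp
  then have "n i j = n j i \<and> (l i * l j < 1 \<longrightarrow> n i j = 0)"
    unfolding e_def by (rule pair_form_nonneg(2)[OF ll])
  with rj show "n i j = n j i \<and> (l i * l j < 1 \<longrightarrow> n i j = 0) \<and> r j = (\<Sum>i\<in>UNIV. (n i j)\<^sup>2)" by blast
qed

text \<open>The diagonal pair form of index \<open>k\<close> is now negative. All diagonal terms are
  therefore split off and absorbed, together with the squared sum, by
  \<open>weighted_diagonal_form\<close> at \<open>x i = h i * n i i\<close>. Off the diagonal the
  products \<open>l i * l j\<close> are still below \<open>1\<close>, even strictly, so a vanishing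
  form leaves no symmetric block.\<close>

lemma hessian_form_expanding:
  fixes l r :: "'i::finite \<Rightarrow> real"
  assumes l: "\<And>i. 0 \<le> l i" and k: "l k > 1"
    and c: "\<And>i. i \<noteq> k \<Longrightarrow> ((l k)\<^sup>2 - 1) * (\<Sum>j\<in>UNIV - {k}. (l j)\<^sup>2) < 1 - (l i)\<^sup>2"
    and r: "\<And>j. (\<Sum>i\<in>UNIV. (n i j)\<^sup>2) \<le> r j"
  shows "hessian_form l n r \<ge> 0"
    and "hessian_form l n r = 0 \<Longrightarrow> r j = 0"
proof -
  define h where "h i = 1 / (1 + (l i)\<^sup>2)" for i
  have hp: "h i > 0" for i by (simp add: h_def add_pos_nonneg)
  define e where "e i j = (n i j)\<^sup>2 + (n j i)\<^sup>2 - 2 * (l i * l j) * n i j * n j i" for i j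
  \<comment> \<open>The diagonal is removed because it goes into the weighted form.\<close>
  define e' where "e' i j = (if i = j then 0 else e i j)" for i j
  have lk: "(l k)\<^sup>2 - 1 > 0" using k by (simp add: one_less_power)
  have S0: "(\<Sum>j\<in>UNIV - {k}. (l j)\<^sup>2) \<ge> 0" by (intro sum_nonneg) auto
  have l1: "(l i)\<^sup>2 < 1" if "i \<noteq> k" for i
    using c[OF that] mult_nonneg_nonneg[OF less_imp_le[OF lk] S0] by linarith
  have l1': "l i < 1" if "i \<noteq> k" for i
    using l1[OF that] l[of i] power_less_imp_less_base[of "l i" 2 1] by simp
  \<comment> \<open>In \<open>((l k)^2 - 1) (l i)^2 < 1 - (l i)^2\<close> the terms
    \<open>(l i)^2\<close> cancel and leave \<open>(l k * l i)^2 < 1\<close>.\<close>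
  have lkj: "l k * l i < 1" if "i \<noteq> k" for i
  proof -
    have "(l i)\<^sup>2 \<le> (\<Sum>j\<in>UNIV - {k}. (l j)\<^sup>2)" using that by (intro member_le_sum) auto
    then have "((l k)\<^sup>2 - 1) * (l i)\<^sup>2 \<le> ((l k)\<^sup>2 - 1) * (\<Sum>j\<in>UNIV - {k}. (l j)\<^sup>2)"
      using lk by (intro mult_left_mono) auto
    with c[OF that] have "(l k * l i)\<^sup>2 < 1" by (simp add: power_mult_distrib algebra_simps)
    then show ?thesis using power_less_imp_less_base[of "l k * l i" 2 1] by simp
  qed
  have ll: "l i * l j < 1" if "i \<noteq> j" for i j
  proof -
    consider "i = k" | "j = k" | "i \<noteq> k" "j \<noteq> k" by blast
    then show ?thesis
    proof cases
      case 3
      have "l i * l j \<le> l i * 1" using l l1'[OF 3(2)] by (intro mult_left_mono) auto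
      then show ?thesis using l1'[OF 3(1)] by simp
    qed (use lkj that in \<open>auto simp: mult.commute\<close>)
  qed
  have l0: "0 \<le> l i * l j" for i j using l by simp
  have "hessian_form l n r = (\<Sum>i\<in>UNIV. l i * (h i * n i i))\<^sup>2 + (\<Sum>j\<in>UNIV. h j * (r j - (\<Sum>i\<in>UNIV. (n i j)\<^sup>2)))
     + (\<Sum>i\<in>UNIV. \<Sum>j\<in>UNIV. h i * h j * (e i j / 2))"
    unfolding h_def e_def by (rule hessian_form_eq)
  moreover have "(\<Sum>i\<in>UNIV. \<Sum>j\<in>UNIV. h i * h j * (e i j / 2))
     = (\<Sum>i\<in>UNIV. (1 - (l i)\<^sup>2) * (h i * n i i)\<^sup>2) + (\<Sum>i\<in>UNIV. \<Sum>j\<in>UNIV. h i * h j * (e' i j / 2))"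
  proof -
    have "(\<Sum>j\<in>UNIV. h i * h j * (e i j / 2)) = (1 - (l i)\<^sup>2) * (h i * n i i)\<^sup>2 + (\<Sum>j\<in>UNIV. h i * h j * (e' i j / 2))" for i
    proof -
      have "(\<Sum>j\<in>UNIV. h i * h j * (e i j / 2)) = h i * h i * (e i i / 2) + (\<Sum>j\<in>UNIV - {i}. h i * h j * (e i j / 2))"
        by (rule sum.remove) auto
      also have "(\<Sum>j\<in>UNIV - {i}. h i * h j * (e i j / 2)) = (\<Sum>j\<in>UNIV - {i}. h i * h j * (e' i j / 2))"
        by (intro sum.cong) (auto simp: e'_def)
      also have "\<dots> = (\<Sum>j\<in>UNIV. h i * h j * (e' i j / 2))"
        by (subst sum.remove[of UNIV i]) (auto simp: e'_def)
      also have "h i * h i * (e i i / 2) = (1 - (l i)\<^sup>2) * (h i * n i i)\<^sup>2"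
        by (simp add: e_def power2_eq_square field_simps)
      finally show ?thesis .
    qed
    then show ?thesis by (simp add: sum.distrib)
  qed
  ultimately have eq: "hessian_form l n r = ((\<Sum>i\<in>UNIV. l i * (h i * n i i))\<^sup>2 + (\<Sum>i\<in>UNIV. (1 - (l i)\<^sup>2) * (h i * n i i)\<^sup>2))
     + (\<Sum>j\<in>UNIV. h j * (r j - (\<Sum>i\<in>UNIV. (n i j)\<^sup>2)))
     + (\<Sum>i\<in>UNIV. \<Sum>j\<in>UNIV. h i * h j * (e' i j / 2))" by linarith
  have en: "e' i j \<ge> 0" for i j
    unfolding e'_def e_def using pair_form_nonneg(1)[OF l0 less_imp_le[OF ll]] by simp
  have t2: "h j * (r j - (\<Sum>i\<in>UNIV. (n i j)\<^sup>2)) \<ge> 0" for j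
    using hp[of j] r[of j] by simp
  have t3: "h i * h j * (e' i j / 2) \<ge> 0" for i j using hp[of i] hp[of j] en[of i j] by simp
  have s1: "(\<Sum>i\<in>UNIV. l i * (h i * n i i))\<^sup>2 + (\<Sum>i\<in>UNIV. (1 - (l i)\<^sup>2) * (h i * n i i)\<^sup>2) \<ge> 0"
    using weighted_diagonal_form(1)[of l k "\<lambda>i. h i * n i i", OF k c] by simp
  have s2: "(\<Sum>j\<in>UNIV. h j * (r j - (\<Sum>i\<in>UNIV. (n i j)\<^sup>2))) \<ge> 0" by (intro sum_nonneg t2)
  have s3: "(\<Sum>i\<in>UNIV. \<Sum>j\<in>UNIV. h i * h j * (e' i j / 2)) \<ge> 0" by (intro sum_nonneg t3)
  show "hessian_form l n r \<ge> 0" unfolding eq using s1 s2 s3 by linarith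
  assume z: "hessian_form l n r = 0"
  have z1: "(\<Sum>i\<in>UNIV. l i * (h i * n i i))\<^sup>2 + (\<Sum>i\<in>UNIV. (1 - (l i)\<^sup>2) * (h i * n i i)\<^sup>2) = 0"
    and z2: "(\<Sum>j\<in>UNIV. h j * (r j - (\<Sum>i\<in>UNIV. (n i j)\<^sup>2))) = 0"
    and z3: "(\<Sum>i\<in>UNIV. \<Sum>j\<in>UNIV. h i * h j * (e' i j / 2)) = 0"
    using z eq s1 s2 s3 by linarith+
  have d: "n i i = 0" for i
  proof -
    have "h i * n i i = 0"
      using weighted_diagonal_form(2)[of l k "\<lambda>i. h i * n i i" i] k c z1 by blast
    then show ?thesis using hp[of i] by simp
  qed
  have "n i j = 0" for i
  proof (cases "i = j")
    case False
    have "(\<Sum>j\<in>UNIV. h i * h j * (e' i j / 2)) = 0"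
      using z3 t3 by (subst (asm) sum_nonneg_eq_0_iff) (auto intro: sum_nonneg)
    then have "h i * h j * (e' i j / 2) = 0"
      using t3 by (subst (asm) sum_nonneg_eq_0_iff) auto
    then have "e i j = 0" using hp[of i] hp[of j] False by (simp add: e'_def)
    then show ?thesis
      using pair_form_nonneg(2)[OF l0 less_imp_le[OF ll[OF False]]] ll[OF False] unfolding e_def by blast
  qed (use d in simp)
  moreover have "h j * (r j - (\<Sum>i\<in>UNIV. (n i j)\<^sup>2)) = 0"
    using z2 t2 by (subst (asm) sum_nonneg_eq_0_iff) auto
  ultimately show "r j = 0" using hp[of j] by simp
qed


section \<open>Simultaneous diagonalisation\<close>

definition pos_def_form :: "('e::real_vector \<Rightarrow> 'e \<Rightarrow> real) \<Rightarrow> bool" where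
  "pos_def_form g \<longleftrightarrow> bilinear g \<and> (\<forall>u v. g u v = g v u) \<and> (\<forall>u. u \<noteq> 0 \<longrightarrow> g u u > 0)"

lemma pos_def_formD:
  assumes "pos_def_form g"
  shows "bilinear g" "g u v = g v u" "u \<noteq> 0 \<Longrightarrow> g u u > 0" "g u u \<ge> 0"
proof -
  show b: "bilinear g" and "g u v = g v u" and p: "u \<noteq> 0 \<Longrightarrow> g u u > 0"
    using assms unfolding pos_def_form_def by blast+
  show "g u u \<ge> 0"
    using p by (cases "u = 0") (auto simp: bilinear_lzero[OF b])
qed

lemmas bilinear_simps = bilinear_ladd bilinear_radd bilinear_lmul bilinear_rmul bilinear_lneg bilinear_rneg
  bilinear_lzero bilinear_rzero bilinear_lsub bilinear_rsub

text \<open>Along \<open>v + t w\<close> the form equals \<open>2 t p(v,w) + t^2 p(w,w)\<close>, and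
  a nonzero linear part would make this negative for a small \<open>t\<close> of suitable
  sign.\<close>

lemma symmetric_form_kernel:
  fixes p :: "'e::real_vector \<Rightarrow> 'e \<Rightarrow> real"
  assumes b: "bilinear p" and s: "\<And>u v. p u v = p v u" and S: "subspace S"
    and nn: "\<And>w. w \<in> S \<Longrightarrow> p w w \<ge> 0" and v: "v \<in> S" "p v v = 0" and w: "w \<in> S"
  shows "p v w = 0"
proof (rule ccontr)
  assume nz: "p v w \<noteq> 0"
  have q: "0 \<le> 2 * t * p v w + t\<^sup>2 * p w w" for t
  proof -
    have "v + t *\<^sub>R w \<in> S" using S v w by (simp add: subspace_add subspace_scale)
    from nn[OF this] show ?thesis
      using v s[of w v] by (simp add: bilinear_simps[OF b] power2_eq_square algebra_simps)
  qed
  have pw: "p w w \<ge> 0" using nn w by blast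
  \<comment> \<open>The minimiser of \<open>2 t p(v,w) + t^2 (p(w,w) + 1)\<close>; the added
    \<open>1\<close> keeps the denominator positive when \<open>p w w = 0\<close>.\<close>
  define t where "t = - p v w / (p w w + 1)"
  have "2 * t * p v w + t\<^sup>2 * p w w \<le> 2 * t * p v w + t\<^sup>2 * (p w w + 1)"
    by (simp add: distrib_left)
  also have "\<dots> = - (p v w)\<^sup>2 / (p w w + 1)"
  proof -
    have "2 * (- x / d) * x + (- x / d)\<^sup>2 * d = - x\<^sup>2 / d" if "d > 0" for x d :: real
      using that by (simp add: power2_eq_square field_simps)
    then show ?thesis using pw by (simp add: t_def)
  qed
  also have "\<dots> < 0" using nz pw by (simp add: divide_neg_pos)
  finally show False using q[of t] by linarith
qed

text \<open>Induction on the dimension. A maximiser \<open>v\<close> of the Rayleigh quotient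
  \<open>q w w / g w w\<close> on the subspace makes \<open>\<mu> g - q\<close> semidefinite with
  \<open>v\<close> as a null vector. Hence \<open>q v\<close> is a multiple of \<open>g v\<close>
  there, and the \<open>g\<close>-orthogonal complement of \<open>v\<close> is also
  \<open>q\<close>-orthogonal to \<open>v\<close>.\<close>

lemma simultaneous_diagonalization:
  fixes g q :: "'e::euclidean_space \<Rightarrow> 'e \<Rightarrow> real"
  assumes g: "pos_def_form g" and q: "bilinear q" "\<And>u v. q u v = q v u"
    and S: "subspace S" "dim S = n"
  shows "\<exists>b :: nat \<Rightarrow> 'e. \<forall>i<n. b i \<in> S \<and> (\<forall>j<n. g (b i) (b j) = (if i = j then 1 else 0) \<and> (i \<noteq> j \<longrightarrow> q (b i) (b j) = 0))"
  using S
proof (induction n arbitrary: S)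
  case 0
  then show ?case by simp
next
  case (Suc n)
  note bg = pos_def_formD(1)[OF g] and sg = pos_def_formD(2)[OF g] and pg = pos_def_formD(3)[OF g]
  obtain u where u: "u \<in> S" "u \<noteq> 0"
    using Suc.prems dim_eq_0[of S] by (metis nat.distinct(1) singletonI subset_eq)
  let ?K = "S \<inter> sphere 0 1"
  have "(1 / norm u) *\<^sub>R u \<in> ?K"
    using u Suc.prems(1) by (auto simp: subspace_scale)
  then have K: "compact ?K" "?K \<noteq> {}"
    using closed_subspace[OF Suc.prems(1)] by (auto intro: closed_Int_compact)
  have cb: "continuous_on X (\<lambda>w. f w w)" if "bilinear f" for f :: "'e \<Rightarrow> 'e \<Rightarrow> real" and X
    using bounded_bilinear.continuous_on[OF bilinear_conv_bounded_bilinear[THEN iffD1, OF that], of X "\<lambda>w. w" "\<lambda>w. w"] by simp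
  have "g w w \<noteq> 0" if "w \<in> ?K" for w
  proof -
    have "w \<noteq> 0" using that by auto
    from pg[OF this] show ?thesis by simp
  qed
  then have "continuous_on ?K (\<lambda>w. q w w / g w w)"
    by (intro continuous_on_divide cb[OF q(1)] cb[OF bg]) blast
  from continuous_attains_sup[OF K this] obtain v where v: "v \<in> S" "norm v = 1"
    and vm: "\<And>w. w \<in> S \<Longrightarrow> norm w = 1 \<Longrightarrow> q w w / g w w \<le> q v v / g v v" by auto
  define \<mu> where "\<mu> = q v v / g v v"
  have "v \<noteq> 0" using v by auto
  then have gv: "g v v > 0" by (rule pg)
  define p where "p x y = \<mu> * g x y - q x y" for x y
  have p: "bilinear p"
    unfolding p_def bilinear_def
    by (auto intro!: linearI simp: bilinear_simps[OF bg] bilinear_simps[OF q(1)] algebra_simps)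
  have sp: "p x y = p y x" for x y unfolding p_def using sg q(2) by metis
  have pn: "p w w \<ge> 0" if w: "w \<in> S" for w
  proof (cases "w = 0")
    case False
    define w' where "w' = (1 / norm w) *\<^sub>R w"
    have w': "w = norm w *\<^sub>R w'" "w' \<in> S" "norm w' = 1" "w' \<noteq> 0"
      using False w Suc.prems(1) by (auto simp: w'_def subspace_scale)
    have "q w' w' \<le> \<mu> * g w' w'"
      using vm[OF w'(2,3)] pg[OF w'(4)] by (simp add: \<mu>_def field_simps)
    then have "0 \<le> (norm w)\<^sup>2 * p w' w'" by (simp add: p_def)
    also have "\<dots> = p w w"
      using arg_cong2[where f = p, OF w'(1) w'(1)] by (simp add: bilinear_simps[OF p] power2_eq_square)
    finally show ?thesis .
  qed (simp add: bilinear_simps[OF p])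
  have "p v v = 0" using gv by (simp add: p_def \<mu>_def)
  from symmetric_form_kernel[OF p sp Suc.prems(1) pn v(1) this]
  have qv: "q v w = \<mu> * g v w" if "w \<in> S" for w using that by (simp add: p_def)
  define S' where "S' = {w \<in> S. g v w = 0}"
  have S': "subspace S'"
    using Suc.prems(1) unfolding S'_def subspace_def by (auto simp: bilinear_simps[OF bg])
  have vS': "v \<notin> S'" using gv by (simp add: S'_def)
  have "span (insert v S') = S"
  proof
    have "insert v S' \<subseteq> S" using v by (auto simp: S'_def)
    then show "span (insert v S') \<subseteq> S" using Suc.prems(1) by (simp add: span_minimal)
    show "S \<subseteq> span (insert v S')"
    proof
      fix w assume w: "w \<in> S"
      have "w - (g v w / g v v) *\<^sub>R v \<in> S'"
        unfolding S'_def using w v gv Suc.prems(1)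
        by (auto simp: bilinear_simps[OF bg] subspace_diff subspace_scale)
      then show "w \<in> span (insert v S')" by (auto simp: span_insert intro: span_base)
    qed
  qed
  then have "dim (insert v S') = Suc n" by (metis Suc.prems(2) dim_span)
  then have "dim S' = n"
    using vS' S' by (simp add: dim_insert span_eq_iff[THEN iffD2, OF S'])
  from Suc.IH[OF S' this] obtain b where b: "\<And>i. i < n \<Longrightarrow> b i \<in> S'"
    "\<And>i j. i < n \<Longrightarrow> j < n \<Longrightarrow> g (b i) (b j) = (if i = j then 1 else 0)"
    "\<And>i j. i < n \<Longrightarrow> j < n \<Longrightarrow> i \<noteq> j \<Longrightarrow> q (b i) (b j) = 0" by blast
  define v' where "v' = (1 / sqrt (g v v)) *\<^sub>R v"
  have v': "v' \<in> S" "g v' v' = 1"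
    using v gv Suc.prems(1) by (auto simp: v'_def subspace_scale bilinear_simps[OF bg])
  have vb: "g v' (b i) = 0" "q v' (b i) = 0" "g (b i) v' = 0" "q (b i) v' = 0" "b i \<in> S" if "i < n" for i
    using b(1)[OF that] qv[of "b i"] sg[of "b i" v] q(2)[of "b i" v]
    by (auto simp: S'_def v'_def bilinear_simps[OF bg] bilinear_simps[OF q(1)])
  show ?case
    by (rule exI[of _ "\<lambda>i. if i < n then b i else v'"]) (auto simp: b v' vb less_Suc_eq)
qed

text \<open>\<open>b\<close> is an orthonormal frame of right singular vectors. The index type is
  unordered, so the values carry no order; when it is the coordinate index type, the frame can be
  read as a square matrix.\<close>

definition svd :: "('e \<Rightarrow> 'e \<Rightarrow> real) \<Rightarrow> ('e \<Rightarrow> 'b::real_inner) \<Rightarrow> ('m \<Rightarrow> 'e) \<Rightarrow> ('m \<Rightarrow> real) \<Rightarrow> bool" where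
  "svd g L b l \<longleftrightarrow> (\<forall>i. 0 \<le> l i) \<and>
     (\<forall>i j. g (b i) (b j) = (if i = j then 1 else 0) \<and> L (b i) \<bullet> L (b j) = (if i = j then (l i)\<^sup>2 else 0))"

lemma svdD:
  assumes "svd g L b l"
  shows "0 \<le> l i" "g (b i) (b j) = (if i = j then 1 else 0)"
    "L (b i) \<bullet> L (b j) = (if i = j then (l i)\<^sup>2 else 0)"
  using assms unfolding svd_def by blast+

lemma bilinear_pullback:
  assumes "bilinear q" "linear L" "linear N"
  shows "bilinear (\<lambda>u v. q (L u) (N v))"
  using assms unfolding bilinear_def
  by (auto intro: linear_compose[unfolded o_def])

lemma bilinear_inner: "bilinear (\<bullet>)"
  unfolding bilinear_def by (auto intro!: linearI simp: inner_left_distrib inner_right_distrib)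

lemma svd_exists:
  fixes g :: "real^'m \<Rightarrow> real^'m \<Rightarrow> real" and L :: "real^'m \<Rightarrow> 'b::real_inner"
  assumes g: "pos_def_form g" and L: "linear L"
  shows "\<exists>(b :: 'm \<Rightarrow> real^'m) l. svd g L b l"
proof -
  obtain b where b: "\<And>i j. i < CARD('m) \<Longrightarrow> j < CARD('m) \<Longrightarrow> g (b i) (b j) = (if i = j then 1 else 0)"
     "\<And>i j. i < CARD('m) \<Longrightarrow> j < CARD('m) \<Longrightarrow> i \<noteq> j \<Longrightarrow> L (b i) \<bullet> L (b j) = 0"
    using simultaneous_diagonalization[OF g bilinear_pullback[OF bilinear_inner L L], of UNIV "CARD('m)"]
    by (auto simp: inner_commute dim_UNIV)
  obtain f where f: "bij_betw f (UNIV :: 'm set) {..<CARD('m)}"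
    using finite_same_card_bij[of "UNIV::'m set" "{..<CARD('m)}"] by auto
  have f1: "f i < CARD('m)" for i using f by (auto simp: bij_betw_def)
  have f2: "f i = f j \<longleftrightarrow> i = j" for i j using f by (auto simp: bij_betw_def inj_on_def)
  have "svd g L (\<lambda>i. b (f i)) (\<lambda>i. norm (L (b (f i))))"
    unfolding svd_def using b f1 f2 by (auto simp: power2_norm_eq_inner)
  then show ?thesis by blast
qed

definition form_matrix :: "(real^'m \<Rightarrow> real^'m \<Rightarrow> real) \<Rightarrow> real^'m^'m" where
  "form_matrix q = (\<chi> i j. q (axis i 1) (axis j 1))"

definition frame_matrix :: "('m \<Rightarrow> real^'m) \<Rightarrow> real^'m^'m" where
  "frame_matrix b = (\<chi> i j. b j $ i)"

lemma bilinear_axis_expand: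
  fixes q :: "real^'m \<Rightarrow> real^'m \<Rightarrow> real"
  assumes "bilinear q"
  shows "q u v = (\<Sum>i\<in>UNIV. \<Sum>j\<in>UNIV. u $ i * v $ j * q (axis i 1) (axis j 1))"
proof -
  have e: "w = (\<Sum>i\<in>UNIV. w $ i *\<^sub>R axis i 1)" for w :: "real^'m"
    using basis_expansion[of w] by (simp add: scalar_mult_eq_scaleR)
  have "q u v = (\<Sum>(i,j)\<in>UNIV\<times>UNIV. q (u $ i *\<^sub>R axis i 1) (v $ j *\<^sub>R axis j 1))"
    by (subst e[of u], subst e[of v]) (rule bilinear_sum[OF assms])
  then show ?thesis
    by (simp add: sum.cartesian_product bilinear_simps[OF assms] mult_ac)
qed

lemma form_matrix_frame:
  fixes q :: "real^'m \<Rightarrow> real^'m \<Rightarrow> real"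
    and b :: "'m \<Rightarrow> real^'m"
  assumes "bilinear q"
  shows "transpose (frame_matrix b) ** form_matrix q ** frame_matrix b = (\<chi> i j. q (b i) (b j))"
proof -
  have "(\<Sum>k\<in>UNIV. (\<Sum>l\<in>UNIV. b i $ l * q (axis l 1) (axis k 1)) * b j $ k) = q (b i) (b j)" for i j
    apply (subst bilinear_axis_expand[OF assms, of "b i" "b j"])
    apply (subst sum.swap)
    apply (simp add: sum_distrib_right)
    apply (intro sum.cong refl)
    apply simp
    done
  then show ?thesis
    by (simp add: vec_eq_iff matrix_matrix_mult_def transpose_def frame_matrix_def form_matrix_def)
qed

text \<open>Orthonormality provides a one-sided inverse \<open>B^T X\<close> of the frame matrix
  \<open>B\<close>, which for square matrices is two-sided; the identity
  \<open>B (B^T X) v = v\<close> is the expansion.\<close>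

lemma orthonormal_frame_expand:
  fixes g :: "real^'m \<Rightarrow> real^'m \<Rightarrow> real" and b :: "'m \<Rightarrow> real^'m"
  assumes g: "bilinear g" and b: "\<And>i j. g (b i) (b j) = (if i = j then 1 else 0)"
  shows "v = (\<Sum>i\<in>UNIV. g (b i) v *\<^sub>R b i)"
proof -
  let ?B = "frame_matrix b" and ?X = "form_matrix g"
  have "transpose ?B ** ?X ** ?B = mat 1"
    by (simp add: form_matrix_frame[OF g] b mat_def)
  then have "?B ** (transpose ?B ** ?X) = mat 1"
    by (simp add: matrix_left_right_inverse)
  then have "v = ?B *v ((transpose ?B ** ?X) *v v)"
    by (simp add: matrix_vector_mul_assoc)
  moreover have "((transpose ?B ** ?X) *v v) $ i = g (b i) v" for i
    apply (subst bilinear_axis_expand[OF g])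
    apply (simp add: matrix_vector_mult_def matrix_matrix_mult_def transpose_def frame_matrix_def form_matrix_def sum_distrib_right)
    apply (subst sum.swap)
    apply (intro sum.cong refl)
    apply simp
    done
  moreover have "?B *v x = (\<Sum>i\<in>UNIV. x $ i *\<^sub>R b i)" for x
    by (simp add: vec_eq_iff matrix_vector_mult_def frame_matrix_def mult.commute)
  ultimately show ?thesis by simp
qed

text \<open>The matrix of the metric induced on the graph of \<open>L\<close>.\<close>

definition gram :: "(real^'m \<Rightarrow> real^'m \<Rightarrow> real) \<Rightarrow> (real^'m \<Rightarrow> 'b::real_inner) \<Rightarrow> real^'m^'m" where
  "gram g L = form_matrix (\<lambda>u v. g u v + L u \<bullet> L v)"

lemma bilinear_add:
  "bilinear p \<Longrightarrow> bilinear q \<Longrightarrow> bilinear (\<lambda>u v. p u v + q u v)"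
  unfolding bilinear_def by (auto intro: linear_compose_add)

text \<open>In the singular frame the Gram matrix becomes diagonal with entries
  \<open>1 + (l i)^2\<close>, and passing to the frame is a congruence by \<open>B\<close>.\<close>

lemma gram_svd:
  fixes g :: "real^'m \<Rightarrow> real^'m \<Rightarrow> real" and L :: "real^'m \<Rightarrow> 'b::real_inner"
    and b :: "'m \<Rightarrow> real^'m"
  assumes g: "bilinear g" and L: "linear L" and s: "svd g L b l"
  defines "B \<equiv> frame_matrix b" and "E \<equiv> (\<chi> i j. if i = j then 1 / (1 + (l i)\<^sup>2) else 0) :: real^'m^'m"
  shows "det (gram g L) > 0" and "matrix_inv (gram g L) = B ** E ** transpose B"
proof -
  define D :: "real^'m^'m" where "D = (\<chi> i j. if i = j then 1 + (l i)\<^sup>2 else 0)"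
  have hp: "1 + (l i)\<^sup>2 > 0" for i by (simp add: add_pos_nonneg)
  have BGB: "transpose B ** gram g L ** B = D"
    unfolding B_def gram_def D_def
    by (subst form_matrix_frame)
      (auto simp: vec_eq_iff svdD[OF s] intro!: bilinear_add g bilinear_pullback[OF bilinear_inner] L)
  have "det D = (\<Prod>i\<in>UNIV. 1 + (l i)\<^sup>2)"
    by (subst det_diagonal) (auto simp: D_def)
  then have "det D > 0" by (simp add: prod_pos hp)
  moreover have "det D = (det B)\<^sup>2 * det (gram g L)"
    unfolding BGB[symmetric] by (simp add: det_mul det_transpose power2_eq_square)
  ultimately show "det (gram g L) > 0"
    by (metis zero_less_mult_pos zero_le_power2 less_eq_real_def mult_zero_left less_irrefl)
  have DE: "D ** E = mat 1"
  proof -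
    have "D $ i $ k * E $ k $ j = (if k = i then (if i = j then 1 else 0) else 0)" for i j k
      using hp[of i] by (auto simp: D_def E_def)
    then show ?thesis by (simp add: vec_eq_iff matrix_matrix_mult_def mat_def)
  qed
  \<comment> \<open>For square matrices a right inverse is also a left inverse, which moves
    \<open>transpose B\<close> to the other end of the product.\<close>
  have "transpose B ** (gram g L ** B ** E) = mat 1"
    using DE unfolding BGB[symmetric] by (simp add: matrix_mul_assoc)
  then have "(gram g L ** B ** E) ** transpose B = mat 1"
    by (simp add: matrix_left_right_inverse)
  then show "matrix_inv (gram g L) = B ** E ** transpose B"
    by (intro matrix_inv_eqI) (simp add: matrix_mul_assoc)
qed

lemma trace_mul_commute:
  fixes X Y :: "real^'m^'m"
  shows "trace (X ** Y) = trace (Y ** X)"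
  unfolding trace_def matrix_matrix_mult_def by (simp, subst sum.swap) (simp add: mult.commute)

text \<open>Cyclicity of the trace moves \<open>B\<close> around, so that the forms are evaluated on
  the frame and weighted by the diagonal inverse.\<close>

lemma trace_inv_gram:
  fixes g :: "real^'m \<Rightarrow> real^'m \<Rightarrow> real" and L :: "real^'m \<Rightarrow> 'b::real_inner"
    and b :: "'m \<Rightarrow> real^'m"
  assumes g: "bilinear g" and L: "linear L" and s: "svd g L b l" and p: "bilinear p" and q: "bilinear q"
  shows "trace (matrix_inv (gram g L) ** form_matrix p) = (\<Sum>i\<in>UNIV. 1 / (1 + (l i)\<^sup>2) * p (b i) (b i))"
    and "trace (matrix_inv (gram g L) ** form_matrix p ** matrix_inv (gram g L) ** form_matrix q)
      = (\<Sum>i\<in>UNIV. \<Sum>j\<in>UNIV. 1 / (1 + (l i)\<^sup>2) * (1 / (1 + (l j)\<^sup>2)) * (p (b i) (b j) * q (b j) (b i)))"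
proof -
  let ?B = "frame_matrix b" and ?E = "(\<chi> i j. if i = j then 1 / (1 + (l i)\<^sup>2) else 0) :: real^'m^'m"
  define P where "P = transpose ?B ** form_matrix p ** ?B"
  define Q where "Q = transpose ?B ** form_matrix q ** ?B"
  have P: "P = (\<chi> i j. p (b i) (b j))" and Q: "Q = (\<chi> i j. q (b i) (b j))"
    unfolding P_def Q_def by (rule form_matrix_frame[OF p] form_matrix_frame[OF q])+
  have EX: "(?E ** X) $ i $ j = 1 / (1 + (l i)\<^sup>2) * X $ i $ j" for X :: "real^'m^'m" and i j
    by (simp add: matrix_matrix_mult_def if_distrib[of "\<lambda>x. x * _"] sum.delta cong: if_cong)
  have "trace (matrix_inv (gram g L) ** form_matrix p) = trace (?B ** (?E ** transpose ?B ** form_matrix p))"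
    unfolding gram_svd(2)[OF g L s] by (simp add: matrix_mul_assoc)
  also have "\<dots> = trace (?E ** P)"
    unfolding P_def by (subst trace_mul_commute) (simp add: matrix_mul_assoc)
  also have "\<dots> = (\<Sum>i\<in>UNIV. 1 / (1 + (l i)\<^sup>2) * p (b i) (b i))"
    unfolding trace_def EX by (simp add: P)
  finally show "trace (matrix_inv (gram g L) ** form_matrix p) = (\<Sum>i\<in>UNIV. 1 / (1 + (l i)\<^sup>2) * p (b i) (b i))" .
  have "trace (matrix_inv (gram g L) ** form_matrix p ** matrix_inv (gram g L) ** form_matrix q)
     = trace (?B ** (?E ** transpose ?B ** form_matrix p ** ?B ** ?E ** transpose ?B ** form_matrix q))"
    unfolding gram_svd(2)[OF g L s] by (simp add: matrix_mul_assoc)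
  also have "\<dots> = trace ((?E ** P) ** (?E ** Q))"
    unfolding P_def Q_def by (subst trace_mul_commute) (simp add: matrix_mul_assoc)
  also have "\<dots> = (\<Sum>i\<in>UNIV. \<Sum>j\<in>UNIV. 1 / (1 + (l i)\<^sup>2) * (1 / (1 + (l j)\<^sup>2)) * (p (b i) (b j) * q (b j) (b i)))"
    unfolding trace_def matrix_matrix_mult_def[of "?E ** P"] by (simp add: EX P Q)
  finally show "trace (matrix_inv (gram g L) ** form_matrix p ** matrix_inv (gram g L) ** form_matrix q)
      = (\<Sum>i\<in>UNIV. \<Sum>j\<in>UNIV. 1 / (1 + (l i)\<^sup>2) * (1 / (1 + (l j)\<^sup>2)) * (p (b i) (b j) * q (b j) (b i)))" .
qed


section \<open>The first variation of area and its monotonicity\<close>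

text \<open>The derivative of the area integrand \<open>sqrt (det (gram g L))\<close> at
  \<open>L\<close> in the direction \<open>N\<close>.\<close>

definition flux :: "(real^'m \<Rightarrow> real^'m \<Rightarrow> real) \<Rightarrow> (real^'m \<Rightarrow> 'b::real_inner) \<Rightarrow> (real^'m \<Rightarrow> 'b) \<Rightarrow> real" where
  "flux g L N = sqrt (det (gram g L)) * trace (matrix_inv (gram g L) ** form_matrix (\<lambda>u v. L u \<bullet> N v))"

text \<open>The second derivative of the area integrand along \<open>N\<close>, divided by the
  integrand. The squared trace comes from differentiating the determinant, the last trace from
  differentiating the inverse.\<close>

definition second_variation :: "(real^'m \<Rightarrow> real^'m \<Rightarrow> real) \<Rightarrow> (real^'m \<Rightarrow> 'b::real_inner) \<Rightarrow> (real^'m \<Rightarrow> 'b) \<Rightarrow> real" where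
  "second_variation g L N = (let H = matrix_inv (gram g L); M = form_matrix (\<lambda>u v. L u \<bullet> N v) in
     (trace (H ** M))\<^sup>2 + trace (H ** form_matrix (\<lambda>u v. N u \<bullet> N v))
     - trace (H ** form_matrix (\<lambda>u v. L u \<bullet> N v + N u \<bullet> L v) ** H ** M))"

lemma gram_sym:
  "(\<And>u v. g u v = g v u) \<Longrightarrow> transpose (gram g L) = gram g L"
  by (simp add: gram_def form_matrix_def transpose_def vec_eq_iff inner_commute)

lemma matrix_inv_gram_sym:
  assumes "\<And>u v. g u v = g v u" "det (gram g L) \<noteq> 0"
  shows "transpose (matrix_inv (gram g L)) = matrix_inv (gram g L)"
  using transpose_matrix_inv[OF assms(2)] gram_sym[of g L, OF assms(1)] by simp

lemma det_gram_pos: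
  fixes g :: "real^'m \<Rightarrow> real^'m \<Rightarrow> real" and L :: "real^'m \<Rightarrow> 'b::real_inner"
  assumes "pos_def_form g" "linear L"
  shows "det (gram g L) > 0"
  using svd_exists[OF assms] gram_svd(1)[OF pos_def_formD(1)[OF assms(1)] assms(2)] by blast

lemma trace_sym_mult:
  fixes H X :: "real^'m^'m"
  assumes "transpose H = H"
  shows "trace (H ** transpose X) = trace (H ** X)"
proof -
  have "trace (H ** transpose X) = trace (transpose (X ** H))"
    by (simp add: matrix_transpose_mul assms)
  also have "\<dots> = trace (X ** H)" by (simp add: trace_def transpose_def)
  finally show ?thesis by (simp add: trace_mul_commute)
qed

lemma form_matrix_add: "form_matrix (\<lambda>u v. p u v + q u v) = form_matrix p + form_matrix q"
  by (simp add: form_matrix_def vec_eq_iff)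

lemma transpose_form_matrix: "transpose (form_matrix p) = form_matrix (\<lambda>u v. p v u)"
  by (simp add: form_matrix_def vec_eq_iff transpose_def)

lemma bounded_linear_trace: "bounded_linear (trace :: real^'m^'m \<Rightarrow> real)"
  by (intro linear_linear[THEN iffD2] linearI) (simp_all add: trace_def sum.distrib sum_distrib_left)

text \<open>The derivative \<open>M2\<close> of the Gram matrix is \<open>M t\<close> plus its
  transpose, and \<open>H\<close> is symmetric. Differentiating the square root of the determinant
  therefore contributes a second factor \<open>trace (H ** M t)\<close>.\<close>

lemma flux_has_derivative:
  fixes g :: "real^'m \<Rightarrow> real^'m \<Rightarrow> real" and L N :: "real^'m \<Rightarrow> 'b::real_inner"
  assumes g: "pos_def_form g" and L: "linear L" and N: "linear N"
  defines "Lt \<equiv> \<lambda>t v. L v + t *\<^sub>R N v"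
  shows "((\<lambda>t. flux g (Lt t) N) has_real_derivative
           sqrt (det (gram g (Lt t))) * second_variation g (Lt t) N) (at t)"
proof -
  define G where "G t = gram g (Lt t)" for t
  define M where "M t = form_matrix (\<lambda>u v. Lt t u \<bullet> N v)" for t
  define R where "R = form_matrix (\<lambda>u v. N u \<bullet> N v)"
  define M2 where "M2 = form_matrix (\<lambda>u v. Lt t u \<bullet> N v + N u \<bullet> Lt t v)"
  define H where "H = matrix_inv (G t)"
  have lin: "linear (Lt s)" for s
    unfolding Lt_def by (intro linear_compose_add L linear_compose_scale_right N)
  have dp: "det (G s) > 0" for s unfolding G_def by (rule det_gram_pos[OF g lin])
  have dG: "(G has_derivative (\<lambda>s. s *\<^sub>R M2)) (at t)"
    by (rule has_derivative_matrixI)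
      (auto simp: G_def gram_def form_matrix_def Lt_def M2_def algebra_simps inner_add_left inner_add_right
          intro!: derivative_eq_intros)
  have dM: "(M has_derivative (\<lambda>s. s *\<^sub>R R)) (at t)"
    by (rule has_derivative_matrixI)
      (auto simp: M_def form_matrix_def Lt_def R_def algebra_simps inner_add_left inner_add_right
          intro!: derivative_eq_intros)
  have dp': "det (G t) \<noteq> 0" using dp[of t] by simp
  have dH: "((\<lambda>s. matrix_inv (G s)) has_derivative (\<lambda>s. - (H ** (s *\<^sub>R M2) ** H))) (at t)"
    unfolding H_def by (rule has_derivative_matrix_inv[OF dG dp'])
  have dT: "((\<lambda>s. trace (matrix_inv (G s) ** M s)) has_derivative
      (\<lambda>s. trace (H ** (s *\<^sub>R R) + - (H ** (s *\<^sub>R M2) ** H) ** M t))) (at t)"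
    unfolding H_def
    by (rule bounded_linear.has_derivative[OF bounded_linear_trace
          bounded_bilinear.FDERIV[OF bounded_bilinear_matrix_mult dH[unfolded H_def] dM]])
  have dV: "((\<lambda>s. sqrt (det (G s))) has_derivative
      (\<lambda>s. det (G t) * trace (H ** (s *\<^sub>R M2)) * (inverse (sqrt (det (G t))) / 2))) (at t)"
    unfolding H_def
    using has_derivative_compose[OF has_derivative_det[OF dG dp'] DERIV_real_sqrt[OF dp[of t], unfolded has_field_derivative_def]]
    by (simp add: mult_ac)
  have Hs: "transpose H = H"
    unfolding H_def G_def by (rule matrix_inv_gram_sym) (use pos_def_formD(2)[OF g] dp' in \<open>auto simp: G_def\<close>)
  have M2: "M2 = M t + transpose (M t)"
    unfolding M2_def M_def form_matrix_add transpose_form_matrix by (simp add: inner_commute)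
  have lt: "trace (s *\<^sub>R X) = s * trace X" "trace (X + Y) = trace X + trace Y" "trace (- X) = - trace X" for s and X Y :: "real^'m^'m"
    by (simp_all add: trace_def sum_distrib_left sum.distrib sum_negf)
  have sc: "X ** (s *\<^sub>R Y) = s *\<^sub>R (X ** Y)" "(s *\<^sub>R X) ** Y = s *\<^sub>R (X ** Y)" "(- X) ** Y = - (X ** Y)"
     "X ** (Y + Z) = X ** Y + X ** Z" for s and X Y Z :: "real^'m^'m"
    by (simp_all add: vec_eq_iff matrix_matrix_mult_def sum_distrib_left mult_ac sum_negf distrib_left sum.distrib)
  have tM2: "trace (H ** M2) = 2 * trace (H ** M t)"
    unfolding M2 sc lt by (simp add: trace_sym_mult[OF Hs])
  have sd: "det (G t) * (inverse (sqrt (det (G t)))) = sqrt (det (G t))"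
    using dp[of t] real_sqrt_mult_self[of "det (G t)"] by (simp add: field_simps)
  have "((\<lambda>s. sqrt (det (G s)) * trace (matrix_inv (G s) ** M s)) has_derivative
     (\<lambda>s. sqrt (det (G t)) * trace (H ** (s *\<^sub>R R) + - (H ** (s *\<^sub>R M2) ** H) ** M t)
        + det (G t) * trace (H ** (s *\<^sub>R M2)) * (inverse (sqrt (det (G t))) / 2) * trace (matrix_inv (G t) ** M t))) (at t)"
    by (rule has_derivative_mult[OF dV dT])
  moreover have "sqrt (det (G t)) * trace (H ** (s *\<^sub>R R) + - (H ** (s *\<^sub>R M2) ** H) ** M t)
        + det (G t) * trace (H ** (s *\<^sub>R M2)) * (inverse (sqrt (det (G t))) / 2) * trace (matrix_inv (G t) ** M t)
     = sqrt (det (G t)) * second_variation g (Lt t) N * s" for s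
  proof -
    have "det (G t) * trace (H ** (s *\<^sub>R M2)) * (inverse (sqrt (det (G t))) / 2) * trace (matrix_inv (G t) ** M t)
       = (det (G t) * (inverse (sqrt (det (G t))))) * (s * (trace (H ** M t))\<^sup>2)"
      unfolding sc lt tM2 H_def[symmetric] by (simp add: power2_eq_square)
    also have "\<dots> = sqrt (det (G t)) * (s * (trace (H ** M t))\<^sup>2)" unfolding sd ..
    finally have e: "det (G t) * trace (H ** (s *\<^sub>R M2)) * (inverse (sqrt (det (G t))) / 2) * trace (matrix_inv (G t) ** M t)
       = sqrt (det (G t)) * (s * (trace (H ** M t))\<^sup>2)" .
    show ?thesis
      unfolding e unfolding second_variation_def Let_def G_def[symmetric] H_def[symmetric] M_def[symmetric] R_def[symmetric] M2_def[symmetric] sc lt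
      by (simp add: algebra_simps)
  qed
  ultimately show ?thesis
    unfolding has_field_derivative_def flux_def G_def[symmetric] M_def[symmetric] by simp
qed

lemma bessel_orthonormal_or_zero:
  fixes c :: "'i::finite \<Rightarrow> 'b::real_inner"
  assumes "\<And>i j. i \<noteq> j \<Longrightarrow> c i \<bullet> c j = 0" "\<And>i. c i = 0 \<or> c i \<bullet> c i = 1"
  shows "(\<Sum>i\<in>UNIV. (c i \<bullet> y)\<^sup>2) \<le> y \<bullet> y"
proof -
  define s where "s = (\<Sum>i\<in>UNIV. (c i \<bullet> y) *\<^sub>R c i)"
  have cs: "c i \<bullet> s = c i \<bullet> y" for i
  proof -
    have "c i \<bullet> s = (\<Sum>j\<in>UNIV. if j = i then c i \<bullet> y else 0)"
      unfolding s_def inner_sum_right using assms(1)[of i] assms(2)[of i] by (intro sum.cong) auto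
    then show ?thesis by simp
  qed
  have "s \<bullet> s = (\<Sum>i\<in>UNIV. (c i \<bullet> y)\<^sup>2)"
    by (subst (1) s_def) (simp add: inner_sum_left cs power2_eq_square)
  moreover have "y \<bullet> s = (\<Sum>i\<in>UNIV. (c i \<bullet> y)\<^sup>2)"
    unfolding s_def by (simp add: inner_sum_right inner_commute power2_eq_square)
  ultimately have "(y - s) \<bullet> (y - s) = y \<bullet> y - (\<Sum>i\<in>UNIV. (c i \<bullet> y)\<^sup>2)"
    by (simp add: inner_diff_left inner_diff_right inner_commute)
  then show ?thesis using inner_ge_zero[of "y - s"] by linarith
qed

text \<open>Left singular vectors; \<open>0\<close> where \<open>l i = 0\<close>.\<close>

definition svd_left :: "(real^'m \<Rightarrow> 'b::real_inner) \<Rightarrow> ('m \<Rightarrow> real^'m) \<Rightarrow> ('m \<Rightarrow> real) \<Rightarrow> 'm \<Rightarrow> 'b" where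
  "svd_left L b l i = inverse (l i) *\<^sub>R L (b i)"

lemma svd_left:
  assumes "svd g L b l"
  shows "L (b i) = l i *\<^sub>R svd_left L b l i"
    and "i \<noteq> j \<Longrightarrow> svd_left L b l i \<bullet> svd_left L b l j = 0"
    and "svd_left L b l i = 0 \<or> svd_left L b l i \<bullet> svd_left L b l i = 1"
    and "(\<Sum>i\<in>UNIV. (svd_left L b l i \<bullet> y)\<^sup>2) \<le> y \<bullet> y"
proof -
  show "L (b i) = l i *\<^sub>R svd_left L b l i"
    using svdD(3)[OF assms, of i i] by (cases "l i = 0") (auto simp: svd_left_def)
  show 1: "i \<noteq> j \<Longrightarrow> svd_left L b l i \<bullet> svd_left L b l j = 0" for i j
    using svdD(3)[OF assms, of i j] by (simp add: svd_left_def)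
  show 2: "svd_left L b l i = 0 \<or> svd_left L b l i \<bullet> svd_left L b l i = 1" for i
    using svdD(3)[OF assms, of i i] by (cases "l i = 0") (simp_all add: svd_left_def power2_eq_square field_simps)
  show "(\<Sum>i\<in>UNIV. (svd_left L b l i \<bullet> y)\<^sup>2) \<le> y \<bullet> y"
    by (rule bessel_orthonormal_or_zero[OF 1 2])
qed

lemma second_variation_svd:
  fixes g :: "real^'m \<Rightarrow> real^'m \<Rightarrow> real" and L N :: "real^'m \<Rightarrow> 'b::real_inner"
  assumes g: "bilinear g" and L: "linear L" and N: "linear N" and s: "svd g L b l"
  shows "second_variation g L N = hessian_form l (\<lambda>i j. svd_left L b l i \<bullet> N (b j)) (\<lambda>j. N (b j) \<bullet> N (b j))"
proof -
  note b1 = bilinear_pullback[OF bilinear_inner L N] and b2 = bilinear_pullback[OF bilinear_inner N L]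
    and b3 = bilinear_pullback[OF bilinear_inner N N]
  have e: "L (b i) \<bullet> N (b j) = l i * (svd_left L b l i \<bullet> N (b j))" for i j
    by (subst svd_left(1)[OF s]) simp
  have e': "N (b i) \<bullet> L (b j) = l j * (svd_left L b l j \<bullet> N (b i))" for i j
    using e[of j i] by (simp add: inner_commute)
  show ?thesis
    unfolding second_variation_def Let_def hessian_form_def
      trace_inv_gram(1)[OF g L s b1 b1] trace_inv_gram(1)[OF g L s b3 b3] trace_inv_gram(2)[OF g L s bilinear_add[OF b1 b2] b1]
      e e' by simp
qed

text \<open>Sufficient for the Hessian of the area integrand to be nonnegative at a map with singular values \<open>l\<close>.\<close>

definition convex_spectrum :: "('i::finite \<Rightarrow> real) \<Rightarrow> bool" where
  "convex_spectrum l \<longleftrightarrow> (\<forall>i. l i \<le> 1) \<or>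
     (\<exists>k. l k > 1 \<and> (\<forall>i. i \<noteq> k \<longrightarrow> ((l k)\<^sup>2 - 1) * (\<Sum>j\<in>UNIV - {k}. (l j)\<^sup>2) < 1 - (l i)\<^sup>2))"

lemma svd_norm_expand:
  fixes g :: "real^'m \<Rightarrow> real^'m \<Rightarrow> real" and L :: "real^'m \<Rightarrow> 'b::real_inner"
    and b :: "'m \<Rightarrow> real^'m"
  assumes g: "bilinear g" and L: "linear L" and s: "svd g L b l"
  shows "L v \<bullet> L v = (\<Sum>i\<in>UNIV. (g (b i) v)\<^sup>2 * (l i)\<^sup>2)" and "g v v = (\<Sum>i\<in>UNIV. (g (b i) v)\<^sup>2)"
proof -
  have v: "v = (\<Sum>i\<in>UNIV. g (b i) v *\<^sub>R b i)"
    using s by (intro orthonormal_frame_expand[OF g]) (auto simp: svdD)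
  have gen: "q v v = (\<Sum>i\<in>UNIV. (g (b i) v)\<^sup>2 * c i)" if q: "bilinear q" "\<And>i j. q (b i) (b j) = (if i = j then c i else 0)"
    for q :: "real^'m \<Rightarrow> real^'m \<Rightarrow> real" and c
  proof -
    have "q v v = (\<Sum>(i,j)\<in>UNIV\<times>UNIV. q (g (b i) v *\<^sub>R b i) (g (b j) v *\<^sub>R b j))"
      using arg_cong2[where f = q, OF v v] unfolding bilinear_sum[OF q(1)] .
    also have "\<dots> = (\<Sum>i\<in>UNIV. \<Sum>j\<in>UNIV. if j = i then (g (b i) v)\<^sup>2 * c i else 0)"
      unfolding sum.cartesian_product[symmetric]
      by (intro sum.cong refl) (auto simp: bilinear_simps[OF q(1)] q(2) power2_eq_square)
    finally show ?thesis by simp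
  qed
  show "L v \<bullet> L v = (\<Sum>i\<in>UNIV. (g (b i) v)\<^sup>2 * (l i)\<^sup>2)"
    by (rule gen[of "\<lambda>u v. L u \<bullet> L v" "\<lambda>i. (l i)\<^sup>2"]) (auto simp: svdD[OF s] intro!: bilinear_pullback[OF bilinear_inner] L)
  show "g v v = (\<Sum>i\<in>UNIV. (g (b i) v)\<^sup>2)"
    using gen[of g "\<lambda>i. 1"] g by (auto simp: svdD[OF s])
qed

lemma linear_zero_on_frame:
  fixes g :: "real^'m \<Rightarrow> real^'m \<Rightarrow> real" and N :: "real^'m \<Rightarrow> 'b::real_vector"
    and b :: "'m \<Rightarrow> real^'m"
  assumes g: "bilinear g" and b: "\<And>i j. g (b i) (b j) = (if i = j then 1 else 0)"
    and N: "linear N" "\<And>i. N (b i) = 0"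
  shows "N v = 0"
  by (subst orthonormal_frame_expand[OF g b]) (simp add: linear_sum[OF N(1)] linear_cmul[OF N(1)] N(2))

text \<open>The last two claims are two ways to exclude the degenerate directions of a contraction.
  If some vector is lengthened, a singular value exceeds \<open>1\<close> and the form is definite.
  Otherwise it is enough that no vector of preserved length changes its length to first order along
  \<open>N\<close>: the surviving block is symmetric, and the condition annihilates its quadratic
  form.\<close>

lemma second_variation_nonneg:
  fixes g :: "real^'m \<Rightarrow> real^'m \<Rightarrow> real" and L N :: "real^'m \<Rightarrow> 'b::real_inner"
    and b :: "'m \<Rightarrow> real^'m"
  assumes g: "bilinear g" and L: "linear L" and N: "linear N" and s: "svd g L b l" and c: "convex_spectrum l"
  shows "second_variation g L N \<ge> 0"
    and "second_variation g L N = 0 \<Longrightarrow> \<exists>v. L v \<bullet> L v > g v v \<Longrightarrow> N = (\<lambda>_. 0)"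
    and "second_variation g L N = 0 \<Longrightarrow> \<forall>v. L v \<bullet> L v = g v v \<longrightarrow> L v \<bullet> N v = 0 \<Longrightarrow> N = (\<lambda>_. 0)"
proof -
  define n where "n = (\<lambda>i j. svd_left L b l i \<bullet> N (b j))"
  define r where "r = (\<lambda>j. N (b j) \<bullet> N (b j))"
  have eq: "second_variation g L N = hessian_form l n r"
    unfolding n_def r_def by (rule second_variation_svd[OF g L N s])
  have bes: "(\<Sum>i\<in>UNIV. (n i j)\<^sup>2) \<le> r j" for j
    unfolding n_def r_def by (rule svd_left(4)[OF s])
  have N0: "N = (\<lambda>_. 0)" if "\<And>j. r j = 0"
    using linear_zero_on_frame[OF g svdD(2)[OF s] N] that by (auto simp: r_def)
  have l0: "0 \<le> l i" for i by (rule svdD(1)[OF s])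
  have A: "second_variation g L N \<ge> 0 \<and> (second_variation g L N = 0 \<longrightarrow> N = (\<lambda>_. 0))" if l: "\<not> (\<forall>i. l i \<le> 1)"
  proof -
    obtain k where k: "l k > 1" "\<And>i. i \<noteq> k \<Longrightarrow> ((l k)\<^sup>2 - 1) * (\<Sum>j\<in>UNIV - {k}. (l j)\<^sup>2) < 1 - (l i)\<^sup>2"
      using c l unfolding convex_spectrum_def by blast
    show ?thesis
      using hessian_form_expanding[where l = l and n = n and r = r, OF l0 k bes] N0 unfolding eq by blast
  qed
  have B: "second_variation g L N \<ge> 0" if l: "\<forall>i. l i \<le> 1"
    using hessian_form_contraction(1)[where l = l and n = n and r = r, OF l0 _ bes] l unfolding eq by blast
  show "second_variation g L N \<ge> 0" using A B by blast
  {
    assume z: "second_variation g L N = 0" and v: "\<exists>v. L v \<bullet> L v > g v v"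
    have "\<not> (\<forall>i. l i \<le> 1)"
    proof
      assume l: "\<forall>i. l i \<le> 1"
      from v obtain v where "L v \<bullet> L v > g v v" by blast
      moreover have "(\<Sum>i\<in>UNIV. (g (b i) v)\<^sup>2 * (l i)\<^sup>2) \<le> (\<Sum>i\<in>UNIV. (g (b i) v)\<^sup>2 * 1)"
        using l l0 by (intro sum_mono mult_left_mono) (auto simp: power_le_one)
      ultimately show False using svd_norm_expand[OF g L s, of v] by simp
    qed
    with A z show "N = (\<lambda>_. 0)" by blast
  }
  assume z: "second_variation g L N = 0" and v: "\<forall>v. L v \<bullet> L v = g v v \<longrightarrow> L v \<bullet> N v = 0"
  show "N = (\<lambda>_. 0)"
  proof (cases "\<forall>i. l i \<le> 1")
    case True
    have h: "n i j = n j i \<and> (l i * l j < 1 \<longrightarrow> n i j = 0) \<and> r j = (\<Sum>i\<in>UNIV. (n i j)\<^sup>2)" for i j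
      using hessian_form_contraction(2)[where l = l and n = n and r = r, OF l0 _ bes] True z unfolding eq by blast
    have Lb: "L (b i) \<bullet> N (b j) = l i * n i j" for i j
      unfolding n_def by (subst svd_left(1)[OF s]) simp
    have d: "n i i = 0" for i
    proof (cases "l i = 1")
      case True
      then have "L (b i) \<bullet> N (b i) = 0" using v svdD[OF s] by simp
      then show ?thesis using Lb True by simp
    next
      case False
      then have "l i < 1" using \<open>\<forall>i. l i \<le> 1\<close> less_eq_real_def by blast
      then have "l i * l i < 1" using l0[of i] mult_strict_mono'[of "l i" 1 "l i" 1] by simp
      then show ?thesis using h by blast
    qed
    have "n i j = 0" for i j
    proof (cases "i = j \<or> l i * l j < 1")
      case True
      then show ?thesis using d h by blast
    next
      case False
      then have ij: "i \<noteq> j" and p: "l i * l j \<ge> 1" by auto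
      have "l i * l j \<le> l i" "l i * l j \<le> l j"
        using \<open>\<forall>i. l i \<le> 1\<close> l0 by (auto simp: mult_left_le mult_right_le_one_le mult_left_le_one_le)
      then have 1: "l i = 1" "l j = 1" using p \<open>\<forall>i. l i \<le> 1\<close> by (auto intro: antisym order_trans)
      \<comment> \<open>Polarisation: \<open>w\<close> is again a vector of preserved length, and
        with the diagonal entries gone \<open>L w \<bullet> N w\<close> is
        \<open>n i j + n j i\<close>, by symmetry twice \<open>n i j\<close>.\<close>
      define w where "w = b i + b j"
      have "L w \<bullet> L w = g w w"
        unfolding w_def using ij 1
        by (simp add: linear_add[OF L] inner_add_left inner_add_right svdD[OF s] bilinear_simps[OF g])
      then have "L w \<bullet> N w = 0" using v by blast
      then have "n i i + n i j + (n j i + n j j) = 0"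
        unfolding w_def by (simp add: linear_add[OF L] linear_add[OF N] inner_add_left inner_add_right Lb 1)
      then show ?thesis using d h[of i j] by simp
    qed
    then show ?thesis using N0 h by simp
  next
    case False
    then show ?thesis using A z by blast
  qed
qed

text \<open>The flux along the segment has a nonnegative derivative. Equal end values make it
  constant, so the second variation vanishes at every interior point; the freedom to choose that
  point is what yields strictness.\<close>

lemma flux_monotone:
  fixes g :: "real^'m \<Rightarrow> real^'m \<Rightarrow> real" and L0 L1 :: "real^'m \<Rightarrow> 'b::real_inner"
  assumes g: "pos_def_form g" and L0: "linear L0" and L1: "linear L1"
    and c: "\<And>t b l. t \<in> {0<..<1} \<Longrightarrow> svd g (\<lambda>v. L0 v + t *\<^sub>R (L1 v - L0 v)) (b :: 'm \<Rightarrow> real^'m) l \<Longrightarrow> convex_spectrum l"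
  defines "N \<equiv> \<lambda>v. L1 v - L0 v"
  shows "flux g L0 N \<le> flux g L1 N" and "flux g L0 N = flux g L1 N \<Longrightarrow> L0 = L1"
proof -
  note bg = pos_def_formD(1)[OF g]
  define Lt where "Lt = (\<lambda>t v. L0 v + t *\<^sub>R N v)"
  have N: "linear N" unfolding N_def by (rule linear_compose_sub[OF L1 L0])
  have lin: "linear (Lt t)" for t
    unfolding Lt_def by (intro linear_compose_add L0 linear_compose_scale_right N)
  define f where "f t = flux g (Lt t) N" for t
  define f' where "f' t = sqrt (det (gram g (Lt t))) * second_variation g (Lt t) N" for t
  have df: "(f has_real_derivative f' t) (at t)" for t
    unfolding f_def f'_def Lt_def by (rule flux_has_derivative[OF g L0 N])
  have dp: "det (gram g (Lt t)) > 0" for t by (rule det_gram_pos[OF g lin])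
  have sv: "\<exists>b l. svd g (Lt t) (b :: 'm \<Rightarrow> real^'m) l \<and> convex_spectrum l" if "t \<in> {0<..<1}" for t
    using svd_exists[OF g lin, of t] c[OF that] unfolding Lt_def N_def by blast
  have nn: "f' t \<ge> 0" if t: "t \<in> {0<..<1}" for t
    using sv[OF t] second_variation_nonneg(1)[OF bg lin N] dp[of t] unfolding f'_def by auto
  have cont: "continuous_on X f" for X
    using df by (meson DERIV_continuous continuous_at_imp_continuous_on)
  have mono: "f s \<le> f t" if "0 \<le> s" "s \<le> t" "t \<le> 1" for s t
  proof (rule DERIV_nonneg_imp_increasing_open[OF that(2) _ cont])
    fix x assume "s < x" "x < t"
    then have "x \<in> {0<..<1}" using that by auto
    then show "\<exists>y. (f has_real_derivative y) (at x) \<and> 0 \<le> y" using df nn by blast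
  qed
  have f01: "f 0 = flux g L0 N" "f 1 = flux g L1 N" by (simp_all add: f_def Lt_def N_def)
  show "flux g L0 N \<le> flux g L1 N" using mono[of 0 1] f01 by simp
  assume "flux g L0 N = flux g L1 N"
  then have fc: "f t = f 0" if "0 \<le> t" "t \<le> 1" for t
    using mono[of 0 t] mono[of t 1] that f01 by simp
  have z: "second_variation g (Lt t) N = 0" if t: "t \<in> {0<..<1}" for t
  proof -
    have "((\<lambda>_. f 0) has_real_derivative f' t) (at t)"
      by (rule DERIV_cong_ev[THEN iffD1, OF refl _ refl df])
        (use t in \<open>auto simp: eventually_nhds intro!: exI[of _ "{0<..<1}"] fc\<close>)
    then have "f' t = 0" using DERIV_unique DERIV_const by blast
    then show ?thesis using dp[of t] by (simp add: f'_def)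
  qed
  have N0: "N = (\<lambda>_. 0)" if t: "t \<in> {0<..<1}" and v: "\<exists>v. Lt t v \<bullet> Lt t v > g v v" for t
    using sv[OF t] second_variation_nonneg(2)[OF bg lin N _ _ z[OF t] v] by blast
  have "N = (\<lambda>_. 0)"
  proof (cases "\<forall>v. Lt (1/2) v \<bullet> Lt (1/2) v = g v v \<longrightarrow> Lt (1/2) v \<bullet> N v = 0")
    case True
    have h: "(1/2 :: real) \<in> {0<..<1}" by simp
    show ?thesis using sv[OF h] second_variation_nonneg(3)[OF bg lin N _ _ z[OF h] True] by blast
  next
    case False
    then obtain v where v: "Lt (1/2) v \<bullet> Lt (1/2) v = g v v" "Lt (1/2) v \<bullet> N v \<noteq> 0" by blast
    \<comment> \<open>The squared length of \<open>Lt t v\<close> is a quadratic polynomial in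
      \<open>t\<close> with nonzero slope at \<open>1/2\<close> and nonnegative leading coefficient,
      so any step in the increasing direction lengthens \<open>v\<close>. The size
      \<open>1/4\<close> stays inside the open interval.\<close>
    define e where "e = (if Lt (1/2) v \<bullet> N v > 0 then 1/4 else - 1/4 :: real)"
    have e: "e * (Lt (1/2) v \<bullet> N v) > 0" using v(2) by (auto simp: e_def)
    have "Lt (1/2 + e) v = Lt (1/2) v + e *\<^sub>R N v" by (simp add: Lt_def scaleR_add_left)
    then have "Lt (1/2 + e) v \<bullet> Lt (1/2 + e) v = g v v + 2 * (e * (Lt (1/2) v \<bullet> N v)) + e * e * (N v \<bullet> N v)"
      using v(1) by (simp add: inner_add_left inner_add_right inner_commute)
    also have "\<dots> > g v v" using e by (simp add: add_pos_nonneg)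
    finally show ?thesis by (intro N0[of "1/2 + e"]) (auto simp: e_def)
  qed
  then have "N v = 0" for v by simp
  then show "L0 = L1" unfolding N_def by (simp add: fun_eq_iff)
qed


section \<open>Spectral bounds along a segment\<close>

lemma svd_ball:
  fixes g :: "real^'m \<Rightarrow> real^'m \<Rightarrow> real" and L :: "real^'m \<Rightarrow> 'b::real_inner"
    and b :: "'m \<Rightarrow> real^'m"
  assumes g: "bilinear g" and L: "linear L" and s: "svd g L b l" and l: "\<And>i. l i \<le> 1"
  shows "L v \<bullet> L v \<le> g v v"
proof -
  have "(\<Sum>i\<in>UNIV. (g (b i) v)\<^sup>2 * (l i)\<^sup>2) \<le> (\<Sum>i\<in>UNIV. (g (b i) v)\<^sup>2 * 1)"
    using l svdD(1)[OF s] by (intro sum_mono mult_left_mono) (auto simp: power_le_one)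
  then show ?thesis using svd_norm_expand[OF g L s, of v] by simp
qed

text \<open>The pairing of \<open>L\<close> with the partial isometry of another map is at most the
  nuclear norm of \<open>L\<close>. After expanding \<open>b' i\<close> in the frame of
  \<open>L\<close>, the inequality \<open>2 x y \<le> x^2 + y^2\<close>, Parseval for the frames and
  Bessel for the left vectors give each \<open>l k\<close> a coefficient at most
  \<open>1\<close>.\<close>

lemma svd_nuclear_bound:
  fixes g :: "real^'m \<Rightarrow> real^'m \<Rightarrow> real" and L L' :: "real^'m \<Rightarrow> 'b::real_inner"
    and b b' :: "'m \<Rightarrow> real^'m"
  assumes g: "pos_def_form g" and L: "linear L" and L': "linear L'" and s: "svd g L b l" and s': "svd g L' b' l'"
  shows "(\<Sum>i\<in>UNIV. L (b' i) \<bullet> svd_left L' b' l' i) \<le> (\<Sum>i\<in>UNIV. l i)"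
proof -
  note bg = pos_def_formD(1)[OF g]
  define c where "c = svd_left L b l"
  define c' where "c' = svd_left L' b' l'"
  have L1: "L (b' i) \<bullet> c' i = (\<Sum>k\<in>UNIV. l k * (g (b k) (b' i) * (c k \<bullet> c' i)))" for i
  proof -
    have "L (b' i) = L (\<Sum>k\<in>UNIV. g (b k) (b' i) *\<^sub>R b k)"
      by (rule arg_cong[where f = L], rule orthonormal_frame_expand[OF bg svdD(2)[OF s]])
    also have "\<dots> = (\<Sum>k\<in>UNIV. g (b k) (b' i) *\<^sub>R (l k *\<^sub>R c k))"
      by (simp add: linear_sum[OF L] linear_cmul[OF L] svd_left(1)[OF s, folded c_def])
    finally show ?thesis by (simp add: inner_sum_left mult_ac)
  qed
  have cc: "c k \<bullet> c k \<le> 1" for k using svd_left(3)[OF s, folded c_def, of k] by auto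
  have "(\<Sum>i\<in>UNIV. L (b' i) \<bullet> c' i) = (\<Sum>k\<in>UNIV. l k * (\<Sum>i\<in>UNIV. g (b k) (b' i) * (c k \<bullet> c' i)))"
    unfolding L1 by (subst sum.swap) (simp add: sum_distrib_left)
  also have "\<dots> \<le> (\<Sum>k\<in>UNIV. l k * 1)"
  proof (intro sum_mono mult_left_mono svdD(1)[OF s])
    fix k
    have "(\<Sum>i\<in>UNIV. g (b k) (b' i) * (c k \<bullet> c' i)) \<le> (\<Sum>i\<in>UNIV. ((g (b k) (b' i))\<^sup>2 + (c k \<bullet> c' i)\<^sup>2) / 2)"
    proof (rule sum_mono)
      fix i
      show "g (b k) (b' i) * (c k \<bullet> c' i) \<le> ((g (b k) (b' i))\<^sup>2 + (c k \<bullet> c' i)\<^sup>2) / 2"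
        using sum_squares_bound[of "g (b k) (b' i)" "c k \<bullet> c' i"] by simp
    qed
    also have "\<dots> = ((\<Sum>i\<in>UNIV. (g (b' i) (b k))\<^sup>2) + (\<Sum>i\<in>UNIV. (c' i \<bullet> c k)\<^sup>2)) / 2"
      by (simp add: sum.distrib sum_divide_distrib[symmetric] inner_commute pos_def_formD(2)[OF g, of "b k"])
    also have "(\<Sum>i\<in>UNIV. (g (b' i) (b k))\<^sup>2) = 1"
      using svd_norm_expand(2)[OF bg L' s', of "b k"] svdD(2)[OF s, of k k] by simp
    also have "(1 + (\<Sum>i\<in>UNIV. (c' i \<bullet> c k)\<^sup>2)) / 2 \<le> 1"
      using svd_left(4)[OF s', folded c'_def, of "c k"] cc[of k] by simp
    finally show "(\<Sum>i\<in>UNIV. g (b k) (b' i) * (c k \<bullet> c' i)) \<le> 1" by simp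
  qed
  finally show ?thesis by (simp add: c'_def)
qed

text \<open>The Frobenius norm does not depend on the orthonormal frame. The frame is taken from
  another map so that several maps on a segment can be compared on one frame.\<close>

lemma svd_frobenius:
  fixes g :: "real^'m \<Rightarrow> real^'m \<Rightarrow> real" and L :: "real^'m \<Rightarrow> 'b::real_inner"
    and b b' :: "'m \<Rightarrow> real^'m"
  assumes g: "pos_def_form g" and L: "linear L" and s: "svd g L b l" and s': "svd g L' b' l'" and L': "linear L'"
  shows "(\<Sum>i\<in>UNIV. L (b' i) \<bullet> L (b' i)) = (\<Sum>i\<in>UNIV. (l i)\<^sup>2)"
proof -
  note bg = pos_def_formD(1)[OF g]
  have "(\<Sum>i\<in>UNIV. L (b' i) \<bullet> L (b' i)) = (\<Sum>k\<in>UNIV. (\<Sum>i\<in>UNIV. (g (b' i) (b k))\<^sup>2) * (l k)\<^sup>2)"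
    unfolding svd_norm_expand(1)[OF bg L s]
    by (subst sum.swap) (simp add: sum_distrib_right pos_def_formD(2)[OF g, of "b _"])
  also have "\<dots> = (\<Sum>k\<in>UNIV. (l k)\<^sup>2)"
    using svd_norm_expand(2)[OF bg L' s', symmetric] svdD(2)[OF s] by simp
  finally show ?thesis .
qed

text \<open>With \<open>a\<close> the sum of the other values, \<open>l k \<le> 2 - a\<close>, and
  the other squares sum to at most \<open>a^2\<close>. What remains is a polynomial inequality in
  one variable for \<open>0 \<le> a < 1\<close>.\<close>

lemma convex_spectrum_sum:
  fixes l :: "'i::finite \<Rightarrow> real"
  assumes l: "\<And>i. 0 \<le> l i" and s: "(\<Sum>i\<in>UNIV. l i) \<le> 2"
  shows "convex_spectrum l"
proof (cases "\<forall>i. l i \<le> 1")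
  case False
  then obtain k where k: "l k > 1" by (auto simp: not_le)
  define a where "a = (\<Sum>j\<in>UNIV - {k}. l j)"
  have a: "l k \<le> 2 - a" "0 \<le> a" "a < 1"
    using s k l unfolding a_def by (auto simp: sum.remove[of UNIV k] intro: sum_nonneg)
  have la: "l i \<le> a" if "i \<noteq> k" for i
    unfolding a_def using that l by (intro member_le_sum) auto
  have "(\<Sum>j\<in>UNIV - {k}. (l j)\<^sup>2) \<le> (\<Sum>j\<in>UNIV - {k}. l j * a)"
    using la l by (intro sum_mono) (auto simp: power2_eq_square intro: mult_left_mono)
  also have "\<dots> = a\<^sup>2" by (simp add: a_def power2_eq_square sum_distrib_right)
  finally have S: "(\<Sum>j\<in>UNIV - {k}. (l j)\<^sup>2) \<le> a\<^sup>2" .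
  have "(l k)\<^sup>2 \<le> (2 - a)\<^sup>2" using a k by (intro power_mono) auto
  then have lk2: "(l k)\<^sup>2 - 1 \<le> (2 - a)\<^sup>2 - 1" by simp
  have "((l k)\<^sup>2 - 1) * (\<Sum>j\<in>UNIV - {k}. (l j)\<^sup>2) \<le> ((2 - a)\<^sup>2 - 1) * a\<^sup>2"
  proof (rule mult_mono[OF lk2 S])
    show "0 \<le> (2 - a)\<^sup>2 - 1" using a one_le_power[of "2 - a" 2] by simp
  qed (auto intro: sum_nonneg)
  \<comment> \<open>The factorisation isolates the double root \<open>a = 1\<close>, the limiting
    case of two singular values equal to \<open>1\<close>.\<close>
  also have "\<dots> = 1 - a\<^sup>2 - (1 - a)\<^sup>2 * (1 + a + a * (1 - a))"
    by (simp add: power2_eq_square algebra_simps)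
  also have "\<dots> < 1 - a\<^sup>2"
    using a by (simp add: add_pos_nonneg)
  finally have m: "((l k)\<^sup>2 - 1) * (\<Sum>j\<in>UNIV - {k}. (l j)\<^sup>2) < 1 - a\<^sup>2" .
  have "(l i)\<^sup>2 \<le> a\<^sup>2" if "i \<noteq> k" for i using la[OF that] l by (intro power_mono) auto
  with m k show ?thesis unfolding convex_spectrum_def by (force intro: less_le_trans)
qed (auto simp: convex_spectrum_def)

text \<open>With \<open>S\<close> the sum of the other squares,
  \<open>S \<le> 2 - (l k)^2 < 1\<close>, so
  \<open>((l k)^2 - 1) S < (l k)^2 - 1 \<le> 1 - S \<le> 1 - (l i)^2\<close>.\<close>

lemma convex_spectrum_sum_squares:
  fixes l :: "'i::finite \<Rightarrow> real"
  assumes s: "(\<Sum>i\<in>UNIV. (l i)\<^sup>2) \<le> 2"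
  shows "convex_spectrum l"
proof (cases "\<forall>i. l i \<le> 1")
  case False
  then obtain k where k: "l k > 1" by (auto simp: not_le)
  define S where "S = (\<Sum>j\<in>UNIV - {k}. (l j)\<^sup>2)"
  have k2: "(l k)\<^sup>2 > 1" using k by (simp add: one_less_power)
  have S: "(l k)\<^sup>2 + S \<le> 2" using s unfolding S_def by (simp add: sum.remove[of UNIV k])
  have lS: "(l i)\<^sup>2 \<le> S" if "i \<noteq> k" for i
    unfolding S_def using that by (intro member_le_sum) auto
  have "((l k)\<^sup>2 - 1) * S < ((l k)\<^sup>2 - 1) * 1"
    using k2 S by (intro mult_strict_left_mono) auto
  then have "((l k)\<^sup>2 - 1) * S < 1 - (l i)\<^sup>2" if "i \<noteq> k" for i
  proof (rule less_le_trans)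
    show "((l k)\<^sup>2 - 1) * 1 \<le> 1 - (l i)\<^sup>2" using lS[OF that] S by simp
  qed
  with k show ?thesis unfolding convex_spectrum_def S_def by blast
qed (auto simp: convex_spectrum_def)

text \<open>There is no second index to constrain a large value: in dimension one the area integrand
  is convex everywhere.\<close>

lemma convex_spectrum_singleton:
  fixes l :: "'i::finite \<Rightarrow> real"
  assumes "CARD('i) = 1"
  shows "convex_spectrum l"
proof -
  have "i = k" for i k :: 'i
    using assms card_1_singletonE[of "UNIV :: 'i set"] by (metis UNIV_I singletonD)
  then show ?thesis unfolding convex_spectrum_def by (metis not_le)
qed

text \<open>So for \<open>m \<ge> 2\<close> condition (iv) reduces to a special case of (i).\<close>

lemma sum_sqrt_le_imp_zero:
  fixes l :: "'i::finite \<Rightarrow> real"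
  assumes "CARD('i) \<noteq> 1" and s: "(\<Sum>i\<in>UNIV. sqrt (1 + (l i)\<^sup>2)) \<le> 2"
  shows "l i = 0"
proof -
  have "CARD('i) \<ge> 2" using assms(1) zero_less_card_finite[where 'a = 'i] by linarith
  then have "(\<Sum>i\<in>(UNIV::'i set). sqrt (1 + (l i)\<^sup>2) - 1) \<le> 0" using s by (simp add: sum_subtractf)
  moreover have p: "sqrt (1 + (l i)\<^sup>2) - 1 \<ge> 0" for i by simp
  ultimately have "(\<Sum>i\<in>(UNIV::'i set). sqrt (1 + (l i)\<^sup>2) - 1) = 0"
    by (intro antisym sum_nonneg) auto
  then have "sqrt (1 + (l i)\<^sup>2) - 1 = 0" using p by (subst (asm) sum_nonneg_eq_0_iff) auto
  then show ?thesis by simp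
qed

definition spectral_bounds :: "('i::finite \<Rightarrow> real) \<Rightarrow> ('i \<Rightarrow> real) \<Rightarrow> bool" where
  "spectral_bounds l0 l1 \<longleftrightarrow>
     (\<forall>l\<in>{l0, l1}. \<forall>i. l i \<le> 1) \<or>
     (\<forall>l\<in>{l0, l1}. (\<Sum>i\<in>UNIV. l i) \<le> 2) \<or>
     (\<forall>l\<in>{l0, l1}. (\<Sum>i\<in>UNIV. (l i)\<^sup>2) \<le> 2) \<or>
     (\<forall>l\<in>{l0, l1}. (\<Sum>i\<in>UNIV. sqrt (1 + (l i)\<^sup>2)) \<le> 2)"

text \<open>The norms of the intermediate map are computed on its own singular frame, where they can
  be compared with those of \<open>L0\<close> and \<open>L1\<close> term by term.\<close>

lemma convex_spectrum_segment:
  fixes g :: "real^'m \<Rightarrow> real^'m \<Rightarrow> real" and L0 L1 :: "real^'m \<Rightarrow> 'b::real_inner"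
    and b b0 b1 :: "'m \<Rightarrow> real^'m"
  assumes g: "pos_def_form g" and L0: "linear L0" and L1: "linear L1"
    and s0: "svd g L0 b0 l0" and s1: "svd g L1 b1 l1" and c: "spectral_bounds l0 l1"
    and t: "t \<in> {0<..<1}" and s: "svd g (\<lambda>v. L0 v + t *\<^sub>R (L1 v - L0 v)) b l"
  shows "convex_spectrum l"
proof -
  note bg = pos_def_formD(1)[OF g]
  define L where "L = (\<lambda>v. L0 v + t *\<^sub>R (L1 v - L0 v))"
  have Le: "L v = (1 - t) *\<^sub>R L0 v + t *\<^sub>R L1 v" for v
    by (simp add: L_def algebra_simps)
  have L: "linear L" unfolding L_def
    by (intro linear_compose_add L0 linear_compose_scale_right linear_compose_sub L1)
  note s = s[folded L_def]
  have nb: "norm (L (b i)) = l i" for i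
    using svdD(3)[OF s, of i i] svdD(1)[OF s, of i] by (simp add: norm_eq_sqrt_inner)
  have nL: "norm (L v) \<le> (1 - t) * norm (L0 v) + t * norm (L1 v)" for v
    unfolding Le using norm_triangle_ineq[of "(1 - t) *\<^sub>R L0 v" "t *\<^sub>R L1 v"] t by simp
  \<comment> \<open>The left singular vectors of the intermediate map express its nuclear norm as a
    pairing that is linear in the map, so it splits between the endpoints.\<close>
  have nuc: "(\<Sum>i\<in>UNIV. l i) \<le> (1 - t) * (\<Sum>i\<in>UNIV. l0 i) + t * (\<Sum>i\<in>UNIV. l1 i)"
  proof -
    have "l i = L (b i) \<bullet> svd_left L b l i" for i
      using svdD(3)[OF s, of i i] by (cases "l i = 0") (simp_all add: svd_left_def power2_eq_square)
    then have "(\<Sum>i\<in>UNIV. l i) = (\<Sum>i\<in>UNIV. L (b i) \<bullet> svd_left L b l i)" by simp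
    also have "\<dots> = (1 - t) * (\<Sum>i\<in>UNIV. L0 (b i) \<bullet> svd_left L b l i) + t * (\<Sum>i\<in>UNIV. L1 (b i) \<bullet> svd_left L b l i)"
      by (subst Le) (simp add: inner_add_left sum.distrib sum_distrib_left)
    also have "\<dots> \<le> (1 - t) * (\<Sum>i\<in>UNIV. l0 i) + t * (\<Sum>i\<in>UNIV. l1 i)"
      using t svd_nuclear_bound[OF g L0 L s0 s] svd_nuclear_bound[OF g L1 L s1 s]
      by (intro add_mono mult_left_mono) auto
    finally show ?thesis .
  qed
  have fro: "(\<Sum>i\<in>UNIV. (l i)\<^sup>2) \<le> (1 - t) * (\<Sum>i\<in>UNIV. (l0 i)\<^sup>2) + t * (\<Sum>i\<in>UNIV. (l1 i)\<^sup>2)"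
  proof -
    have "(l i)\<^sup>2 \<le> (1 - t) * (L0 (b i) \<bullet> L0 (b i)) + t * (L1 (b i) \<bullet> L1 (b i))" for i
    proof -
      have "(l i)\<^sup>2 = L (b i) \<bullet> L (b i)" using svdD(3)[OF s, of i i] by simp
      \<comment> \<open>Convexity of the square with its exact defect, \<open>t (1 - t)\<close>
        times the squared difference.\<close>
      also have "\<dots> = (1 - t) * (L0 (b i) \<bullet> L0 (b i)) + t * (L1 (b i) \<bullet> L1 (b i))
          - t * (1 - t) * ((L1 (b i) - L0 (b i)) \<bullet> (L1 (b i) - L0 (b i)))"
        unfolding Le by (simp add: inner_add_left inner_add_right inner_diff_left inner_diff_right inner_commute algebra_simps)
      finally show ?thesis using t by simp
    qed
    then have "(\<Sum>i\<in>UNIV. (l i)\<^sup>2) \<le> (\<Sum>i\<in>UNIV. (1 - t) * (L0 (b i) \<bullet> L0 (b i)) + t * (L1 (b i) \<bullet> L1 (b i)))"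
      by (rule sum_mono)
    also have "\<dots> = (1 - t) * (\<Sum>i\<in>UNIV. (l0 i)\<^sup>2) + t * (\<Sum>i\<in>UNIV. (l1 i)\<^sup>2)"
      unfolding svd_frobenius[OF g L0 s0 s L, symmetric] svd_frobenius[OF g L1 s1 s L, symmetric]
      by (simp add: sum.distrib sum_distrib_left)
    finally show ?thesis .
  qed
  have conv2: "(1 - t) * x + t * y \<le> 2" if "x \<le> 2" "y \<le> 2" for x y :: real
    using convex_bound_le[of x 2 y "1 - t" t] that t by simp
  have ball: "convex_spectrum l" if "\<And>i. l0 i \<le> 1" "\<And>i. l1 i \<le> 1"
  proof -
    have "l i \<le> 1" for i
    proof -
      have n: "norm (L0 (b i)) \<le> 1" "norm (L1 (b i)) \<le> 1"
        using svd_ball[OF bg L0 s0 that(1), of "b i"] svd_ball[OF bg L1 s1 that(2), of "b i"] svdD(2)[OF s, of i i]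
        by (simp_all add: norm_eq_sqrt_inner)
      have "(1 - t) * norm (L0 (b i)) + t * norm (L1 (b i)) \<le> 1"
        using convex_bound_le[OF n, of "1 - t" t] t by simp
      then show ?thesis using nL[of "b i"] nb[of i] by simp
    qed
    then show ?thesis unfolding convex_spectrum_def by blast
  qed
  consider "\<And>i. l0 i \<le> 1 \<and> l1 i \<le> 1" | "(\<Sum>i\<in>UNIV. l0 i) \<le> 2" "(\<Sum>i\<in>UNIV. l1 i) \<le> 2"
    | "(\<Sum>i\<in>UNIV. (l0 i)\<^sup>2) \<le> 2" "(\<Sum>i\<in>UNIV. (l1 i)\<^sup>2) \<le> 2"
    | "(\<Sum>i\<in>UNIV. sqrt (1 + (l0 i)\<^sup>2)) \<le> 2" "(\<Sum>i\<in>UNIV. sqrt (1 + (l1 i)\<^sup>2)) \<le> 2"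
    using c unfolding spectral_bounds_def by auto
  then show ?thesis
  proof cases
    case 1
    then show ?thesis using ball by blast
  next
    case 2
    show ?thesis by (intro convex_spectrum_sum[OF svdD(1)[OF s]] order_trans[OF nuc conv2[OF 2]])
  next
    case 3
    show ?thesis by (intro convex_spectrum_sum_squares order_trans[OF fro conv2[OF 3]])
  next
    case 4
    show ?thesis
    proof (cases "CARD('m) = 1")
      case False
      then show ?thesis using sum_sqrt_le_imp_zero[OF False 4(1)] sum_sqrt_le_imp_zero[OF False 4(2)] ball by simp
    qed (rule convex_spectrum_singleton)
  qed
qed

section \<open>Eigenvalue multiplicities and the ordered list of singular values\<close>

lemma dim_eigenspace_svd:
  fixes g :: "real^'m \<Rightarrow> real^'m \<Rightarrow> real" and L :: "real^'m \<Rightarrow> 'b::real_inner"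
    and b :: "'m \<Rightarrow> real^'m"
  assumes g: "pos_def_form g" and L: "linear L" and s: "svd g L b l"
  shows "dim {v. \<forall>w. L v \<bullet> L w = \<mu> * g v w} = card {i. (l i)\<^sup>2 = \<mu>}"
proof -
  note bg = pos_def_formD(1)[OF g] and sg = pos_def_formD(2)[OF g]
  note exp = orthonormal_frame_expand[OF bg svdD(2)[OF s]]
  let ?I = "{i. (l i)\<^sup>2 = \<mu>}"
  have inj: "inj b"
    using svdD(2)[OF s] by (metis injI zero_neq_one)
  have spn: "v \<in> span (range b)" for v
    by (subst exp) (intro span_sum span_scale span_base rangeI)
  have ind: "independent (range b)"
    by (rule card_le_dim_spanning[of _ UNIV]) (auto simp: spn card_image[OF inj])
  have "{v. \<forall>w. L v \<bullet> L w = \<mu> * g v w} = span (b ` ?I)"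
  proof
    show "{v. \<forall>w. L v \<bullet> L w = \<mu> * g v w} \<subseteq> span (b ` ?I)"
    proof clarify
      fix v assume v: "\<forall>w. L v \<bullet> L w = \<mu> * g v w"
      \<comment> \<open>In the frame the eigenvalue equation reads
        \<open>((l i)^2 - \<mu>) g (b i) v = 0\<close>, so only coordinates with
        \<open>(l i)^2 = \<mu>\<close> survive.\<close>
      have Lv: "L v \<bullet> L (b i) = (l i)\<^sup>2 * g (b i) v" for i
      proof -
        have "L v = L (\<Sum>k\<in>UNIV. g (b k) v *\<^sub>R b k)" by (rule arg_cong[where f = L], rule exp)
        also have "\<dots> \<bullet> L (b i) = (\<Sum>k\<in>UNIV. if k = i then (l i)\<^sup>2 * g (b i) v else 0)"
          unfolding linear_sum[OF L] linear_cmul[OF L] inner_sum_left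
          by (intro sum.cong) (auto simp: svdD(3)[OF s])
        finally show ?thesis by simp
      qed
      have z: "g (b i) v = 0" if "i \<notin> ?I" for i
        using v Lv[of i] sg[of v "b i"] that by auto
      have "v = (\<Sum>i\<in>?I. g (b i) v *\<^sub>R b i)"
        by (subst exp) (rule sum.mono_neutral_right, auto simp: z)
      then show "v \<in> span (b ` ?I)"
        by (metis (no_types, lifting) imageI span_base span_scale span_sum)
    qed
    have "subspace {v. \<forall>w. L v \<bullet> L w = \<mu> * g v w}"
      unfolding subspace_def
      by (auto simp: linear_0[OF L] linear_add[OF L] linear_cmul[OF L] bilinear_simps[OF bg] inner_add_left algebra_simps)
    moreover have "b ` ?I \<subseteq> {v. \<forall>w. L v \<bullet> L w = \<mu> * g v w}"
    proof clarify
      fix i w assume "\<mu> = (l i)\<^sup>2"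
      have "L w = L (\<Sum>k\<in>UNIV. g (b k) w *\<^sub>R b k)" by (rule arg_cong[where f = L], rule exp)
      then have "L (b i) \<bullet> L w = L (b i) \<bullet> (\<Sum>k\<in>UNIV. g (b k) w *\<^sub>R L (b k))"
        by (simp add: linear_sum[OF L] linear_cmul[OF L])
      also have "\<dots> = (\<Sum>k\<in>UNIV. if k = i then (l i)\<^sup>2 * g (b i) w else 0)"
        unfolding inner_sum_right by (intro sum.cong) (auto simp: svdD(3)[OF s])
      finally show "L (b i) \<bullet> L w = (l i)\<^sup>2 * g (b i) w" by simp
    qed
    ultimately show "span (b ` ?I) \<subseteq> {v. \<forall>w. L v \<bullet> L w = \<mu> * g v w}"
      by (simp add: span_minimal)
  qed
  also have "dim (span (b ` ?I)) = card (b ` ?I)"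
    using independent_mono[OF ind, of "b ` ?I"] by (simp add: dim_eq_card_independent image_mono)
  also have "\<dots> = card ?I" using inj by (simp add: card_image inj_on_def)
  finally show ?thesis .
qed

text \<open>The uniqueness behind \<open>singular_values\<close>: equal counts mean equal multisets
  of squares, nonnegativity allows square roots to be taken, and the ordering fixes the
  list.\<close>

lemma sorted_list_squares_unique:
  fixes xs ys :: "real list"
  assumes "sorted_wrt (\<ge>) xs" "sorted_wrt (\<ge>) ys" "\<forall>l\<in>set xs. 0 \<le> l" "\<forall>l\<in>set ys. 0 \<le> l"
    and c: "\<And>\<mu>. count_list (map (\<lambda>l. l\<^sup>2) xs) \<mu> = count_list (map (\<lambda>l. l\<^sup>2) ys) \<mu>"
  shows "xs = ys"
proof -
  have "mset (map (\<lambda>l. l\<^sup>2) xs) = mset (map (\<lambda>l. l\<^sup>2) ys)"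
    using c by (intro multiset_eqI) (simp only: count_mset)
  then have "mset (map sqrt (map (\<lambda>l. l\<^sup>2) xs)) = mset (map sqrt (map (\<lambda>l. l\<^sup>2) ys))"
    by (metis mset_map)
  moreover have "map sqrt (map (\<lambda>l. l\<^sup>2) zs) = zs" if "\<forall>l\<in>set zs. 0 \<le> l" for zs :: "real list"
    using that by (induction zs) auto
  ultimately have "mset xs = mset ys" using assms(3,4) by metis
  then have "mset (rev xs) = mset (rev ys)" by simp
  moreover have "sorted (rev xs)" "sorted (rev ys)" using assms by (simp_all add: sorted_wrt_rev)
  ultimately have "rev xs = rev ys" by (metis properties_for_sort)
  then show ?thesis by simp
qed


section \<open>Differentiability classes\<close>

lemma times_differentiable_on_subset:
  "times_differentiable_on k S f \<Longrightarrow> T \<subseteq> S \<Longrightarrow> times_differentiable_on k T f"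
  by (induction k arbitrary: f) (auto intro: continuous_on_subset)

lemma smooth_on_subset: "smooth_on S f \<Longrightarrow> T \<subseteq> S \<Longrightarrow> smooth_on T f"
  unfolding smooth_on_def using times_differentiable_on_subset by blast

lemma has_derivative_cong_open:
  assumes "open S" "x \<in> S" "\<And>y. y \<in> S \<Longrightarrow> f y = g y"
  shows "(f has_derivative f') (at x) \<longleftrightarrow> (g has_derivative f') (at x)"
  using assms has_derivative_transform_within_open by metis

lemma frechet_derivative_cong_open:
  assumes "open S" "x \<in> S" "\<And>y. y \<in> S \<Longrightarrow> f y = g y"
  shows "frechet_derivative f (at x) = frechet_derivative g (at x)"
  unfolding frechet_derivative_def using has_derivative_cong_open[OF assms] by simp

lemma differentiable_cong_open:
  assumes "open S" "x \<in> S" "\<And>y. y \<in> S \<Longrightarrow> f y = g y"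
  shows "f differentiable (at x) \<longleftrightarrow> g differentiable (at x)"
  unfolding differentiable_def using has_derivative_cong_open[OF assms] by simp

lemma times_differentiable_on_cong:
  assumes S: "open S" and e: "\<And>y. y \<in> S \<Longrightarrow> f y = g y" and f: "times_differentiable_on k S f"
  shows "times_differentiable_on k S g"
  using e f
proof (induction k arbitrary: f g)
  case 0
  then show ?case by (auto cong: continuous_on_cong)
next
  case (Suc k)
  have "times_differentiable_on k S (\<lambda>x. frechet_derivative g (at x) v)" for v
    by (rule Suc.IH[of "\<lambda>x. frechet_derivative f (at x) v"])
      (use frechet_derivative_cong_open[OF S _ Suc.prems(1)] Suc.prems(2) in auto)
  moreover have "\<forall>x\<in>S. g differentiable (at x)"
    using Suc.prems differentiable_cong_open[OF S _ Suc.prems(1)] by auto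
  ultimately show ?case by simp
qed

lemma smooth_on_cong:
  "open S \<Longrightarrow> (\<And>y. y \<in> S \<Longrightarrow> f y = g y) \<Longrightarrow> smooth_on S f \<Longrightarrow> smooth_on S g"
  unfolding smooth_on_def using times_differentiable_on_cong by blast

lemma frechet_derivative_Pair:
  assumes "f differentiable (at x)" "g differentiable (at x)"
  shows "frechet_derivative (\<lambda>y. (f y, g y)) (at x) = (\<lambda>v. (frechet_derivative f (at x) v, frechet_derivative g (at x) v))"
  by (rule frechet_derivative_at[symmetric])
    (intro has_derivative_Pair frechet_derivative_works[THEN iffD1] assms)

lemma times_differentiable_on_Pair:
  assumes S: "open S"
  shows "times_differentiable_on k S f \<Longrightarrow> times_differentiable_on k S g \<Longrightarrow> times_differentiable_on k S (\<lambda>y. (f y, g y))"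
proof (induction k arbitrary: f g)
  case 0
  then show ?case by (auto intro: continuous_on_Pair)
next
  case (Suc k)
  have "times_differentiable_on k S (\<lambda>x. frechet_derivative (\<lambda>y. (f y, g y)) (at x) v)" for v
    by (rule times_differentiable_on_cong[OF S _ Suc.IH])
      (use Suc.prems in \<open>auto simp: frechet_derivative_Pair\<close>)
  moreover have "(\<lambda>y. (f y, g y)) differentiable (at x)" if "x \<in> S" for x
  proof -
    have "f differentiable (at x)" "g differentiable (at x)" using Suc.prems that by auto
    then show ?thesis using has_derivative_Pair unfolding differentiable_def by blast
  qed
  ultimately show ?case by auto
qed

lemma smooth_on_Pair: "open S \<Longrightarrow> smooth_on S f \<Longrightarrow> smooth_on S g \<Longrightarrow> smooth_on S (\<lambda>y. (f y, g y))"
  unfolding smooth_on_def using times_differentiable_on_Pair by blast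

lemma smooth_on_derivative:
  assumes "smooth_on S f"
  shows "smooth_on S (\<lambda>x. frechet_derivative f (at x) v)"
  using assms unfolding smooth_on_def by (metis times_differentiable_on.simps(2))

lemma smooth_on_imp_continuous_on: "smooth_on S f \<Longrightarrow> continuous_on S f"
  unfolding smooth_on_def by (metis times_differentiable_on.simps(1))

lemma smooth_on_differentiable: "smooth_on S f \<Longrightarrow> x \<in> S \<Longrightarrow> f differentiable (at x)"
  unfolding smooth_on_def by (metis times_differentiable_on.simps(2))

text \<open>Continuity is expressed direction by direction, matching
  \<open>times_differentiable_on\<close>. One derivative suffices for the divergence argument, and
  the class is stable under the roots and inverses that occur in the flux field.\<close>

definition C1_on :: "'a::real_normed_vector set \<Rightarrow> ('a \<Rightarrow> 'b::real_normed_vector) \<Rightarrow> bool" where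
  "C1_on S f \<longleftrightarrow> (\<forall>x\<in>S. f differentiable (at x)) \<and> (\<forall>v. continuous_on S (\<lambda>x. frechet_derivative f (at x) v))"

lemma smooth_on_imp_C1_on: "smooth_on S f \<Longrightarrow> C1_on S f"
  unfolding C1_on_def using smooth_on_differentiable smooth_on_derivative smooth_on_imp_continuous_on by blast

lemma C1_onI:
  assumes d: "\<And>x. x \<in> S \<Longrightarrow> (f has_derivative f' x) (at x)" and c: "\<And>v. continuous_on S (\<lambda>x. f' x v)"
  shows "C1_on S f"
proof -
  have "frechet_derivative f (at x) = f' x" if "x \<in> S" for x
    using frechet_derivative_at[OF d[OF that]] by simp
  then have "continuous_on S (\<lambda>x. frechet_derivative f (at x) v)" for v
    using c[of v] by (simp cong: continuous_on_cong)
  then show ?thesis unfolding C1_on_def using differentiableI[OF d] by blast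
qed

lemma C1_onD:
  assumes "C1_on S f"
  shows "x \<in> S \<Longrightarrow> (f has_derivative frechet_derivative f (at x)) (at x)"
    and "continuous_on S (\<lambda>x. frechet_derivative f (at x) v)"
  using assms frechet_derivative_works unfolding C1_on_def by blast+

lemma C1_on_continuous: "C1_on S f \<Longrightarrow> continuous_on S f"
  by (meson C1_onD(1) continuous_at_imp_continuous_on has_derivative_continuous)

lemma C1_on_subset: "C1_on S f \<Longrightarrow> T \<subseteq> S \<Longrightarrow> C1_on T f"
  unfolding C1_on_def by (auto intro: continuous_on_subset)

lemma C1_on_cong:
  assumes "open S" "\<And>y. y \<in> S \<Longrightarrow> f y = g y" "C1_on S f"
  shows "C1_on S g"
  using assms(3) unfolding C1_on_def
  using differentiable_cong_open[OF assms(1) _ assms(2)] frechet_derivative_cong_open[OF assms(1) _ assms(2)]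
  by (auto cong: continuous_on_cong)

lemma C1_on_bilinear:
  assumes p: "bounded_bilinear p" and f: "C1_on S f" and g: "C1_on S g"
  shows "C1_on S (\<lambda>x. p (f x) (g x))"
proof (rule C1_onI)
  show "((\<lambda>x. p (f x) (g x)) has_derivative
      (\<lambda>v. p (f x) (frechet_derivative g (at x) v) + p (frechet_derivative f (at x) v) (g x))) (at x)" if "x \<in> S" for x
    by (rule bounded_bilinear.FDERIV[OF p C1_onD(1)[OF f that] C1_onD(1)[OF g that]])
  show "continuous_on S (\<lambda>x. p (f x) (frechet_derivative g (at x) v) + p (frechet_derivative f (at x) v) (g x))" for v
    by (intro continuous_on_add bounded_bilinear.continuous_on[OF p] C1_on_continuous[OF f] C1_on_continuous[OF g]
        C1_onD(2)[OF f] C1_onD(2)[OF g])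
qed

lemmas C1_on_mult = C1_on_bilinear[OF bounded_bilinear_mult]
lemmas C1_on_scaleR = C1_on_bilinear[OF bounded_bilinear_scaleR]
lemmas C1_on_inner = C1_on_bilinear[OF bounded_bilinear_inner]

lemma C1_on_linear:
  assumes p: "bounded_linear p" and f: "C1_on S f"
  shows "C1_on S (\<lambda>x. p (f x))"
  by (rule C1_onI[where f' = "\<lambda>x v. p (frechet_derivative f (at x) v)"])
    (auto intro!: bounded_linear.has_derivative[OF p] C1_onD[OF f] bounded_linear.continuous_on[OF p])

lemma C1_on_const: "C1_on S (\<lambda>x. c)"
  by (rule C1_onI[where f' = "\<lambda>x v. 0"]) auto

lemma C1_on_add: "C1_on S f \<Longrightarrow> C1_on S g \<Longrightarrow> C1_on S (\<lambda>x. f x + g x)"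
  by (rule C1_onI[where f' = "\<lambda>x v. frechet_derivative f (at x) v + frechet_derivative g (at x) v"])
    (auto intro!: has_derivative_add C1_onD continuous_on_add)

lemma C1_on_sum: "(\<And>i. i \<in> I \<Longrightarrow> C1_on S (f i)) \<Longrightarrow> C1_on S (\<lambda>x. \<Sum>i\<in>I. f i x)"
  by (induction I rule: infinite_finite_induct) (auto intro: C1_on_const C1_on_add)

lemma C1_on_real_compose:
  fixes f :: "'a::real_normed_vector \<Rightarrow> real"
  assumes f: "C1_on S f" and \<phi>: "\<And>x. x \<in> S \<Longrightarrow> (\<phi> has_real_derivative \<phi>' (f x)) (at (f x))"
    and c: "continuous_on (f ` S) \<phi>'"
  shows "C1_on S (\<lambda>x. \<phi> (f x))"
proof (rule C1_onI[where f' = "\<lambda>x v. \<phi>' (f x) * frechet_derivative f (at x) v"])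
  show "((\<lambda>x. \<phi> (f x)) has_derivative (\<lambda>v. \<phi>' (f x) * frechet_derivative f (at x) v)) (at x)" if "x \<in> S" for x
    using has_derivative_compose[OF C1_onD(1)[OF f that] \<phi>[OF that, unfolded has_field_derivative_def]] by simp
  show "continuous_on S (\<lambda>x. \<phi>' (f x) * frechet_derivative f (at x) v)" for v
    using continuous_on_compose[OF C1_on_continuous[OF f] c]
    by (intro continuous_on_mult C1_onD(2)[OF f]) (simp add: o_def)
qed

lemma linear_expand_euclidean:
  fixes L :: "'a::euclidean_space \<Rightarrow> 'b::real_vector"
  assumes "linear L"
  shows "L v = (\<Sum>b\<in>Basis. (v \<bullet> b) *\<^sub>R L b)"
proof -
  have "L v = L (\<Sum>b\<in>Basis. (v \<bullet> b) *\<^sub>R b)" by (simp add: euclidean_representation)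
  then show ?thesis by (simp add: linear_sum[OF assms] linear_cmul[OF assms])
qed

lemma continuous_on_matrixI:
  fixes A :: "'a::topological_space \<Rightarrow> real^'n^'m"
  assumes "\<And>i j. continuous_on S (\<lambda>x. A x $ i $ j)"
  shows "continuous_on S A"
proof -
  have "continuous_on S (\<lambda>x. \<chi> i. \<chi> j. A x $ i $ j)"
    by (intro continuous_on_vec_lambda assms)
  then show ?thesis by simp
qed

lemma C1_on_matrixI:
  fixes A :: "'a::real_normed_vector \<Rightarrow> real^'n^'m"
  assumes "\<And>i j. C1_on S (\<lambda>x. A x $ i $ j)"
  shows "C1_on S A"
  by (rule C1_onI[where f' = "\<lambda>x v. \<chi> i j. frechet_derivative (\<lambda>x. A x $ i $ j) (at x) v"])
    (auto intro!: has_derivative_matrixI continuous_on_matrixI C1_onD assms)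

lemma C1_on_matrix_inv:
  fixes A :: "'a::real_normed_vector \<Rightarrow> real^'n^'n"
  assumes A: "C1_on S A" and d: "\<And>x. x \<in> S \<Longrightarrow> det (A x) \<noteq> 0"
  shows "C1_on S (\<lambda>x. matrix_inv (A x))"
proof (rule C1_onI[where f' = "\<lambda>x v. - (matrix_inv (A x) ** frechet_derivative A (at x) v ** matrix_inv (A x))"])
  have hd: "((\<lambda>x. matrix_inv (A x)) has_derivative
       (\<lambda>v. - (matrix_inv (A x) ** frechet_derivative A (at x) v ** matrix_inv (A x)))) (at x)" if "x \<in> S" for x
    by (rule has_derivative_matrix_inv[OF C1_onD(1)[OF A that] d[OF that]])
  then show "((\<lambda>x. matrix_inv (A x)) has_derivative
       (\<lambda>v. - (matrix_inv (A x) ** frechet_derivative A (at x) v ** matrix_inv (A x)))) (at x)" if "x \<in> S" for x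
    using that by blast
  have c: "continuous_on S (\<lambda>x. matrix_inv (A x))"
    using hd has_derivative_continuous by (intro continuous_at_imp_continuous_on) blast
  note cm = bounded_bilinear.continuous_on[OF bounded_bilinear_matrix_mult]
  show "continuous_on S (\<lambda>x. - (matrix_inv (A x) ** frechet_derivative A (at x) v ** matrix_inv (A x)))" for v
    by (intro continuous_on_minus cm c C1_onD(2)[OF A])
qed

lemma C1_on_det:
  fixes A :: "'a::real_normed_vector \<Rightarrow> real^'n^'n"
  assumes A: "C1_on S A" and d: "\<And>x. x \<in> S \<Longrightarrow> det (A x) \<noteq> 0"
  shows "C1_on S (\<lambda>x. det (A x))"
proof (rule C1_onI[where f' = "\<lambda>x v. det (A x) * trace (matrix_inv (A x) ** frechet_derivative A (at x) v)"])
  have hd: "((\<lambda>x. det (A x)) has_derivative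
       (\<lambda>v. det (A x) * trace (matrix_inv (A x) ** frechet_derivative A (at x) v))) (at x)" if "x \<in> S" for x
    by (rule has_derivative_det[OF C1_onD(1)[OF A that] d[OF that]])
  then show "((\<lambda>x. det (A x)) has_derivative
       (\<lambda>v. det (A x) * trace (matrix_inv (A x) ** frechet_derivative A (at x) v))) (at x)" if "x \<in> S" for x
    using that by blast
  have c: "continuous_on S (\<lambda>x. det (A x))"
    using hd has_derivative_continuous by (intro continuous_at_imp_continuous_on) blast
  show "continuous_on S (\<lambda>x. det (A x) * trace (matrix_inv (A x) ** frechet_derivative A (at x) v))" for v
    by (intro continuous_on_mult c bounded_linear.continuous_on[OF bounded_linear_trace]
        bounded_bilinear.continuous_on[OF bounded_bilinear_matrix_mult] C1_on_continuous[OF C1_on_matrix_inv[OF A d]] C1_onD(2)[OF A])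
qed

lemma C1_on_sqrt:
  fixes f :: "'a::real_normed_vector \<Rightarrow> real"
  assumes f: "C1_on S f" and p: "\<And>x. x \<in> S \<Longrightarrow> f x > 0"
  shows "C1_on S (\<lambda>x. sqrt (f x))"
  by (rule C1_on_real_compose[OF f, of _ "\<lambda>y. inverse (sqrt y) / 2"])
    (use p in \<open>auto intro!: DERIV_real_sqrt continuous_intros simp: less_imp_neq[symmetric]\<close>)

section \<open>Symmetry of second derivatives\<close>

lemma second_difference:
  fixes F :: "'a::real_normed_vector \<Rightarrow> real"
  assumes s: "s > 0" and ball: "\<And>a b. 0 \<le> a \<Longrightarrow> a \<le> s \<Longrightarrow> 0 \<le> b \<Longrightarrow> b \<le> s \<Longrightarrow> z + a *\<^sub>R u + b *\<^sub>R v \<in> S"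
    and F: "smooth_on S F"
  shows "\<exists>a b. 0 \<le> a \<and> a \<le> s \<and> 0 \<le> b \<and> b \<le> s \<and>
     F (z + s *\<^sub>R u + s *\<^sub>R v) - F (z + s *\<^sub>R u) - F (z + s *\<^sub>R v) + F z
      = s\<^sup>2 * frechet_derivative (\<lambda>y. frechet_derivative F (at y) u) (at (z + a *\<^sub>R u + b *\<^sub>R v)) v"
proof -
  define D where "D y = frechet_derivative F (at y) u" for y
  have dF: "(F has_derivative frechet_derivative F (at y)) (at y)" if "y \<in> S" for y
    using smooth_on_differentiable[OF F that] frechet_derivative_works by blast
  have dD: "(D has_derivative frechet_derivative D (at y)) (at y)" if "y \<in> S" for y
    unfolding D_def
    using smooth_on_differentiable[OF smooth_on_derivative[OF F] that] frechet_derivative_works by blast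
  \<comment> \<open>This turns the second difference into an ordinary one, so the mean value theorem
    applies twice, first along \<open>u\<close> and then along \<open>v\<close>.\<close>
  define \<phi> where "\<phi> a = F (z + a *\<^sub>R u + s *\<^sub>R v) - F (z + a *\<^sub>R u)" for a
  have line: "((\<lambda>a. G (p + a *\<^sub>R w)) has_real_derivative G' w) (at a)"
    if "(G has_derivative G') (at (p + a *\<^sub>R w))" for G :: "'a \<Rightarrow> real" and G' p w a
  proof -
    have "((\<lambda>a. p + a *\<^sub>R w) has_derivative (\<lambda>h. h *\<^sub>R w)) (at a)"
      by (auto intro!: derivative_eq_intros)
    note h = this
    have "(\<lambda>h. G' (h *\<^sub>R w)) = (*) (G' w)"
      using linear_cmul[OF has_derivative_linear[OF that]] by (simp add: fun_eq_iff mult.commute)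
    then show ?thesis
      using has_derivative_compose[OF h that] by (simp add: has_field_derivative_def)
  qed
  have d\<phi>: "(\<phi> has_real_derivative (D (z + a *\<^sub>R u + s *\<^sub>R v) - D (z + a *\<^sub>R u))) (at a)" if "0 \<le> a" "a \<le> s" for a
  proof -
    have 1: "z + s *\<^sub>R v + a *\<^sub>R u \<in> S" "z + a *\<^sub>R u \<in> S" using ball[OF that, of s] ball[OF that, of 0] s
      by (simp_all add: add_ac)
    show ?thesis
      unfolding \<phi>_def D_def
      using DERIV_diff[OF line[OF dF[OF 1(1)]] line[OF dF[OF 1(2)]]] by (simp add: add_ac)
  qed
  obtain a where a: "0 < a" "a < s" "\<phi> s - \<phi> 0 = (s - 0) * (D (z + a *\<^sub>R u + s *\<^sub>R v) - D (z + a *\<^sub>R u))"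
    using MVT2[OF s, of \<phi> "\<lambda>a. D (z + a *\<^sub>R u + s *\<^sub>R v) - D (z + a *\<^sub>R u)"] d\<phi> by auto
  have dD': "((\<lambda>b. D (z + a *\<^sub>R u + b *\<^sub>R v)) has_real_derivative frechet_derivative D (at (z + a *\<^sub>R u + b *\<^sub>R v)) v) (at b)"
    if "0 \<le> b" "b \<le> s" for b
    by (rule line[OF dD]) (use ball that a in auto)
  obtain b where b: "0 < b" "b < s"
    "D (z + a *\<^sub>R u + s *\<^sub>R v) - D (z + a *\<^sub>R u + 0 *\<^sub>R v) = (s - 0) * frechet_derivative D (at (z + a *\<^sub>R u + b *\<^sub>R v)) v"
    using MVT2[OF s, of "\<lambda>b. D (z + a *\<^sub>R u + b *\<^sub>R v)" "\<lambda>b. frechet_derivative D (at (z + a *\<^sub>R u + b *\<^sub>R v)) v"] dD'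
    by auto
  have "F (z + s *\<^sub>R u + s *\<^sub>R v) - F (z + s *\<^sub>R u) - F (z + s *\<^sub>R v) + F z = \<phi> s - \<phi> 0"
    by (simp add: \<phi>_def)
  also have "\<dots> = s\<^sup>2 * frechet_derivative D (at (z + a *\<^sub>R u + b *\<^sub>R v)) v"
    using a(3) b(3) by (simp add: power2_eq_square)
  finally show ?thesis using a b unfolding D_def[abs_def] by (intro exI[of _ a] exI[of _ b]) auto
qed

text \<open>The second difference does not change when \<open>u\<close> and \<open>v\<close> are
  exchanged, so the two mixed derivatives take a common value at two points close to
  \<open>z\<close>. If they differed at \<open>z\<close>, this would contradict their
  continuity.\<close>

lemma symmetric_second_derivative_real:
  fixes F :: "'a::real_normed_vector \<Rightarrow> real"
  assumes S: "open S" "z \<in> S" and F: "smooth_on S F"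
  shows "frechet_derivative (\<lambda>y. frechet_derivative F (at y) u) (at z) v
       = frechet_derivative (\<lambda>y. frechet_derivative F (at y) v) (at z) u"
proof (rule ccontr)
  define A where "A x = frechet_derivative (\<lambda>y. frechet_derivative F (at y) u) (at x) v" for x
  define B where "B x = frechet_derivative (\<lambda>y. frechet_derivative F (at y) v) (at x) u" for x
  assume "\<not> ?thesis"
  then have "A z \<noteq> B z" by (simp add: A_def B_def)
  define e where "e = \<bar>A z - B z\<bar> / 2"
  have e: "e > 0" using \<open>A z \<noteq> B z\<close> by (simp add: e_def)
  have "continuous_on S A" "continuous_on S B"
    unfolding A_def B_def using F by (auto intro!: smooth_on_imp_continuous_on smooth_on_derivative)
  then have "isCont A z" "isCont B z" using S by (auto simp: continuous_on_eq_continuous_at)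
  then have "\<exists>d>0. \<forall>y. dist y z < d \<longrightarrow> dist (A y) (A z) < e" "\<exists>d>0. \<forall>y. dist y z < d \<longrightarrow> dist (B y) (B z) < e"
    using e unfolding continuous_at_eps_delta by blast+
  then obtain d1 d2 where d: "d1 > 0" "d2 > 0" "\<And>y. dist y z < d1 \<Longrightarrow> dist (A y) (A z) < e"
    "\<And>y. dist y z < d2 \<Longrightarrow> dist (B y) (B z) < e"
    by blast
  obtain d3 where d3: "d3 > 0" "ball z d3 \<subseteq> S" using S openE by blast
  define d where "d = min (min d1 d2) d3"
  \<comment> \<open>Small enough for the parallelogram with sides \<open>s u\<close> and
    \<open>s v\<close> to stay within \<open>d\<close> of \<open>z\<close>; the added
    \<open>1\<close> excludes a zero denominator.\<close>
  define s where "s = d / (2 * (1 + norm u + norm v))"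
  have dp: "d > 0" using d d3 by (simp add: d_def)
  have q: "1 + norm u + norm v > 0" by (simp add: add_pos_nonneg)
  have s: "s > 0" using dp q by (simp add: s_def)
  have near: "dist (z + a *\<^sub>R u + b *\<^sub>R v) z < d" if "0 \<le> a" "a \<le> s" "0 \<le> b" "b \<le> s" for a b
  proof -
    have "norm (a *\<^sub>R u + b *\<^sub>R v) \<le> a * norm u + b * norm v"
      using norm_triangle_ineq[of "a *\<^sub>R u" "b *\<^sub>R v"] that by simp
    also have "\<dots> \<le> s * norm u + s * norm v" using that by (intro add_mono mult_right_mono) auto
    also have "\<dots> \<le> s * (1 + norm u + norm v)" using s by (simp add: algebra_simps)
    also have "\<dots> = d / 2" using q by (simp add: s_def field_simps)
    finally show ?thesis using dp by (simp add: dist_norm)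
  qed
  have inS: "z + a *\<^sub>R u + b *\<^sub>R v \<in> S" if "0 \<le> a" "a \<le> s" "0 \<le> b" "b \<le> s" for a b
    using near[OF that] d3 by (auto simp: d_def dist_commute)
  have inS': "z + a *\<^sub>R v + b *\<^sub>R u \<in> S" if "0 \<le> a" "a \<le> s" "0 \<le> b" "b \<le> s" for a b
    using inS[OF that(3,4,1,2)] by (simp add: add_ac)
  obtain a b where ab: "0 \<le> a" "a \<le> s" "0 \<le> b" "b \<le> s"
    "F (z + s *\<^sub>R u + s *\<^sub>R v) - F (z + s *\<^sub>R u) - F (z + s *\<^sub>R v) + F z = s\<^sup>2 * A (z + a *\<^sub>R u + b *\<^sub>R v)"
    using second_difference[OF s inS F] unfolding A_def by blast
  obtain a' b' where ab': "0 \<le> a'" "a' \<le> s" "0 \<le> b'" "b' \<le> s"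
    "F (z + s *\<^sub>R v + s *\<^sub>R u) - F (z + s *\<^sub>R v) - F (z + s *\<^sub>R u) + F z = s\<^sup>2 * B (z + a' *\<^sub>R v + b' *\<^sub>R u)"
    using second_difference[OF s inS' F] unfolding B_def by blast
  have "s\<^sup>2 * A (z + a *\<^sub>R u + b *\<^sub>R v) = s\<^sup>2 * B (z + b' *\<^sub>R u + a' *\<^sub>R v)"
  proof -
    have c: "z + s *\<^sub>R v + s *\<^sub>R u = z + s *\<^sub>R u + s *\<^sub>R v" "z + a' *\<^sub>R v + b' *\<^sub>R u = z + b' *\<^sub>R u + a' *\<^sub>R v"
      by (simp_all add: add_ac)
    show ?thesis using ab(5) ab'(5) unfolding c by linarith
  qed
  then have "A (z + a *\<^sub>R u + b *\<^sub>R v) = B (z + b' *\<^sub>R u + a' *\<^sub>R v)" using s by simp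
  moreover have "\<bar>A (z + a *\<^sub>R u + b *\<^sub>R v) - A z\<bar> < e"
    using d(3) near[OF ab(1-4)] by (auto simp: d_def dist_real_def)
  moreover have "\<bar>B (z + b' *\<^sub>R u + a' *\<^sub>R v) - B z\<bar> < e"
    using d(4) near[OF ab'(3,4,1,2)] by (auto simp: d_def dist_real_def)
  ultimately have "\<bar>A z - B z\<bar> < 2 * e" by linarith
  then show False by (simp add: e_def)
qed

lemma frechet_derivative_inner_left:
  assumes "f differentiable (at x)"
  shows "frechet_derivative (\<lambda>y. f y \<bullet> b) (at x) = (\<lambda>v. frechet_derivative f (at x) v \<bullet> b)"
  by (rule frechet_derivative_at[symmetric])
    (intro has_derivative_inner_left frechet_derivative_works[THEN iffD1] assms)

lemma smooth_on_inner_left: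
  assumes S: "open S" and f: "smooth_on S f"
  shows "smooth_on S (\<lambda>y. f y \<bullet> b)"
proof -
  have "times_differentiable_on k S f \<Longrightarrow> times_differentiable_on k S (\<lambda>y. f y \<bullet> b)" for k
  proof (induction k arbitrary: f)
    case 0
    then show ?case by (auto intro: continuous_on_inner)
  next
    case (Suc k)
    have "times_differentiable_on k S (\<lambda>x. frechet_derivative (\<lambda>y. f y \<bullet> b) (at x) v)" for v
      by (rule times_differentiable_on_cong[OF S _ Suc.IH])
        (use Suc.prems in \<open>auto simp: frechet_derivative_inner_left\<close>)
    moreover have "(\<lambda>y. f y \<bullet> b) differentiable (at x)" if "x \<in> S" for x
    proof -
      have "f differentiable (at x)" using Suc.prems that by auto
      then show ?thesis using has_derivative_inner_left unfolding differentiable_def by blast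
    qed
    ultimately show ?case by auto
  qed
  then show ?thesis using f unfolding smooth_on_def by blast
qed

lemma symmetric_second_derivative:
  fixes F :: "'a::real_normed_vector \<Rightarrow> 'b::euclidean_space"
  assumes S: "open S" "z \<in> S" and F: "smooth_on S F"
  shows "frechet_derivative (\<lambda>y. frechet_derivative F (at y) u) (at z) v
       = frechet_derivative (\<lambda>y. frechet_derivative F (at y) v) (at z) u"
proof (rule euclidean_eqI)
  fix b :: 'b
  have e: "frechet_derivative (\<lambda>y. frechet_derivative (\<lambda>y. F y \<bullet> b) (at y) u) (at z) v
     = frechet_derivative (\<lambda>y. frechet_derivative F (at y) u) (at z) v \<bullet> b" for u v
  proof -
    have "frechet_derivative (\<lambda>y. frechet_derivative (\<lambda>y. F y \<bullet> b) (at y) u) (at z)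
        = frechet_derivative (\<lambda>y. frechet_derivative F (at y) u \<bullet> b) (at z)"
      by (rule frechet_derivative_cong_open[OF S])
        (simp add: frechet_derivative_inner_left smooth_on_differentiable[OF F])
    also have "\<dots> = (\<lambda>v. frechet_derivative (\<lambda>y. frechet_derivative F (at y) u) (at z) v \<bullet> b)"
      by (rule frechet_derivative_inner_left[OF smooth_on_differentiable[OF smooth_on_derivative[OF F] S(2)]])
    finally show ?thesis by simp
  qed
  show "frechet_derivative (\<lambda>y. frechet_derivative F (at y) u) (at z) v \<bullet> b
      = frechet_derivative (\<lambda>y. frechet_derivative F (at y) v) (at z) u \<bullet> b"
    unfolding e[symmetric]
    by (rule symmetric_second_derivative_real[OF S smooth_on_inner_left[OF S(1) F]])
qed


section \<open>The minimal graph equation\<close>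

text \<open>Definiteness makes the map from vectors to functionals injective, hence surjective in
  finite dimension; \<open>T\<close> is this map in coordinates.\<close>

lemma riesz_form:
  fixes B :: "'e::euclidean_space \<Rightarrow> 'e \<Rightarrow> real"
  assumes B: "pos_def_form B" and p: "linear p"
  shows "\<exists>w. \<forall>z. B w z = p z"
proof -
  note b = pos_def_formD(1)[OF B]
  define T where "T w = (\<Sum>b\<in>Basis. B w b *\<^sub>R b)" for w
  have T: "linear T"
    by (rule linearI) (simp_all add: T_def bilinear_simps[OF b] scaleR_add_left sum.distrib scaleR_sum_right)
  have Tb: "T w \<bullet> b = B w b" if "b \<in> Basis" for w b
    using that by (simp add: T_def inner_sum_left inner_Basis if_distrib cong: if_cong)
  have Bexp: "B w z = (\<Sum>b\<in>Basis. (z \<bullet> b) * B w b)" for w z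
    using linear_expand_euclidean[of "B w" z] b unfolding bilinear_def by simp
  have "inj T"
  proof (rule linear_injective_0[OF T, THEN iffD2], intro allI impI)
    fix w assume "T w = 0"
    then have "B w b = 0" if "b \<in> Basis" for b using Tb[OF that, of w] by simp
    then have "B w w = 0" by (subst Bexp) simp
    then show "w = 0" using pos_def_formD(3)[OF B, of w] by force
  qed
  then have "surj T" using linear_injective_imp_surjective[OF T] by simp
  then obtain w where w: "T w = (\<Sum>b\<in>Basis. p b *\<^sub>R b)" by (metis surjD)
  have wb: "B w b = p b" if "b \<in> Basis" for b
    using Tb[OF that, of w] that by (simp add: w inner_sum_left inner_Basis if_distrib cong: if_cong)
  have "B w z = p z" for z
    using Bexp[of w z] linear_expand_euclidean[OF p, of z] by (simp add: wb)
  then show ?thesis by blast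
qed

text \<open>Gives meaning to the \<open>THE\<close> in \<open>normal_part\<close>: Riesz
  representation for the form pulled back along \<open>A\<close> produces the tangential part, and
  definiteness makes it unique.\<close>

lemma normal_part_diff_in_range:
  fixes b :: "'e::euclidean_space \<Rightarrow> 'e \<Rightarrow> real" and A :: "'d::euclidean_space \<Rightarrow> 'e"
  assumes b: "pos_def_form b" and A: "linear A" "inj A"
  shows "w - normal_part b (range A) w \<in> range A"
proof -
  note bb = pos_def_formD(1)[OF b]
  have B: "pos_def_form (\<lambda>s t. b (A s) (A t))"
    unfolding pos_def_form_def
    using bilinear_pullback[OF bb A(1) A(1)] pos_def_formD(2,3)[OF b] linear_injective_0[OF A(1)] A(2) by blast
  have "linear (\<lambda>t. b w (A t))"
    using bb linear_compose[OF A(1), of "b w"] unfolding bilinear_def o_def by blast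
  from riesz_form[OF B this] obtain s where s: "\<And>t. b (A s) (A t) = b w (A t)" by blast
  let ?P = "\<lambda>n. w - n \<in> range A \<and> (\<forall>t\<in>range A. b n t = 0)"
  have ex: "?P (w - A s)" using s by (auto simp: bilinear_simps[OF bb])
  have "normal_part b (range A) w = w - A s"
    unfolding normal_part_def
  proof (rule the_equality)
    show "?P (w - A s)" by (rule ex)
    fix n assume n: "?P n"
    then obtain r where r: "w - n = A r" by blast
    have d: "w - A s - n = A (r - s)" using r by (simp add: linear_diff[OF A(1)] algebra_simps)
    have "b (w - A s - n) (A (r - s)) = 0"
      using ex n by (simp add: bilinear_simps(9)[OF bb] )
    then have "w - A s - n = 0" using pos_def_formD(3)[OF b, of "w - A s - n"] d by force
    then show "n = w - A s" by simp
  qed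
  then show ?thesis by simp
qed

definition christoffel_rhs :: "('e::euclidean_space \<Rightarrow> 'e \<Rightarrow> 'e \<Rightarrow> real) \<Rightarrow> 'e \<Rightarrow> 'e \<Rightarrow> 'e \<Rightarrow> 'e \<Rightarrow> real" where
  "christoffel_rhs h x u v z =
     frechet_derivative (\<lambda>y. h y v z) (at x) u
     + frechet_derivative (\<lambda>y. h y u z) (at x) v
     - frechet_derivative (\<lambda>y. h y u v) (at x) z"

lemma riemannian_metric_onD:
  assumes "riemannian_metric_on S h"
  shows "z \<in> S \<Longrightarrow> pos_def_form (h z)" "smooth_on S (\<lambda>z. h z u v)"
  using assms unfolding riemannian_metric_on_def pos_def_form_def by blast+

text \<open>The bilinearity identities hold at all points near \<open>x\<close>, so they may be
  differentiated.\<close>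

lemma metric_derivative_bilinear:
  assumes h: "riemannian_metric_on S h" and S: "open S" "x \<in> S"
  shows "bilinear (\<lambda>u v. frechet_derivative (\<lambda>y. h y u v) (at x) w)"
proof -
  have d: "((\<lambda>y. h y u v) has_derivative frechet_derivative (\<lambda>y. h y u v) (at x)) (at x)" for u v
    using smooth_on_differentiable[OF riemannian_metric_onD(2)[OF h] S(2)] frechet_derivative_works by blast
  have bl: "bilinear (h y)" if "y \<in> S" for y using pos_def_formD(1)[OF riemannian_metric_onD(1)[OF h that]] .
  have eq: "frechet_derivative F (at x) w = f' w" if "\<And>y. y \<in> S \<Longrightarrow> G y = F y" "(G has_derivative f') (at x)"
    for F G :: "'a \<Rightarrow> real" and f'
    using frechet_derivative_at[of F f' x] has_derivative_cong_open[of S x G F f', OF S that(1)] that(2) by metis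
  show ?thesis
    unfolding bilinear_def
  proof (intro conjI allI linearI)
    fix u v1 v2 r
    show "frechet_derivative (\<lambda>y. h y u (v1 + v2)) (at x) w
       = frechet_derivative (\<lambda>y. h y u v1) (at x) w + frechet_derivative (\<lambda>y. h y u v2) (at x) w"
      by (rule eq[OF _ has_derivative_add[OF d d]]) (simp add: bilinear_simps[OF bl])
    show "frechet_derivative (\<lambda>y. h y (v1 + v2) u) (at x) w
       = frechet_derivative (\<lambda>y. h y v1 u) (at x) w + frechet_derivative (\<lambda>y. h y v2 u) (at x) w"
      by (rule eq[OF _ has_derivative_add[OF d d]]) (simp add: bilinear_simps[OF bl])
    show "frechet_derivative (\<lambda>y. h y u (r *\<^sub>R v1)) (at x) w = r *\<^sub>R frechet_derivative (\<lambda>y. h y u v1) (at x) w"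
      by (rule eq[OF _ has_derivative_scaleR_right[OF d]]) (simp add: bilinear_simps[OF bl])
    show "frechet_derivative (\<lambda>y. h y (r *\<^sub>R v1) u) (at x) w = r *\<^sub>R frechet_derivative (\<lambda>y. h y v1 u) (at x) w"
      by (rule eq[OF _ has_derivative_scaleR_right[OF d]]) (simp add: bilinear_simps[OF bl])
  qed
qed

lemma christoffel_exists:
  assumes h: "riemannian_metric_on S h" and S: "open S" "x \<in> S"
  shows "\<exists>w. \<forall>z. 2 * h x w z = christoffel_rhs h x u v z"
proof -
  note mb = metric_derivative_bilinear[OF h S, unfolded bilinear_def, THEN conjunct1, rule_format]
  have "linear (\<lambda>z. frechet_derivative (\<lambda>y. h y u v) (at x) z)"
    using smooth_on_differentiable[OF riemannian_metric_onD(2)[OF h] S(2)] by (rule linear_frechet_derivative)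
  then have "linear (christoffel_rhs h x u v)"
    unfolding christoffel_rhs_def[abs_def] by (intro linear_compose_add linear_compose_sub mb)
  then have "linear (\<lambda>z. inverse 2 *\<^sub>R christoffel_rhs h x u v z)"
    by (rule linear_compose_scale_right)
  from riesz_form[OF riemannian_metric_onD(1)[OF h S(2)] this]
  obtain w where w: "\<And>z. h x w z = inverse 2 *\<^sub>R christoffel_rhs h x u v z" by blast
  have "2 * h x w z = christoffel_rhs h x u v z" for z using w[of z] by simp
  then show ?thesis by blast
qed

definition product_metric :: "('e \<Rightarrow> 'e \<Rightarrow> 'e \<Rightarrow> real) \<Rightarrow> ('e \<times> 'n) \<Rightarrow> ('e \<times> 'n) \<Rightarrow> ('e \<times> 'n::real_inner) \<Rightarrow> real" where
  "product_metric g = (\<lambda>(z, y) (u, a) (v, b). g z u v + a \<bullet> b)"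

lemma pos_def_form_product_metric:
  assumes g: "pos_def_form (g z)"
  shows "pos_def_form (product_metric g (z, y))"
proof -
  note b = bilinear_simps[OF pos_def_formD(1)[OF g]]
  have "bilinear (product_metric g (z, y))"
    unfolding bilinear_def product_metric_def
    by (auto intro!: linearI simp: b inner_add_left inner_add_right algebra_simps)
  moreover have "product_metric g (z, y) p p > 0" if nz: "p \<noteq> 0" for p :: "'a \<times> 'b"
  proof (cases p)
    case (Pair u a)
    show ?thesis
    proof (cases "u = 0")
      case True
      then have "a \<noteq> 0" using nz Pair by (auto simp: zero_prod_def)
      then show ?thesis using Pair True by (simp add: product_metric_def b)
    next
      case False
      then show ?thesis using Pair pos_def_formD(3)[OF g False] by (simp add: product_metric_def add_pos_nonneg)
    qed
  qed
  ultimately show ?thesis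
    unfolding pos_def_form_def using pos_def_formD(2)[OF g]
    by (auto simp: product_metric_def inner_commute)
qed

text \<open>The product metric does not depend on \<open>y\<close> and its Euclidean part is
  constant, so the Koszul expression involves only the first factor. The vector
  \<open>\<gamma>\<close> is described by its Koszul identity, the form in which the graph equation
  records it.\<close>

lemma christoffel_product_metric:
  fixes g :: "'e::euclidean_space \<Rightarrow> 'e \<Rightarrow> 'e \<Rightarrow> real" and y a b :: "'n::euclidean_space"
  assumes h: "riemannian_metric_on S g" and S: "open S" "z \<in> S"
  shows "\<exists>\<gamma>. (\<forall>\<zeta>. 2 * g z \<gamma> \<zeta> = christoffel_rhs g z u v \<zeta>) \<and>
     christoffel (product_metric g) (z, y) (u, a) (v, b) = (\<gamma>, 0)"
proof -
  obtain \<gamma> where \<gamma>: "\<And>\<zeta>. 2 * g z \<gamma> \<zeta> = christoffel_rhs g z u v \<zeta>"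
    using christoffel_exists[OF h S] by blast
  have d: "frechet_derivative (\<lambda>p. product_metric g p (p1, q1) (p2, q2)) (at (z, y)) (w, e)
     = frechet_derivative (\<lambda>q. g q p1 p2) (at z) w" for p1 p2 w and q1 q2 e :: 'n
  proof -
    have "((\<lambda>q. g q p1 p2) has_derivative frechet_derivative (\<lambda>q. g q p1 p2) (at z)) (at (fst (z, y)))"
      using frechet_derivative_works[THEN iffD1, OF smooth_on_differentiable[OF riemannian_metric_onD(2)[OF h] S(2)]] by simp
    from has_derivative_add_const[OF has_derivative_compose[OF has_derivative_fst[OF has_derivative_ident] this], of "q1 \<bullet> q2"]
    have "((\<lambda>p. product_metric g p (p1, q1) (p2, q2)) has_derivative
        (\<lambda>p. frechet_derivative (\<lambda>q. g q p1 p2) (at z) (fst p))) (at (z, y))"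
      by (simp add: product_metric_def case_prod_unfold)
    then show ?thesis by (simp add: frechet_derivative_at[symmetric])
  qed
  have "christoffel (product_metric g) (z, y) (u, a) (v, b) = (\<gamma>, 0)"
    unfolding christoffel_def
  proof (rule the_equality)
    show "\<forall>p. 2 * product_metric g (z, y) (\<gamma>, 0) p =
       frechet_derivative (\<lambda>q. product_metric g q (v, b) p) (at (z, y)) (u, a)
     + frechet_derivative (\<lambda>q. product_metric g q (u, a) p) (at (z, y)) (v, b)
     - frechet_derivative (\<lambda>q. product_metric g q (u, a) (v, b)) (at (z, y)) p"
      by (clarify, unfold d) (simp add: product_metric_def \<gamma> christoffel_rhs_def)
    fix w :: "'e \<times> 'n"
    assume w: "\<forall>p. 2 * product_metric g (z, y) w p =
       frechet_derivative (\<lambda>q. product_metric g q (v, b) p) (at (z, y)) (u, a)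
     + frechet_derivative (\<lambda>q. product_metric g q (u, a) p) (at (z, y)) (v, b)
     - frechet_derivative (\<lambda>q. product_metric g q (u, a) (v, b)) (at (z, y)) p"
    note P = pos_def_form_product_metric[of g z y, OF riemannian_metric_onD(1)[OF h S(2)]]
    have "product_metric g (z, y) w (p, e) = product_metric g (z, y) (\<gamma>, 0) (p, e)" for p e
      using w[rule_format, of "(p, e)", unfolded d] by (simp add: product_metric_def \<gamma>[symmetric] christoffel_rhs_def[symmetric])
    then have "product_metric g (z, y) (w - (\<gamma>, 0)) p = 0" for p
      by (cases p) (simp add: bilinear_simps[OF pos_def_formD(1)[OF P]])
    then have "w - (\<gamma>, 0) = 0" using pos_def_formD(3)[OF P, of "w - (\<gamma>, 0)"] by (metis less_irrefl)
    then show "w = (\<gamma>, 0)" by simp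
  qed
  with \<gamma> show ?thesis by blast
qed

text \<open>Each term differs from its normal part by a tangent vector, so when the trace of the
  normal parts vanishes, the trace of the full terms is tangent. For a graph, tangency is easier to
  read than a projection.\<close>

lemma mean_curvature_zero_tangent:
  fixes F :: "real^'m \<Rightarrow> 'e::euclidean_space"
  assumes h: "pos_def_form (h (F z))" and F: "linear (frechet_derivative F (at z))" "inj (frechet_derivative F (at z))"
    and z: "mean_curvature_vector h F z = 0"
  shows "(\<Sum>i\<in>UNIV. \<Sum>j\<in>UNIV. (matrix_inv (induced_gram h F z) $ i $ j) *\<^sub>R
      (frechet_derivative (\<lambda>y. frechet_derivative F (at y) (axis j 1)) (at z) (axis i 1)
         + christoffel h (F z) (frechet_derivative F (at z) (axis i 1)) (frechet_derivative F (at z) (axis j 1))))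
     \<in> range (frechet_derivative F (at z))"
proof -
  let ?T = "range (frechet_derivative F (at z))"
  define w where "w i j = frechet_derivative (\<lambda>y. frechet_derivative F (at y) (axis j 1)) (at z) (axis i 1)
         + christoffel h (F z) (frechet_derivative F (at z) (axis i 1)) (frechet_derivative F (at z) (axis j 1))" for i j :: 'm
  define n where "n i j = normal_part (h (F z)) ?T (w i j)" for i j
  define H where "H = matrix_inv (induced_gram h F z)"
  have T: "subspace ?T" using linear_subspace_image[OF F(1) subspace_UNIV] .
  have "(\<Sum>i\<in>UNIV. \<Sum>j\<in>UNIV. H $ i $ j *\<^sub>R n i j) = 0"
    using z unfolding mean_curvature_vector_def second_fundamental_form_def Let_def n_def w_def H_def .
  then have "(\<Sum>i\<in>UNIV. \<Sum>j\<in>UNIV. H $ i $ j *\<^sub>R w i j) = (\<Sum>i\<in>UNIV. \<Sum>j\<in>UNIV. H $ i $ j *\<^sub>R (w i j - n i j))"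
    by (simp add: scaleR_diff_right sum_subtractf)
  also have "\<dots> \<in> ?T"
    unfolding n_def by (intro subspace_sum[OF T] subspace_scale[OF T] normal_part_diff_in_range[OF h F])
  finally show ?thesis unfolding w_def H_def .
qed

lemma mean_curvature_vector_cong:
  assumes "open S" "z \<in> S" "\<And>y. y \<in> S \<Longrightarrow> F y = F' y"
  shows "mean_curvature_vector h F z = mean_curvature_vector h F' z"
proof -
  have 1: "frechet_derivative F (at y) = frechet_derivative F' (at y)" if "y \<in> S" for y
    by (rule frechet_derivative_cong_open[OF assms(1) that assms(3)])
  have 2: "frechet_derivative (\<lambda>y. frechet_derivative F (at y) v) (at z) = frechet_derivative (\<lambda>y. frechet_derivative F' (at y) v) (at z)" for v
    by (rule frechet_derivative_cong_open[OF assms(1,2)]) (simp add: 1)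
  show ?thesis
    unfolding mean_curvature_vector_def second_fundamental_form_def induced_gram_def Let_def
    by (simp add: 1[OF assms(2)] 2 assms(3)[OF assms(2)])
qed

text \<open>The minimal surface system in nonparametric form,
  \<open>H^{ij} (f_{ij} - \<Gamma>^k_{ij} f_k) = 0\<close>, with \<open>H\<close> the inverse of the
  induced metric and the Christoffel symbols of \<open>g\<close>.\<close>

definition minimal_graph_eq :: "(real^'m \<Rightarrow> real^'m \<Rightarrow> real^'m \<Rightarrow> real) \<Rightarrow> (real^'m \<Rightarrow> 'n::real_inner) \<Rightarrow> real^'m \<Rightarrow> bool" where
  "minimal_graph_eq g f z \<longleftrightarrow>
     (\<exists>\<Gamma>. (\<forall>i j \<zeta>. 2 * g z (\<Gamma> i j) \<zeta> = christoffel_rhs g z (axis i 1) (axis j 1) \<zeta>) \<and>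
       (let H = matrix_inv (gram (g z) (frechet_derivative f (at z))) in
        (\<Sum>i\<in>UNIV. \<Sum>j\<in>UNIV. H $ i $ j *\<^sub>R frechet_derivative (\<lambda>y. frechet_derivative f (at y) (axis j 1)) (at z) (axis i 1))
         = frechet_derivative f (at z) (\<Sum>i\<in>UNIV. \<Sum>j\<in>UNIV. H $ i $ j *\<^sub>R \<Gamma> i j)))"

text \<open>Tangent vectors of the graph are the pairs \<open>(v, df v)\<close>. The first component
  of the traced vector identifies \<open>v\<close> as the trace of the Christoffel vectors, and the
  second component is then the equation.\<close>

lemma mean_curvature_zero_graph:
  fixes f :: "real^'m \<Rightarrow> 'n::euclidean_space"
  assumes g: "riemannian_metric_on S g" and S: "open S" "z \<in> S" and f: "smooth_on S f"
    and mc: "mean_curvature_vector (product_metric g) (\<lambda>z. (z, f z)) z = 0"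
  shows "minimal_graph_eq g f z"
proof -
  let ?F = "\<lambda>z. (z, f z)"
  let ?Df = "frechet_derivative f (at z)"
  have fd: "f differentiable (at y)" if "y \<in> S" for y by (rule smooth_on_differentiable[OF f that])
  have dF: "frechet_derivative ?F (at y) = (\<lambda>v. (v, frechet_derivative f (at y) v))" if "y \<in> S" for y
    by (simp add: frechet_derivative_Pair fd[OF that] frechet_derivative_ident)
  have lin: "linear ?Df" by (rule linear_frechet_derivative[OF fd[OF S(2)]])
  have d2: "frechet_derivative (\<lambda>y. frechet_derivative ?F (at y) v) (at z) u
      = (0, frechet_derivative (\<lambda>y. frechet_derivative f (at y) v) (at z) u)" for u v
  proof -
    have "frechet_derivative (\<lambda>y. frechet_derivative ?F (at y) v) (at z)
       = frechet_derivative (\<lambda>y. (v, frechet_derivative f (at y) v)) (at z)"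
      by (rule frechet_derivative_cong_open[OF S]) (simp add: dF)
    then show ?thesis
      using smooth_on_differentiable[OF smooth_on_derivative[OF f] S(2)] by (simp add: frechet_derivative_Pair)
  qed
  have "linear (frechet_derivative ?F (at z))"
    unfolding dF[OF S(2)] using lin by (auto intro!: linearI simp: linear_add linear_cmul)
  moreover have "inj (frechet_derivative ?F (at z))" unfolding dF[OF S(2)] by (auto intro: injI)
  ultimately have R: "(\<Sum>i\<in>UNIV. \<Sum>j\<in>UNIV. (matrix_inv (induced_gram (product_metric g) ?F z) $ i $ j) *\<^sub>R
      (frechet_derivative (\<lambda>y. frechet_derivative ?F (at y) (axis j 1)) (at z) (axis i 1)
         + christoffel (product_metric g) (?F z) (frechet_derivative ?F (at z) (axis i 1)) (frechet_derivative ?F (at z) (axis j 1))))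
     \<in> range (frechet_derivative ?F (at z))"
    using pos_def_form_product_metric[of g z "f z", OF riemannian_metric_onD(1)[OF g S(2)]] mc
    by (intro mean_curvature_zero_tangent) auto
  have ig: "induced_gram (product_metric g) ?F z = gram (g z) ?Df"
    by (simp add: induced_gram_def gram_def form_matrix_def dF[OF S(2)] product_metric_def)
  define H where "H = matrix_inv (gram (g z) ?Df)"
  have "\<exists>\<Gamma>. \<forall>i j. (\<forall>\<zeta>. 2 * g z (\<Gamma> i j) \<zeta> = christoffel_rhs g z (axis i 1) (axis j 1) \<zeta>) \<and>
     christoffel (product_metric g) (z, f z) (axis i 1, ?Df (axis i 1)) (axis j 1, ?Df (axis j 1)) = (\<Gamma> i j, 0)"
  proof -
    have "\<exists>\<gamma>. (\<forall>\<zeta>. 2 * g z \<gamma> \<zeta> = christoffel_rhs g z (axis i 1) (axis j 1) \<zeta>) \<and>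
      christoffel (product_metric g) (z, f z) (axis i 1, ?Df (axis i 1)) (axis j 1, ?Df (axis j 1)) = (\<gamma>, 0)" for i j
      by (rule christoffel_product_metric[OF g S])
    then show ?thesis by metis
  qed
  then obtain \<Gamma> where \<Gamma>: "\<And>i j \<zeta>. 2 * g z (\<Gamma> i j) \<zeta> = christoffel_rhs g z (axis i 1) (axis j 1) \<zeta>"
     "\<And>i j. christoffel (product_metric g) (z, f z) (axis i 1, ?Df (axis i 1)) (axis j 1, ?Df (axis j 1)) = (\<Gamma> i j, 0)" by blast
  have "(\<Sum>i\<in>UNIV. \<Sum>j\<in>UNIV. H $ i $ j *\<^sub>R
      (\<Gamma> i j, frechet_derivative (\<lambda>y. frechet_derivative f (at y) (axis j 1)) (at z) (axis i 1)))
     \<in> range (\<lambda>v. (v, ?Df v))"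
    using R unfolding d2 ig H_def[symmetric] dF[OF S(2)] \<Gamma>(2) by simp
  then obtain v where v: "(\<Sum>i\<in>UNIV. \<Sum>j\<in>UNIV. H $ i $ j *\<^sub>R
      (\<Gamma> i j, frechet_derivative (\<lambda>y. frechet_derivative f (at y) (axis j 1)) (at z) (axis i 1))) = (v, ?Df v)" by blast
  have "v = (\<Sum>i\<in>UNIV. \<Sum>j\<in>UNIV. H $ i $ j *\<^sub>R \<Gamma> i j)"
    using arg_cong[OF v, of fst] by (simp add: fst_sum)
  moreover have "?Df v = (\<Sum>i\<in>UNIV. \<Sum>j\<in>UNIV. H $ i $ j *\<^sub>R
      frechet_derivative (\<lambda>y. frechet_derivative f (at y) (axis j 1)) (at z) (axis i 1))"
    using arg_cong[OF v, of snd] by (simp add: snd_sum)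
  ultimately show ?thesis
    unfolding minimal_graph_eq_def Let_def H_def[symmetric] using \<Gamma>(1) by (intro exI[of _ \<Gamma>]) simp
qed


section \<open>Divergence form\<close>

text \<open>The area density is included as a factor, so that the plain coordinate divergence of
  this field is what vanishes on minimal graphs.\<close>

definition flux_field :: "(real^'m \<Rightarrow> real^'m \<Rightarrow> real^'m \<Rightarrow> real) \<Rightarrow> (real^'m \<Rightarrow> 'n::real_inner) \<Rightarrow> 'm \<Rightarrow> real^'m \<Rightarrow> 'n" where
  "flux_field g f i z = (let G = gram (g z) (frechet_derivative f (at z)) in
     \<Sum>k\<in>UNIV. (sqrt (det G) * matrix_inv G $ i $ k) *\<^sub>R frechet_derivative f (at z) (axis k 1))"

lemma flux_eq_flux_field:
  "flux (g z) (frechet_derivative f (at z)) N = (\<Sum>i\<in>UNIV. flux_field g f i z \<bullet> N (axis i 1))"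
  by (simp add: flux_def flux_field_def Let_def trace_def matrix_matrix_mult_def form_matrix_def
      inner_sum_left sum_distrib_left mult_ac)

text \<open>With \<open>K i\<close> the \<open>i\<close>-th partial derivative of \<open>G\<close>
  and \<open>V = sqrt (det G)\<close>, the left side is the divergence of the columns of
  \<open>V H\<close>, divided by \<open>V\<close>. Hypothesis \<open>kos\<close> is the Koszul
  identity traced with \<open>H\<close>, so \<open>\<tau>\<close> is the traced Christoffel vector
  of the induced metric.\<close>

lemma divergence_algebra:
  fixes H G :: "real^'m^'m" and K :: "'m \<Rightarrow> real^'m^'m"
  assumes Hs: "transpose H = H" and HG: "H ** G = mat 1"
    and kos: "\<And>q. (\<Sum>p\<in>UNIV. \<Sum>s\<in>UNIV. H $ p $ s * (K q $ p $ s - K p $ s $ q - K s $ p $ q)) = - 2 * (G *v \<tau>) $ q"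
    and Ks: "\<And>i p q. K i $ p $ q = K i $ q $ p"
  shows "(\<Sum>i\<in>UNIV. trace (H ** K i) / 2 * H $ i $ k - (H ** K i ** H) $ i $ k) = - \<tau> $ k"
proof -
  have Hs': "H $ p $ s = H $ s $ p" for p s
    using Hs by (metis transpose_def vec_lambda_beta)
  define C where "C q = (\<Sum>i\<in>UNIV. (H ** K i) $ i $ q)" for q
  \<comment> \<open>Half of the traced Koszul expression, whose last two sums coincide by the
    symmetry of \<open>H\<close>.\<close>
  define B where "B q = trace (H ** K q) / 2 - C q" for q
  have t: "trace (H ** K q) = (\<Sum>p\<in>UNIV. \<Sum>s\<in>UNIV. H $ p $ s * K q $ p $ s)" for q
    by (simp add: trace_def matrix_matrix_mult_def Ks[of q _ _])
  have c1: "(\<Sum>p\<in>UNIV. \<Sum>s\<in>UNIV. H $ p $ s * K p $ s $ q) = C q" for q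
    by (simp add: C_def matrix_matrix_mult_def)
  have c2: "(\<Sum>p\<in>UNIV. \<Sum>s\<in>UNIV. H $ p $ s * K s $ p $ q) = C q" for q
    by (subst sum.swap) (simp add: C_def matrix_matrix_mult_def Hs'[of _ _])
  have B: "B q = - (G *v \<tau>) $ q" for q
  proof -
    have "trace (H ** K q) - C q - C q = - 2 * (G *v \<tau>) $ q"
      unfolding kos[symmetric] by (simp add: right_diff_distrib sum_subtractf t c1 c2)
    then show ?thesis by (simp add: B_def)
  qed
  have "(\<Sum>i\<in>UNIV. trace (H ** K i) / 2 * H $ i $ k - (H ** K i ** H) $ i $ k) = (\<Sum>q\<in>UNIV. B q * H $ q $ k)"
  proof -
    have "(\<Sum>i\<in>UNIV. (H ** K i ** H) $ i $ k) = (\<Sum>q\<in>UNIV. C q * H $ q $ k)"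
      unfolding C_def sum_distrib_right
      by (subst sum.swap) (simp add: matrix_matrix_mult_def[of _ H])
    then show ?thesis by (simp add: B_def sum_subtractf left_diff_distrib)
  qed
  also have "\<dots> = - (H *v (G *v \<tau>)) $ k"
    unfolding B by (simp add: matrix_vector_mult_def[of H] sum_negf Hs'[of k] mult.commute)
  also have "\<dots> = - \<tau> $ k" by (simp add: matrix_vector_mul_assoc HG)
  finally show ?thesis .
qed

lemma gram_mult_vec:
  fixes g :: "real^'m \<Rightarrow> real^'m \<Rightarrow> real" and L :: "real^'m \<Rightarrow> 'b::real_inner"
  assumes g: "bilinear g" and L: "linear L"
  shows "(gram g L *v v) $ q = g (axis q 1) v + L (axis q 1) \<bullet> L v"
proof -
  have p: "bilinear (\<lambda>u v. g u v + L u \<bullet> L v)"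
    by (intro bilinear_add g bilinear_pullback[OF bilinear_inner] L)
  have "g (axis q 1) v + L (axis q 1) \<bullet> L v =
     (\<Sum>i\<in>UNIV. if i = q then (\<Sum>j\<in>UNIV. v $ j * (g (axis q 1) (axis j 1) + L (axis q 1) \<bullet> L (axis j 1))) else 0)"
    unfolding bilinear_axis_expand[OF p, of "axis q 1" v] by (intro sum.cong) (auto simp: axis_def)
  then show ?thesis
    by (simp add: gram_def form_matrix_def matrix_vector_mult_def mult.commute)
qed

context
  fixes g :: "real^'m \<Rightarrow> real^'m \<Rightarrow> real^'m \<Rightarrow> real" and f :: "real^'m \<Rightarrow> 'n::euclidean_space" and S :: "(real^'m) set"
  assumes g: "riemannian_metric_on S g" and S: "open S" and f: "smooth_on S f"
begin

lemma graph_gram_C1: "C1_on S (\<lambda>z. gram (g z) (frechet_derivative f (at z)))"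
proof (rule C1_on_matrixI)
  fix i j
  have "C1_on S (\<lambda>z. g z (axis i 1) (axis j 1) + frechet_derivative f (at z) (axis i 1) \<bullet> frechet_derivative f (at z) (axis j 1))"
    by (intro C1_on_add C1_on_inner smooth_on_imp_C1_on[OF riemannian_metric_onD(2)[OF g]]
        smooth_on_imp_C1_on[OF smooth_on_derivative[OF f]])
  then show "C1_on S (\<lambda>z. gram (g z) (frechet_derivative f (at z)) $ i $ j)"
    by (simp add: gram_def form_matrix_def)
qed

lemma graph_linear: "z \<in> S \<Longrightarrow> linear (frechet_derivative f (at z))"
  by (rule linear_frechet_derivative[OF smooth_on_differentiable[OF f]])

lemma graph_gram_det_pos:
  "z \<in> S \<Longrightarrow> det (gram (g z) (frechet_derivative f (at z))) > 0"
  by (rule det_gram_pos[OF riemannian_metric_onD(1)[OF g] graph_linear])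

lemma flux_field_C1: "C1_on S (flux_field g f i)"
proof -
  have nz: "det (gram (g z) (frechet_derivative f (at z))) \<noteq> 0" if "z \<in> S" for z
    using graph_gram_det_pos[OF that] by simp
  have inv: "C1_on S (\<lambda>z. matrix_inv (gram (g z) (frechet_derivative f (at z))) $ i $ k)" for i k
    by (intro C1_on_linear[OF bounded_linear_vec_nth] C1_on_matrix_inv graph_gram_C1 nz)
  show ?thesis
    unfolding flux_field_def[abs_def] Let_def
    by (intro C1_on_sum C1_on_scaleR C1_on_mult C1_on_sqrt C1_on_det graph_gram_C1 nz inv
        graph_gram_det_pos smooth_on_imp_C1_on[OF smooth_on_derivative[OF f]])
qed

text \<open>Divided by the area density, the divergence is the trace of the second derivatives of
  \<open>f\<close> plus a combination of the first ones. By \<open>divergence_algebra\<close> the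
  latter is \<open>- df \<tau>\<close>, and by the graph equation the former is
  \<open>df \<tau>\<close>.\<close>

lemma flux_field_divergence:
  assumes z: "z \<in> S" and m: "minimal_graph_eq g f z"
  shows "(\<Sum>i\<in>UNIV. frechet_derivative (flux_field g f i) (at z) (axis i 1)) = 0"
proof -
  define D where "D k = frechet_derivative f (at z) (axis k 1)" for k
  define F2 where "F2 v k = frechet_derivative (\<lambda>y. frechet_derivative f (at y) (axis k 1)) (at z) v" for v and k :: 'm
  define hs where "hs v p q = frechet_derivative (\<lambda>y. g y (axis p 1) (axis q 1)) (at z) v" for v and p q :: 'm
  define G where "G y = gram (g y) (frechet_derivative f (at y))" for y
  define H where "H = matrix_inv (G z)"
  define V where "V = sqrt (det (G z))"
  define K where "K v = (\<chi> p q. hs v p q + F2 v p \<bullet> D q + D p \<bullet> F2 v q)" for v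
  have gz: "pos_def_form (g z)" by (rule riemannian_metric_onD(1)[OF g z])
  have lin: "linear (frechet_derivative f (at z))" by (rule graph_linear[OF z])
  have dp: "det (G z) > 0" unfolding G_def by (rule graph_gram_det_pos[OF z])
  have dnz: "det (G z) \<noteq> 0" using dp by simp
  have dD: "((\<lambda>y. frechet_derivative f (at y) (axis k 1)) has_derivative (\<lambda>v. F2 v k)) (at z)" for k
    unfolding F2_def
    using smooth_on_differentiable[OF smooth_on_derivative[OF f] z] frechet_derivative_works by blast
  have dg: "((\<lambda>y. g y (axis p 1) (axis q 1)) has_derivative (\<lambda>v. hs v p q)) (at z)" for p q
    unfolding hs_def
    using smooth_on_differentiable[OF riemannian_metric_onD(2)[OF g] z] frechet_derivative_works by blast
  have dG: "(G has_derivative K) (at z)"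
  proof (rule has_derivative_matrixI)
    fix p q
    show "((\<lambda>y. G y $ p $ q) has_derivative (\<lambda>v. K v $ p $ q)) (at z)"
      using has_derivative_add[OF dg[of p q] has_derivative_inner[OF dD[of p] dD[of q]]]
      by (simp add: G_def gram_def form_matrix_def K_def D_def add_ac)
  qed
  have dH: "((\<lambda>y. matrix_inv (G y) $ i $ k) has_derivative (\<lambda>v. - (H ** K v ** H) $ i $ k)) (at z)" for i k
    using bounded_linear.has_derivative[OF bounded_linear_vec_nth
        bounded_linear.has_derivative[OF bounded_linear_vec_nth has_derivative_matrix_inv[OF dG dnz]], of i k]
    by (simp add: H_def)
  have dV: "((\<lambda>y. sqrt (det (G y))) has_derivative (\<lambda>v. V * (trace (H ** K v) / 2))) (at z)"
  proof -
    have "det (G z) * (inverse (sqrt (det (G z)))) = sqrt (det (G z))"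
      using dp real_sqrt_mult_self[of "det (G z)"] by (simp add: field_simps)
    then have e: "inverse (sqrt (det (G z))) / 2 * (det (G z) * x) = V * (x / 2)" for x
      unfolding V_def by (metis (no_types, lifting) mult.assoc mult.commute times_divide_eq_left times_divide_eq_right)
    show ?thesis
      using has_derivative_compose[OF has_derivative_det[OF dG dnz] DERIV_real_sqrt[OF dp, unfolded has_field_derivative_def]]
      by (simp only: e H_def)
  qed
  have "(flux_field g f i has_derivative (\<lambda>v. \<Sum>k\<in>UNIV. (V * H $ i $ k) *\<^sub>R F2 v k
       + (V * - (H ** K v ** H) $ i $ k + V * (trace (H ** K v) / 2) * H $ i $ k) *\<^sub>R D k)) (at z)" for i
  proof -
    have "((\<lambda>y. \<Sum>k\<in>UNIV. (sqrt (det (G y)) * matrix_inv (G y) $ i $ k) *\<^sub>R frechet_derivative f (at y) (axis k 1))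
      has_derivative (\<lambda>v. \<Sum>k\<in>UNIV. (sqrt (det (G z)) * matrix_inv (G z) $ i $ k) *\<^sub>R F2 v k
       + (sqrt (det (G z)) * - (H ** K v ** H) $ i $ k + V * (trace (H ** K v) / 2) * matrix_inv (G z) $ i $ k) *\<^sub>R frechet_derivative f (at z) (axis k 1))) (at z)"
      by (intro has_derivative_sum has_derivative_scaleR has_derivative_mult dV dH dD)
    then show ?thesis
      by (simp only: flux_field_def[abs_def] Let_def G_def[symmetric] V_def[symmetric] H_def[symmetric] D_def[symmetric])
  qed
  from frechet_derivative_at[OF this, symmetric]
  have "(\<Sum>i\<in>UNIV. frechet_derivative (flux_field g f i) (at z) (axis i 1))
     = (\<Sum>i\<in>UNIV. \<Sum>k\<in>UNIV. (V * H $ i $ k) *\<^sub>R F2 (axis i 1) k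
       + (V * - (H ** K (axis i 1) ** H) $ i $ k + V * (trace (H ** K (axis i 1)) / 2) * H $ i $ k) *\<^sub>R D k)" by simp
  also have "\<dots> = V *\<^sub>R ((\<Sum>i\<in>UNIV. \<Sum>k\<in>UNIV. H $ i $ k *\<^sub>R F2 (axis i 1) k)
       + (\<Sum>i\<in>UNIV. \<Sum>k\<in>UNIV. (trace (H ** K (axis i 1)) / 2 * H $ i $ k - (H ** K (axis i 1) ** H) $ i $ k) *\<^sub>R D k))"
    unfolding scaleR_add_right scaleR_sum_right sum.distrib[symmetric]
    by (intro sum.cong refl) (simp add: algebra_simps)
  also have "(\<Sum>i\<in>UNIV. \<Sum>k\<in>UNIV. (trace (H ** K (axis i 1)) / 2 * H $ i $ k - (H ** K (axis i 1) ** H) $ i $ k) *\<^sub>R D k)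
     = (\<Sum>k\<in>UNIV. (\<Sum>i\<in>UNIV. trace (H ** K (axis i 1)) / 2 * H $ i $ k - (H ** K (axis i 1) ** H) $ i $ k) *\<^sub>R D k)"
    unfolding scaleR_sum_left by (rule sum.swap)
  finally have div: "(\<Sum>i\<in>UNIV. frechet_derivative (flux_field g f i) (at z) (axis i 1))
     = V *\<^sub>R ((\<Sum>i\<in>UNIV. \<Sum>k\<in>UNIV. H $ i $ k *\<^sub>R F2 (axis i 1) k)
       + (\<Sum>k\<in>UNIV. (\<Sum>i\<in>UNIV. trace (H ** K (axis i 1)) / 2 * H $ i $ k - (H ** K (axis i 1) ** H) $ i $ k) *\<^sub>R D k))" .
  obtain \<Gamma> where \<Gamma>: "\<And>i j \<zeta>. 2 * g z (\<Gamma> i j) \<zeta> = christoffel_rhs g z (axis i 1) (axis j 1) \<zeta>"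
    and eq: "(\<Sum>i\<in>UNIV. \<Sum>k\<in>UNIV. H $ i $ k *\<^sub>R F2 (axis i 1) k)
      = frechet_derivative f (at z) (\<Sum>i\<in>UNIV. \<Sum>j\<in>UNIV. H $ i $ j *\<^sub>R \<Gamma> i j)"
    using m unfolding minimal_graph_eq_def Let_def F2_def H_def G_def by blast
  define \<tau> where "\<tau> = (\<Sum>i\<in>UNIV. \<Sum>j\<in>UNIV. H $ i $ j *\<^sub>R \<Gamma> i j)"
  have symF2: "F2 (axis i 1) k = F2 (axis k 1) i" for i k
    unfolding F2_def by (rule symmetric_second_derivative[OF S z f])
  have symhs: "hs v p q = hs v q p" for v p q
  proof -
    have "frechet_derivative (\<lambda>y. g y (axis p 1) (axis q 1)) (at z) = frechet_derivative (\<lambda>y. g y (axis q 1) (axis p 1)) (at z)"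
      by (rule frechet_derivative_cong_open[OF S z]) (rule pos_def_formD(2)[OF riemannian_metric_onD(1)[OF g]])
    then show ?thesis by (simp add: hs_def)
  qed
  \<comment> \<open>The Koszul expression of the induced metric: of the six products of first and
    second derivatives of \<open>f\<close>, four cancel in pairs by symmetry and two equal ones
    remain.\<close>
  have kos: "K (axis q 1) $ p $ s - K (axis p 1) $ s $ q - K (axis s 1) $ p $ q
      = - 2 * (g z (\<Gamma> p s) (axis q 1) + F2 (axis p 1) s \<bullet> D q)" for p q s
    using \<Gamma>[of p s "axis q 1"] symF2[of q p] symF2[of q s] symF2[of s p]
    unfolding christoffel_rhs_def hs_def[symmetric] K_def
    by (simp add: inner_commute symhs[of _ q])
  have gt: "g z \<tau> (axis q 1) = (\<Sum>p\<in>UNIV. \<Sum>s\<in>UNIV. H $ p $ s * g z (\<Gamma> p s) (axis q 1))" for q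
  proof -
    have l: "linear (\<lambda>x. g z x (axis q 1))" using pos_def_formD(1)[OF gz] unfolding bilinear_def by blast
    show ?thesis unfolding \<tau>_def by (simp add: linear_sum[OF l] linear_cmul[OF l])
  qed
  have "(\<Sum>p\<in>UNIV. \<Sum>s\<in>UNIV. H $ p $ s * (K (axis q 1) $ p $ s - K (axis p 1) $ s $ q - K (axis s 1) $ p $ q))
     = - 2 * (G z *v \<tau>) $ q" for q
  proof -
    have "(\<Sum>p\<in>UNIV. \<Sum>s\<in>UNIV. H $ p $ s * (K (axis q 1) $ p $ s - K (axis p 1) $ s $ q - K (axis s 1) $ p $ q))
       = - 2 * ((\<Sum>p\<in>UNIV. \<Sum>s\<in>UNIV. H $ p $ s * g z (\<Gamma> p s) (axis q 1))
          + (\<Sum>p\<in>UNIV. \<Sum>s\<in>UNIV. H $ p $ s *\<^sub>R F2 (axis p 1) s) \<bullet> D q)"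
      unfolding kos inner_sum_left sum.distrib[symmetric] sum_distrib_left
      by (intro sum.cong refl) (simp add: algebra_simps)
    \<comment> \<open>The graph equation enters here: it turns the traced second derivatives into
      \<open>df \<tau>\<close>, which completes \<open>g\<close> to the Gram matrix.\<close>
    also have "\<dots> = - 2 * (g z (axis q 1) \<tau> + D q \<bullet> frechet_derivative f (at z) \<tau>)"
      unfolding eq gt[symmetric] \<tau>_def[symmetric] by (simp add: inner_commute pos_def_formD(2)[OF gz, of \<tau>])
    finally show ?thesis
      unfolding G_def by (simp add: gram_mult_vec[OF pos_def_formD(1)[OF gz] lin] D_def)
  qed
  moreover have "transpose H = H"
    unfolding H_def G_def by (rule matrix_inv_gram_sym[OF pos_def_formD(2)[OF gz]]) (use dnz in \<open>simp add: G_def\<close>)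
  moreover have "H ** G z = mat 1" unfolding H_def by (rule matrix_inv_mult(2)[OF dnz])
  moreover have "K v $ p $ q = K v $ q $ p" for v p q
    by (simp add: K_def inner_commute symhs[of v p q])
  ultimately have alg: "(\<Sum>i\<in>UNIV. trace (H ** K (axis i 1)) / 2 * H $ i $ k - (H ** K (axis i 1) ** H) $ i $ k) = - \<tau> $ k" for k
    by (intro divergence_algebra[where K = "\<lambda>i. K (axis i 1)" and G = "G z"]) auto
  have "frechet_derivative f (at z) \<tau> = (\<Sum>k\<in>UNIV. \<tau> $ k *\<^sub>R D k)"
  proof -
    have "\<tau> = (\<Sum>k\<in>UNIV. \<tau> $ k *\<^sub>R axis k 1)"
      using basis_expansion[of \<tau>] by (simp add: scalar_mult_eq_scaleR)
    then have "frechet_derivative f (at z) \<tau> = frechet_derivative f (at z) (\<Sum>k\<in>UNIV. \<tau> $ k *\<^sub>R axis k 1)" by simp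
    then show ?thesis by (simp add: linear_sum[OF lin] linear_cmul[OF lin] D_def)
  qed
  then show ?thesis unfolding div eq alg \<tau>_def[symmetric] by (simp add: sum_negf)
qed

end


section \<open>Change of variables for arbitrary finite index types\<close>

text \<open>The change-of-variables theorem of the library is stated for index types that are
  well-orders; this copy of a finite type carries one.\<close>

typedef 'a wo = "UNIV :: 'a set" by blast

lemma bij_Rep_wo: "bij (Rep_wo :: 'a wo \<Rightarrow> 'a)"
  by (rule o_bij[where g = Abs_wo]) (auto simp: Rep_wo_inverse Abs_wo_inverse fun_eq_iff)

lemma bij_Abs_wo: "bij (Abs_wo :: 'a \<Rightarrow> 'a wo)"
  by (rule o_bij[where g = Rep_wo]) (auto simp: Rep_wo_inverse Abs_wo_inverse fun_eq_iff)

instance wo :: (finite) finite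
proof
  show "finite (UNIV :: 'a wo set)"
    using finite_imageI[of "UNIV :: 'a set" Abs_wo] bij_Abs_wo by (metis bij_is_surj finite_class.finite_UNIV)
qed

text \<open>Any injection will do, since only the existence of some well-order on the index type
  matters.\<close>

definition wo_index :: "'a::finite wo \<Rightarrow> nat" where
  "wo_index = (SOME f. inj f)"

lemma inj_wo_index: "inj wo_index"
proof -
  have "\<exists>f :: 'a::finite wo \<Rightarrow> nat. inj f"
    using finite_imp_inj_to_nat_seg[of "UNIV :: 'a wo set"] by auto
  then show ?thesis unfolding wo_index_def by (rule someI_ex)
qed

instantiation wo :: (finite) wellorder
begin

definition less_eq_wo :: "'a wo \<Rightarrow> 'a wo \<Rightarrow> bool" where "less_eq_wo x y \<longleftrightarrow> wo_index x \<le> wo_index y"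
definition less_wo :: "'a wo \<Rightarrow> 'a wo \<Rightarrow> bool" where "less_wo x y \<longleftrightarrow> wo_index x < wo_index y"

instance
proof
  fix x y :: "'a wo" and P
  show "x \<le> y \<Longrightarrow> y \<le> x \<Longrightarrow> x = y"
    using inj_wo_index by (auto simp: less_eq_wo_def inj_def)
  assume *: "\<And>x :: 'a wo. (\<And>y. y < x \<Longrightarrow> P y) \<Longrightarrow> P x"
  show "P x"
    by (induction x rule: measure_induct_rule[of wo_index]) (rule *, simp add: less_wo_def)
qed (auto simp: less_eq_wo_def less_wo_def)

end

definition wo_vec :: "real^'m \<Rightarrow> real^'m wo" where
  "wo_vec x = (\<chi> i. x $ Rep_wo i)"

definition unwo_vec :: "real^'m wo \<Rightarrow> real^'m" where
  "unwo_vec x = (\<chi> i. x $ Abs_wo i)"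

lemma wo_vec_inverse [simp]: "unwo_vec (wo_vec x) = x" "wo_vec (unwo_vec y) = y"
  by (simp_all add: wo_vec_def unwo_vec_def Abs_wo_inverse Rep_wo_inverse)

lemma linear_wo_vec: "linear wo_vec" "linear unwo_vec"
  by (auto intro!: linearI simp: wo_vec_def unwo_vec_def vec_eq_iff)

lemma bounded_linear_wo_vec: "bounded_linear wo_vec" "bounded_linear unwo_vec"
  by (simp_all add: linear_wo_vec linear_linear)

lemma wo_vec_measurable: "wo_vec \<in> borel_measurable borel"
  by (intro borel_measurable_continuous_onI linear_continuous_on bounded_linear_wo_vec)

lemma prod_Basis_vec:
  fixes h :: "real^'n \<Rightarrow> 'c::comm_monoid_mult"
  shows "(\<Prod>b\<in>Basis. h b) = (\<Prod>i\<in>UNIV. h (axis i 1))"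
proof -
  have B: "(Basis :: (real^'n) set) = range (\<lambda>i. axis i 1)" by (auto simp: Basis_vec_def)
  have "(\<Prod>b\<in>range (\<lambda>i::'n. axis i (1::real)). h b) = (\<Prod>i\<in>UNIV. h (axis i 1))"
    by (subst prod.reindex) (auto simp: inj_on_def axis_eq_axis)
  then show ?thesis using B by metis
qed

text \<open>Relabelling coordinates carries boxes to boxes of equal volume, and boxes determine
  Lebesgue measure.\<close>

lemma distr_wo_vec: "distr lborel borel wo_vec = (lborel :: (real^('m::finite) wo) measure)"
proof (rule lborel_eqI[symmetric])
  fix l u :: "real^'m wo"
  assume le: "\<And>b. b \<in> Basis \<Longrightarrow> l \<bullet> b \<le> u \<bullet> b"
  then have le': "l $ i \<le> u $ i" for i
    using le[of "axis i 1"] by (simp add: axis_in_Basis_iff inner_axis)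
  have "wo_vec -` box l u \<inter> space lborel = box (unwo_vec l) (unwo_vec u)"
  proof -
    have "(\<forall>i. l $ i < x $ Rep_wo i \<and> x $ Rep_wo i < u $ i) \<longleftrightarrow>
       (\<forall>i. l $ Abs_wo i < x $ i \<and> x $ i < u $ Abs_wo i)" for x :: "real^'m"
      by (metis Abs_wo_inverse Rep_wo_inverse UNIV_I)
    then show ?thesis by (auto simp: mem_box_cart wo_vec_def unwo_vec_def)
  qed
  then have "emeasure (distr lborel borel wo_vec) (box l u) = emeasure lborel (box (unwo_vec l) (unwo_vec u))"
    using wo_vec_measurable emeasure_distr[of wo_vec lborel borel "box l u"] by simp
  also have "\<dots> = (\<Prod>b\<in>Basis. (unwo_vec u - unwo_vec l) \<bullet> b)"
    by (subst emeasure_lborel_box) (auto simp: Basis_vec_def inner_axis unwo_vec_def le')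
  also have "(\<Prod>b\<in>Basis. (unwo_vec u - unwo_vec l) \<bullet> b) = (\<Prod>i\<in>UNIV. (unwo_vec u - unwo_vec l) $ i)"
    by (simp add: prod_Basis_vec inner_axis)
  also have "\<dots> = (\<Prod>i\<in>UNIV. (u - l) $ i)"
    using prod.reindex_bij_betw[of Abs_wo UNIV UNIV "\<lambda>i. (u - l) $ i"] bij_Abs_wo
    by (simp add: unwo_vec_def)
  also have "\<dots> = (\<Prod>b\<in>Basis. (u - l) \<bullet> b)"
    by (simp add: prod_Basis_vec inner_axis)
  finally show "emeasure (distr lborel borel wo_vec) (box l u) = ennreal (\<Prod>b\<in>Basis. (u - l) \<bullet> b)" .
qed simp

lemma wo_vec_integral:
  fixes f :: "real^('m::finite) wo \<Rightarrow> 'b::{banach, second_countable_topology}"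
  shows "integrable lborel (\<lambda>x. f (wo_vec x)) \<longleftrightarrow> integrable lborel f"
    and "integral\<^sup>L lborel (\<lambda>x. f (wo_vec x)) = integral\<^sup>L lborel f"
proof -
  have m: "wo_vec \<in> measurable lborel borel" using wo_vec_measurable by simp
  have bk: "integrable lborel f" if "integrable lborel (\<lambda>x. f (wo_vec x))"
  proof -
    have "(\<lambda>x. f (wo_vec x)) \<in> borel_measurable borel" using that borel_measurable_integrable by force
    moreover have "unwo_vec \<in> borel_measurable borel"
      by (intro borel_measurable_continuous_onI linear_continuous_on bounded_linear_wo_vec)
    ultimately have "(\<lambda>y. f (wo_vec (unwo_vec y))) \<in> borel_measurable borel"
      by (rule measurable_compose[rotated])
    then have "f \<in> borel_measurable borel" by simp
    from integrable_distr_eq[OF m this] that show ?thesis by (simp add: distr_wo_vec)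
  qed
  show iff: "integrable lborel (\<lambda>x. f (wo_vec x)) \<longleftrightarrow> integrable lborel f"
    using bk integrable_distr[OF m, of f] by (auto simp: distr_wo_vec)
  show "integral\<^sup>L lborel (\<lambda>x. f (wo_vec x)) = integral\<^sup>L lborel f"
  proof (cases "integrable lborel f")
    case True
    then have "f \<in> borel_measurable borel" using borel_measurable_integrable by force
    from integral_distr[OF m this] show ?thesis by (simp add: distr_wo_vec)
  next
    case False
    then show ?thesis using iff by (simp add: not_integrable_integral_eq)
  qed
qed

text \<open>Induction over transpositions, which relabelling carries to transpositions.\<close>

lemma sign_wo:
  fixes p :: "'m::finite \<Rightarrow> 'm"
  assumes "p permutes UNIV"
  shows "sign (\<lambda>i. Abs_wo (p (Rep_wo i))) = sign p \<and> (\<lambda>i. Abs_wo (p (Rep_wo i))) permutes UNIV"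
  using assms finite_class.finite_UNIV
proof (induction rule: permutes_induct)
  case id
  have "(\<lambda>i :: 'm wo. Abs_wo (id (Rep_wo i))) = id" by (auto simp: Rep_wo_inverse)
  then show ?case by (simp add: permutes_id)
next
  case (swap a b p)
  let ?q = "\<lambda>i. Abs_wo (p (Rep_wo i))"
  have e: "(\<lambda>i. Abs_wo ((Transposition.transpose a b \<circ> p) (Rep_wo i))) = Transposition.transpose (Abs_wo a) (Abs_wo b) \<circ> ?q"
    by (auto simp: fun_eq_iff Transposition.transpose_def Abs_wo_inject)
  have 1: "permutation p" "permutation ?q" "permutation (Transposition.transpose a b)" "permutation (Transposition.transpose (Abs_wo a) (Abs_wo b))"
    using swap permutation_permutes[of p] permutation_permutes[of ?q] by (blast intro: permutation_swap_id finite_class.finite_UNIV)+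
  have "sign (Transposition.transpose (Abs_wo a) (Abs_wo b) \<circ> ?q) = sign (Transposition.transpose a b \<circ> p)"
    using swap 1 by (simp add: sign_compose sign_swap_id Abs_wo_inject)
  moreover have "(Transposition.transpose (Abs_wo a) (Abs_wo b) \<circ> ?q) permutes UNIV"
    using swap by (intro permutes_compose permutes_swap_id) auto
  ultimately show ?case unfolding e by blast
qed

lemma det_wo:
  fixes A :: "real^'m^'m"
  shows "det (\<chi> i j. A $ Rep_wo i $ Rep_wo j) = det A"
proof -
  let ?c = "\<lambda>p i. Abs_wo (p (Rep_wo i)) :: 'm wo"
  have bij: "bij_betw ?c {p. p permutes UNIV} {q. q permutes UNIV}"
  proof (rule bij_betwI[where g = "\<lambda>q i. Rep_wo (q (Abs_wo i))"])
    show "?c \<in> {p. p permutes UNIV} \<rightarrow> {q. q permutes UNIV}" using sign_wo by blast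
    show "(\<lambda>q i. Rep_wo (q (Abs_wo i))) \<in> {q :: 'm wo \<Rightarrow> 'm wo. q permutes UNIV} \<rightarrow> {p. p permutes UNIV}"
    proof clarify
      fix q :: "'m wo \<Rightarrow> 'm wo" assume "q permutes UNIV"
      then have "bij q" by (simp add: permutes_univ bij_def inj_def surj_def) metis
      then have "bij (Rep_wo \<circ> (q \<circ> Abs_wo))" by (intro bij_comp bij_Rep_wo bij_Abs_wo)
      then show "(\<lambda>i. Rep_wo (q (Abs_wo i))) permutes UNIV" using bij_imp_permutes[of "\<lambda>i. Rep_wo (q (Abs_wo i))" UNIV] by (simp add: o_def)
    qed
  qed (auto simp: Abs_wo_inverse Rep_wo_inverse)
  have "det (\<chi> i j. A $ Rep_wo i $ Rep_wo j)
     = (\<Sum>p | p permutes UNIV. of_int (sign (?c p)) * (\<Prod>i\<in>UNIV. A $ Rep_wo i $ p (Rep_wo i)))"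
    unfolding det_def by (subst sum.reindex_bij_betw[OF bij, symmetric]) (simp add: Abs_wo_inverse)
  also have "\<dots> = (\<Sum>p | p permutes UNIV. of_int (sign p) * (\<Prod>i\<in>UNIV. A $ i $ p i))"
  proof (rule sum.cong[OF refl])
    fix p :: "'m \<Rightarrow> 'm" assume "p \<in> {p. p permutes UNIV}"
    then show "of_int (sign (?c p)) * (\<Prod>i\<in>UNIV. A $ Rep_wo i $ p (Rep_wo i)) = of_int (sign p) * (\<Prod>i\<in>UNIV. A $ i $ p i)"
      using sign_wo[of p] prod.reindex_bij_betw[of Rep_wo UNIV UNIV "\<lambda>i. A $ i $ p i"] bij_Rep_wo by simp
  qed
  finally show ?thesis unfolding det_def .
qed

lemma lborel_change_of_variables_wo:
  fixes F :: "real^'m::{finite,wellorder} \<Rightarrow> real"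
  assumes U: "open U" and V: "g ` U \<in> sets borel"
    and d: "\<And>z. z \<in> U \<Longrightarrow> (g has_derivative g' z) (at z)" and inj: "inj_on g U"
    and i1: "integrable lborel (\<lambda>z. if z \<in> U then \<bar>det (matrix (g' z))\<bar> * F (g z) else 0)"
    and i2: "integrable lborel (\<lambda>y. if y \<in> g ` U then F y else 0)"
  shows "(LINT z|lborel. (if z \<in> U then \<bar>det (matrix (g' z))\<bar> * F (g z) else 0)) = (LINT y|lborel. (if y \<in> g ` U then F y else 0))"
proof -
  \<comment> \<open>A fixed nonzero vector: the change-of-variables theorem is applied to the
    vector-valued integrand \<open>F y *\<^sub>R e\<close>, and \<open>e\<close> is cancelled at the
    end.\<close>
  define e where "e = (axis undefined 1 :: real^'m::_)"
  have hi: "f absolutely_integrable_on S \<and> integral S f = (LINT z|lborel. (if z \<in> S then h z else 0)) *\<^sub>R e"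
    if "integrable lborel (\<lambda>z. if z \<in> S then h z else 0)" "\<And>z. f z = h z *\<^sub>R e"
    for f :: "real^'m::_ \<Rightarrow> real^'m::_" and h S
  proof -
    let ?f = "\<lambda>z. (if z \<in> S then h z else 0) *\<^sub>R e"
    have e1: "?f = (\<lambda>z. if z \<in> S then f z else 0)" using that(2) by auto
    have i: "integrable lborel ?f" using that(1) by (rule integrable_scaleR_left)
    then have "integrable lebesgue ?f"
      using integrable_completion[of ?f lborel] borel_measurable_integrable by blast
    then have "?f absolutely_integrable_on UNIV" by (simp add: set_integrable_def)
    then have 1: "f absolutely_integrable_on S" unfolding e1 by (simp only: absolutely_integrable_restrict_UNIV)
    have "(?f has_integral (LINT z|lborel. ?f z)) UNIV" by (rule has_integral_integral_lborel[OF i])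
    then have "(f has_integral (LINT z|lborel. ?f z)) S" unfolding e1 by (simp only: has_integral_restrict_UNIV)
    then have "integral S f = (LINT z|lborel. ?f z)" by (rule integral_unique)
    with 1 that(1) show ?thesis by simp
  qed
  have "(\<lambda>z. \<bar>det (matrix (g' z))\<bar> *\<^sub>R (F (g z) *\<^sub>R e)) absolutely_integrable_on U \<and>
        integral U (\<lambda>z. \<bar>det (matrix (g' z))\<bar> *\<^sub>R (F (g z) *\<^sub>R e)) = (LINT z|lborel. (if z \<in> U then \<bar>det (matrix (g' z))\<bar> * F (g z) else 0)) *\<^sub>R e"
    by (rule hi[OF i1]) simp
  moreover have "U \<in> sets lebesgue" using U by auto
  moreover have "(g has_derivative g' z) (at z within U)" if "z \<in> U" for z
    using d[OF that] has_derivative_at_withinI by blast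
  ultimately have "integral (g ` U) (\<lambda>y. F y *\<^sub>R e) = (LINT z|lborel. (if z \<in> U then \<bar>det (matrix (g' z))\<bar> * F (g z) else 0)) *\<^sub>R e"
    using has_absolute_integral_change_of_variables[of U g g' "\<lambda>y. F y *\<^sub>R e"] inj by blast
  moreover have "integral (g ` U) (\<lambda>y. F y *\<^sub>R e) = (LINT y|lborel. (if y \<in> g ` U then F y else 0)) *\<^sub>R e"
    using hi[OF i2, of "\<lambda>y. F y *\<^sub>R e"] by simp
  moreover have "e \<noteq> 0" by (simp add: e_def axis_eq_0_iff)
  ultimately show ?thesis by simp
qed

lemma lborel_change_of_variables:
  fixes F :: "real^'m \<Rightarrow> real"
  assumes U: "open U" and V: "open (g ` U)"
    and d: "\<And>z. z \<in> U \<Longrightarrow> (g has_derivative g' z) (at z)" and inj: "inj_on g U"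
    and i1: "integrable lborel (\<lambda>z. if z \<in> U then \<bar>det (matrix (g' z))\<bar> * F (g z) else 0)"
    and i2: "integrable lborel (\<lambda>y. if y \<in> g ` U then F y else 0)"
  shows "(LINT z|lborel. (if z \<in> U then \<bar>det (matrix (g' z))\<bar> * F (g z) else 0)) = (LINT y|lborel. (if y \<in> g ` U then F y else 0))"
proof -
  define U2 where "U2 = unwo_vec -` U"
  define g2 where "g2 y = wo_vec (g (unwo_vec y))" for y :: "real^'m wo"
  define g2' where "g2' y v = wo_vec (g' (unwo_vec y) (unwo_vec v))" for y v :: "real^'m wo"
  define F2 where "F2 y = F (unwo_vec y)" for y :: "real^'m wo"
  have im: "g2 ` U2 = unwo_vec -` (g ` U)"
  proof (intro equalityI subsetI)
    fix y assume "y \<in> unwo_vec -` (g ` U)"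
    then obtain x where x: "x \<in> U" "unwo_vec y = g x" by auto
    then have "y = g2 (wo_vec x)" by (metis g2_def wo_vec_inverse)
    then show "y \<in> g2 ` U2" using x(1) by (simp add: U2_def)
  qed (auto simp: g2_def U2_def)
  have cu: "continuous_on UNIV unwo_vec" by (rule linear_continuous_on[OF bounded_linear_wo_vec(2)])
  have 1: "open U2" "open (g2 ` U2)"
    unfolding im using open_vimage[OF U cu] open_vimage[OF V cu] by (auto simp: U2_def)
  have 2: "(g2 has_derivative g2' y) (at y)" if "y \<in> U2" for y
  proof -
    have "(unwo_vec has_derivative unwo_vec) (at y)"
      by (rule bounded_linear_imp_has_derivative[OF bounded_linear_wo_vec(2)])
    from has_derivative_compose[OF this d] that
    have "((\<lambda>y. g (unwo_vec y)) has_derivative (\<lambda>v. g' (unwo_vec y) (unwo_vec v))) (at y)" by (simp add: U2_def)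
    from bounded_linear.has_derivative[OF bounded_linear_wo_vec(1) this] show ?thesis
      unfolding g2_def[abs_def] g2'_def[abs_def] .
  qed
  have 3: "inj_on g2 U2"
    using inj unfolding inj_on_def g2_def U2_def by (metis vimageD wo_vec_inverse)
  have dt: "det (matrix (g2' (wo_vec z))) = det (matrix (g' z))" for z
  proof -
    have "unwo_vec (axis j 1) = axis (Rep_wo j) (1::real)" for j :: "'m wo"
      by (auto simp: unwo_vec_def axis_def vec_eq_iff Abs_wo_inverse Rep_wo_inverse)
    then have "matrix (g2' (wo_vec z)) $ i $ j = matrix (g' z) $ Rep_wo i $ Rep_wo j" for i j
      by (simp add: matrix_def g2'_def wo_vec_def[of "g' _ _"])
    then have "matrix (g2' (wo_vec z)) = (\<chi> i j. matrix (g' z) $ Rep_wo i $ Rep_wo j)"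
      by (simp add: vec_eq_iff)
    then show ?thesis by (simp add: det_wo)
  qed
  let ?f = "\<lambda>z. if z \<in> U2 then \<bar>det (matrix (g2' z))\<bar> * F2 (g2 z) else 0"
  let ?h = "\<lambda>y. if y \<in> g2 ` U2 then F2 y else 0"
  have f: "(\<lambda>z. ?f (wo_vec z)) = (\<lambda>z. if z \<in> U then \<bar>det (matrix (g' z))\<bar> * F (g z) else 0)"
    by (auto simp: U2_def dt F2_def g2_def)
  have h: "(\<lambda>y. ?h (wo_vec y)) = (\<lambda>y. if y \<in> g ` U then F y else 0)"
    unfolding im by (auto simp: F2_def)
  have "integral\<^sup>L lborel ?f = integral\<^sup>L lborel ?h"
    by (rule lborel_change_of_variables_wo[OF 1(1) _ 2 3])
      (use 1 i1 i2 wo_vec_integral(1)[of ?f] wo_vec_integral(1)[of ?h] in \<open>auto simp only: f h borel_open\<close>)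
  then show ?thesis
    using wo_vec_integral(2)[of ?f] wo_vec_integral(2)[of ?h] by (simp only: f h)
qed


section \<open>The weak form in a chart\<close>

lemma C1_on_line_bound:
  fixes X :: "'a::euclidean_space \<Rightarrow> real"
  assumes X: "C1_on UNIV X" and s: "s > 0"
  shows "\<exists>r. 0 < r \<and> r < s \<and> X (x + s *\<^sub>R e) - X x = s * frechet_derivative X (at (x + r *\<^sub>R e)) e"
proof -
  have d: "((\<lambda>r. X (x + r *\<^sub>R e)) has_real_derivative frechet_derivative X (at (x + r *\<^sub>R e)) e) (at r)" for r
  proof -
    have 1: "((\<lambda>r. x + r *\<^sub>R e) has_derivative (\<lambda>h. h *\<^sub>R e)) (at r)"
      by (auto intro!: derivative_eq_intros)
    have 2: "(X has_derivative frechet_derivative X (at (x + r *\<^sub>R e))) (at (x + r *\<^sub>R e))"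
      using C1_onD(1)[OF X] by blast
    have "(\<lambda>h. frechet_derivative X (at (x + r *\<^sub>R e)) (h *\<^sub>R e)) = (*) (frechet_derivative X (at (x + r *\<^sub>R e)) e)"
      using linear_cmul[OF has_derivative_linear[OF 2]] by (simp add: fun_eq_iff mult.commute)
    then show ?thesis using has_derivative_compose[OF 1 2] by (simp add: has_field_derivative_def)
  qed
  show ?thesis using MVT2[OF s, of "\<lambda>r. X (x + r *\<^sub>R e)", OF d] by auto
qed

lemma compact_support_integrable:
  fixes f :: "'a::euclidean_space \<Rightarrow> real"
  assumes c: "continuous_on UNIV f" and K: "compact K" "\<And>x. x \<notin> K \<Longrightarrow> f x = 0"
  shows "integrable lborel f"
proof -
  have "integrable lborel (\<lambda>x. indicator K x *\<^sub>R f x)"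
    by (rule borel_integrable_compact[OF K(1) continuous_on_subset[OF c]]) simp
  moreover have "(\<lambda>x. indicator K x *\<^sub>R f x) = f" using K(2) by (auto simp: indicator_def fun_eq_iff)
  ultimately show ?thesis by simp
qed

text \<open>Translation invariance of Lebesgue measure makes the difference quotients integrate to \<open>0\<close>.\<close>

lemma integral_directional_derivative:
  fixes X :: "'a::euclidean_space \<Rightarrow> real"
  assumes X: "C1_on UNIV X" and K: "compact K" and z: "\<And>x. x \<notin> K \<Longrightarrow> X x = 0"
  shows "integrable lborel (\<lambda>x. frechet_derivative X (at x) e)"
    and "(LINT x|lborel. frechet_derivative X (at x) e) = 0"
proof -
  define D where "D x = frechet_derivative X (at x) e" for x
  have cD: "continuous_on UNIV D" unfolding D_def by (rule C1_onD(2)[OF X])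
  have cX: "continuous_on UNIV X" by (rule C1_on_continuous[OF X])
  have zD: "D x = 0" if "x \<notin> K" for x
  proof -
    have "frechet_derivative X (at x) = frechet_derivative (\<lambda>_. 0) (at x)"
      by (rule frechet_derivative_cong_open[of "- K"]) (use K that z in \<open>auto simp: compact_imp_closed\<close>)
    then show ?thesis by (simp add: D_def)
  qed
  show "integrable lborel (\<lambda>x. frechet_derivative X (at x) e)"
    using compact_support_integrable[OF cD K zD] by (simp add: D_def)
  have iX: "integrable lborel X" by (rule compact_support_integrable[OF cX K z])
  \<comment> \<open>Sweeps \<open>K\<close> backwards along \<open>e\<close> by all steps up to
    \<open>1\<close>. Every difference quotient \<open>q n\<close> vanishes outside it, which gives
    a common dominating function.\<close>
  define K' where "K' = (\<lambda>(k, t). k - t *\<^sub>R e) ` (K \<times> {0..1})"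
  have K': "compact K'"
    unfolding K'_def by (intro compact_continuous_image compact_Times K compact_Icc)
      (auto simp: case_prod_unfold intro!: continuous_intros)
  have "bounded (D ` K)" using compact_continuous_image[OF continuous_on_subset[OF cD] K] compact_imp_bounded by blast
  then obtain C0 where C0: "\<And>x. x \<in> K \<Longrightarrow> \<bar>D x\<bar> \<le> C0" unfolding bounded_iff by force
  define C where "C = max C0 0"
  have C: "\<bar>D x\<bar> \<le> C" for x using C0[of x] zD[of x] by (cases "x \<in> K") (auto simp: C_def)
  define s where "s n = inverse (real (Suc n))" for n
  have s: "0 < s n" "s n \<le> 1" for n by (auto simp: s_def field_simps)
  define q where "q n x = (X (x + s n *\<^sub>R e) - X x) / s n" for n x
  have trX: "integrable lborel (\<lambda>x. X (x + c))" "(LINT x|lborel. X (x + c)) = integral\<^sup>L lborel X" for c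
  proof -
    have m: "X \<in> borel_measurable borel" using borel_measurable_integrable[OF iX] by simp
    have m2: "(+) c \<in> measurable lborel borel" by simp
    show "integrable lborel (\<lambda>x. X (x + c))"
      using integrable_distr_eq[OF m2 m] iX by (simp add: lborel_distr_plus add.commute)
    show "(LINT x|lborel. X (x + c)) = integral\<^sup>L lborel X"
      using integral_distr[OF m2 m] by (simp add: lborel_distr_plus add.commute)
  qed
  have iq: "integrable lborel (q n)" "integral\<^sup>L lborel (q n) = 0" for n
    unfolding q_def using trX[of "s n *\<^sub>R e"] iX by simp_all
  have qD: "\<exists>r. 0 < r \<and> r < s n \<and> q n x = D (x + r *\<^sub>R e)" for n x
    using C1_on_line_bound[OF X s(1)[of n], of x e] s(1)[of n] unfolding q_def D_def by fastforce
  have "(\<lambda>n. integral\<^sup>L lborel (q n)) \<longlonglongrightarrow> integral\<^sup>L lborel D"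
  proof (rule integral_dominated_convergence[where w = "\<lambda>x. indicator K' x *\<^sub>R C"])
    show "D \<in> borel_measurable lborel" using cD by (simp add: borel_measurable_continuous_onI)
    show "q n \<in> borel_measurable lborel" for n using iq(1) borel_measurable_integrable by blast
    show "integrable lborel (\<lambda>x. indicator K' x *\<^sub>R C)"
      by (rule borel_integrable_compact[OF K']) auto
    show "AE x in lborel. (\<lambda>n. q n x) \<longlonglongrightarrow> D x"
    proof (rule AE_I2)
      fix x
      obtain r where r: "\<And>n. 0 < r n \<and> r n < s n \<and> q n x = D (x + r n *\<^sub>R e)"
        using qD[of _ x] by metis
      have "s \<longlonglongrightarrow> 0" unfolding s_def by (rule LIMSEQ_inverse_real_of_nat)
      then have "r \<longlonglongrightarrow> 0"
        by (rule tendsto_sandwich[OF _ _ tendsto_const, rotated 2]) (auto intro!: always_eventually less_imp_le simp: r)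
      then have "(\<lambda>n. x + r n *\<^sub>R e) \<longlonglongrightarrow> x + 0 *\<^sub>R e" by (intro tendsto_intros)
      then have "(\<lambda>n. D (x + r n *\<^sub>R e)) \<longlonglongrightarrow> D x"
        using cD by (intro isCont_tendsto_compose[of x D]) (auto simp: continuous_on_eq_continuous_at)
      then show "(\<lambda>n. q n x) \<longlonglongrightarrow> D x" using r by simp
    qed
    show "AE x in lborel. norm (q n x) \<le> indicator K' x *\<^sub>R C" for n
    proof (rule AE_I2)
      fix x
      obtain r where r: "0 < r" "r < s n" "q n x = D (x + r *\<^sub>R e)" using qD by blast
      show "norm (q n x) \<le> indicator K' x *\<^sub>R C"
      proof (cases "x + r *\<^sub>R e \<in> K")
        case True
        then have "x \<in> K'"
          unfolding K'_def using r s(2)[of n] by (intro image_eqI[of _ _ "(x + r *\<^sub>R e, r)"]) auto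
        then show ?thesis using C r by simp
      next
        case False
        then show ?thesis using r zD by (simp add: C_def)
      qed
    qed
  qed
  then show "(LINT x|lborel. frechet_derivative X (at x) e) = 0"
    unfolding iq(2) D_def by (simp add: LIMSEQ_const_iff)
qed

text \<open>The open sets \<open>S\<close> and \<open>- K\<close> cover the space; the extension
  agrees with \<open>F\<close> on the first and with zero on the second.\<close>

lemma zero_extension:
  fixes F :: "'a::real_normed_vector \<Rightarrow> 'b::real_normed_vector"
  assumes S: "open S" and K: "closed K" "K \<subseteq> S" and z: "\<And>x. x \<in> S - K \<Longrightarrow> F x = 0"
  defines "E \<equiv> \<lambda>x. if x \<in> S then F x else 0"
  shows "continuous_on S F \<Longrightarrow> continuous_on UNIV E"
    and "C1_on S F \<Longrightarrow> C1_on UNIV E"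
    and "x \<in> S \<Longrightarrow> frechet_derivative E (at x) = frechet_derivative F (at x)"
    and "x \<notin> K \<Longrightarrow> frechet_derivative E (at x) v = 0"
proof -
  have op: "open (- K)" by (rule open_Compl[OF K(1)])
  have U: "UNIV = S \<union> - K" using K by auto
  have E0: "E x = 0" if "x \<in> - K" for x using z that by (auto simp: E_def)
  have EF: "E x = F x" if "x \<in> S" for x using that by (simp add: E_def)
  show "continuous_on UNIV E" if c: "continuous_on S F"
  proof -
    have "continuous_on S E" using c EF by (simp cong: continuous_on_cong)
    moreover have "continuous_on (- K) E" by (rule continuous_on_eq[OF continuous_on_const[of _ 0]]) (simp add: E0)
    ultimately show ?thesis unfolding U by (intro continuous_on_open_Un S op)
  qed
  show "C1_on UNIV E" if c: "C1_on S F"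
  proof -
    have "C1_on S E" by (rule C1_on_cong[OF S _ c]) (simp add: EF)
    moreover have "C1_on (- K) E" by (rule C1_on_cong[OF op _ C1_on_const[of _ 0]]) (simp add: E0)
    ultimately show ?thesis unfolding U C1_on_def by (blast intro: continuous_on_open_Un S op)
  qed
  show "x \<in> S \<Longrightarrow> frechet_derivative E (at x) = frechet_derivative F (at x)"
    by (rule frechet_derivative_cong_open[OF S _ EF])
  show "frechet_derivative E (at x) v = 0" if "x \<notin> K"
  proof -
    have "frechet_derivative E (at x) = frechet_derivative (\<lambda>_. 0) (at x)"
      by (rule frechet_derivative_cong_open[OF op]) (use that E0 in auto)
    then show ?thesis by simp
  qed
qed

text \<open>Since the flux field is divergence free, the flux tested with \<open>w\<close> is the
  divergence of the products \<open>flux_field \<bullet> w\<close>. Extended by zero these have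
  compact support, so the divergence integrates to zero.\<close>

lemma flux_weak:
  fixes g :: "real^'m \<Rightarrow> real^'m \<Rightarrow> real^'m \<Rightarrow> real" and f w :: "real^'m \<Rightarrow> 'n::euclidean_space"
  assumes g: "riemannian_metric_on S g" and S: "open S" and f: "smooth_on S f"
    and m: "\<And>z. z \<in> S \<Longrightarrow> minimal_graph_eq g f z"
    and w: "C1_on S w" and K: "compact K" "K \<subseteq> S" "\<And>z. z \<in> S - K \<Longrightarrow> w z = 0"
  defines "\<theta> \<equiv> \<lambda>z. if z \<in> S then flux (g z) (frechet_derivative f (at z)) (frechet_derivative w (at z)) else 0"
  shows "integrable lborel \<theta>" and "integral\<^sup>L lborel \<theta> = 0"
proof -
  have cl: "closed K" using K by (simp add: compact_imp_closed)
  define Y where "Y i z = flux_field g f i z \<bullet> w z" for i z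
  define X where "X i z = (if z \<in> S then Y i z else 0)" for i z
  have Y: "C1_on S (Y i)" for i
    unfolding Y_def by (intro C1_on_inner flux_field_C1[OF g S f] w)
  have Yz: "Y i z = 0" if "z \<in> S - K" for i z using K(3)[OF that] by (simp add: Y_def)
  have X: "C1_on UNIV (X i)" for i
    unfolding X_def by (rule zero_extension(2)[OF S cl K(2) Yz Y])
  have XY: "frechet_derivative (X i) (at z) = frechet_derivative (Y i) (at z)" if "z \<in> S" for i z
    unfolding X_def by (rule zero_extension(3)[OF S cl K(2) Yz that])
  have X0: "frechet_derivative (X i) (at z) v = 0" if "z \<notin> K" for i z v
    unfolding X_def by (rule zero_extension(4)[OF S cl K(2) Yz that])
  have Xz: "X i z = 0" if "z \<notin> K" for i z using that Yz by (auto simp: X_def)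
  have dY: "frechet_derivative (Y i) (at z) v =
      flux_field g f i z \<bullet> frechet_derivative w (at z) v + frechet_derivative (flux_field g f i) (at z) v \<bullet> w z"
    if "z \<in> S" for i z v
  proof -
    have "(Y i has_derivative (\<lambda>v. flux_field g f i z \<bullet> frechet_derivative w (at z) v
        + frechet_derivative (flux_field g f i) (at z) v \<bullet> w z)) (at z)"
      unfolding Y_def
      by (rule has_derivative_inner[OF C1_onD(1)[OF flux_field_C1[OF g S f] that] C1_onD(1)[OF w that]])
    from frechet_derivative_at[OF this, symmetric] show ?thesis by simp
  qed
  have eq: "\<theta> z = (\<Sum>i\<in>UNIV. frechet_derivative (X i) (at z) (axis i 1))" for z
  proof (cases "z \<in> S")
    case True
    have "(\<Sum>i\<in>UNIV. frechet_derivative (X i) (at z) (axis i 1))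
      = (\<Sum>i\<in>UNIV. flux_field g f i z \<bullet> frechet_derivative w (at z) (axis i 1))
        + (\<Sum>i\<in>UNIV. frechet_derivative (flux_field g f i) (at z) (axis i 1)) \<bullet> w z"
      by (simp add: XY[OF True] dY[OF True] sum.distrib inner_sum_left)
    then show ?thesis
      using True by (simp add: \<theta>_def flux_eq_flux_field flux_field_divergence[OF g S f True m[OF True]])
  next
    case False
    then have "z \<notin> K" using K by auto
    then show ?thesis using False X0 by (simp add: \<theta>_def)
  qed
  note I = integral_directional_derivative[OF X K(1) Xz]
  show "integrable lborel \<theta>"
    unfolding eq[abs_def] by (intro Bochner_Integration.integrable_sum I(1))
  show "integral\<^sup>L lborel \<theta> = 0"
    unfolding eq[abs_def] by (subst Bochner_Integration.integral_sum) (simp_all add: I)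
qed


section \<open>Charts\<close>

definition chart_region :: "('a, 'e) riem_chart \<Rightarrow> 'a set \<Rightarrow> 'e set" where
  "chart_region c W = chart_map c ` (chart_dom c \<inter> W)"

definition transition :: "('a, 'e) riem_chart \<Rightarrow> ('a, 'e) riem_chart \<Rightarrow> 'e \<Rightarrow> 'e" where
  "transition c d = chart_map d \<circ> chart_inv c"

section \<open>Linear algebra of the flux\<close>

lemma flux_zero: "flux g L (\<lambda>_. 0) = 0"
  by (simp add: flux_def form_matrix_def trace_def matrix_matrix_mult_def)

lemma trace_mult_sum:
  fixes H :: "real^'k^'k" and X :: "'i \<Rightarrow> real^'k^'k"
  shows "trace (H ** (\<Sum>i\<in>I. X i)) = (\<Sum>i\<in>I. trace (H ** X i))"
proof -
  have "bounded_linear (\<lambda>X. trace (H ** X))"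
    by (rule bounded_linear_compose[OF bounded_linear_trace bounded_bilinear.bounded_linear_right[OF bounded_bilinear_matrix_mult]])
  then show ?thesis by (rule linear_sum[OF bounded_linear.linear])
qed

lemma flux_sum_right:
  "flux g L (\<lambda>v. \<Sum>i\<in>I. N i v) = (\<Sum>i\<in>I. flux g L (N i))"
proof -
  have "form_matrix (\<lambda>u v. L u \<bullet> (\<Sum>i\<in>I. N i v)) = (\<Sum>i\<in>I. form_matrix (\<lambda>u v. L u \<bullet> N i v))"
    by (simp add: form_matrix_def vec_eq_iff inner_sum_right sum_component)
  then show ?thesis by (simp add: flux_def sum_distrib_left trace_mult_sum)
qed

text \<open>Under a congruence the trace is invariant, while the square root of the determinant
  gains the absolute determinant of \<open>T\<close>. This is the transformation law of a
  density.\<close>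

lemma flux_pullback:
  fixes g :: "real^'m \<Rightarrow> real^'m \<Rightarrow> real" and L N :: "real^'m \<Rightarrow> 'b::real_inner" and T :: "real^'m \<Rightarrow> real^'m"
  assumes g: "pos_def_form g" and L: "linear L" and N: "linear N" and T: "linear T" and d: "det (matrix T) \<noteq> 0"
  shows "flux (\<lambda>u v. g (T u) (T v)) (\<lambda>v. L (T v)) (\<lambda>v. N (T v)) = \<bar>det (matrix T)\<bar> * flux g L N"
proof -
  define B where "B = matrix T"
  have B: "B = frame_matrix (\<lambda>i. T (axis i 1))" by (simp add: B_def matrix_def frame_matrix_def)
  have fm: "form_matrix (\<lambda>u v. q (T u) (T v)) = transpose B ** form_matrix q ** B" if "bilinear q" for q
    unfolding B form_matrix_frame[OF that] by (simp add: form_matrix_def)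
  have G: "gram (\<lambda>u v. g (T u) (T v)) (\<lambda>v. L (T v)) = transpose B ** gram g L ** B"
    unfolding gram_def
    by (rule fm) (intro bilinear_add pos_def_formD(1)[OF g] bilinear_pullback[OF bilinear_inner] L)
  have M: "form_matrix (\<lambda>u v. L (T u) \<bullet> N (T v)) = transpose B ** form_matrix (\<lambda>u v. L u \<bullet> N v) ** B"
    by (rule fm) (intro bilinear_pullback[OF bilinear_inner] L N)
  let ?G = "gram g L" and ?M = "form_matrix (\<lambda>u v. L u \<bullet> N v)"
  have dG: "det ?G > 0" by (rule det_gram_pos[OF g L])
  then have dG': "det ?G \<noteq> 0" by simp
  have dB: "det B \<noteq> 0" "det (transpose B) \<noteq> 0" using d by (simp_all add: B_def det_transpose)
  have inv: "matrix_inv (transpose B ** ?G ** B) = matrix_inv B ** matrix_inv ?G ** matrix_inv (transpose B)"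
  proof (rule matrix_inv_eqI)
    have "transpose B ** ?G ** B ** (matrix_inv B ** matrix_inv ?G ** matrix_inv (transpose B))
       = transpose B ** (?G ** (B ** matrix_inv B) ** matrix_inv ?G) ** matrix_inv (transpose B)"
      by (simp add: matrix_mul_assoc)
    then show "transpose B ** ?G ** B ** (matrix_inv B ** matrix_inv ?G ** matrix_inv (transpose B)) = mat 1"
      by (simp add: matrix_inv_mult[OF dB(1)] matrix_inv_mult[OF dB(2)] matrix_inv_mult[OF dG'])
  qed
  have "trace (matrix_inv (transpose B ** ?G ** B) ** (transpose B ** ?M ** B))
     = trace (matrix_inv B ** (matrix_inv ?G ** (matrix_inv (transpose B) ** transpose B) ** ?M ** B))"
    unfolding inv by (simp add: matrix_mul_assoc)
  also have "\<dots> = trace (matrix_inv ?G ** ?M ** (B ** matrix_inv B))"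
    by (subst trace_mul_commute) (simp add: matrix_inv_mult[OF dB(2)] matrix_mul_assoc)
  finally have tr: "trace (matrix_inv (transpose B ** ?G ** B) ** (transpose B ** ?M ** B)) = trace (matrix_inv ?G ** ?M)"
    by (simp add: matrix_inv_mult[OF dB(1)])
  have "sqrt (det (transpose B ** ?G ** B)) = \<bar>det B\<bar> * sqrt (det ?G)"
    by (simp add: det_mul det_transpose real_sqrt_mult mult_ac)
  then show ?thesis unfolding flux_def G M tr B_def[symmetric] by simp
qed

locale riem_mfd =
  fixes A :: "('a::{t2_space, second_countable_topology}, real^'m) riem_chart set"
  assumes mfd: "riemannian_manifold A"
begin

lemma chart_cover: "\<exists>c\<in>A. x \<in> chart_dom c"
  using mfd unfolding riemannian_manifold_def by blast

context
  fixes c assumes c: "c \<in> A"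
begin

lemma chart: "riem_chart c"
  using mfd c unfolding riemannian_manifold_def by blast

lemma open_dom: "open (chart_dom c)" and open_image: "open (chart_image c)"
  and chart_homeo: "homeomorphism (chart_dom c) (chart_image c) (chart_map c) (chart_inv c)"
  and chart_metric: "riemannian_metric_on (chart_image c) (chart_metric c)"
  using chart unfolding riem_chart_def by blast+

lemma chart_inv_map: "x \<in> chart_dom c \<Longrightarrow> chart_inv c (chart_map c x) = x"
  by (rule homeomorphism_apply1[OF chart_homeo])

lemma chart_map_inv: "z \<in> chart_image c \<Longrightarrow> chart_map c (chart_inv c z) = z"
  by (rule homeomorphism_apply2[OF chart_homeo])

lemma chart_inv_dom: "z \<in> chart_image c \<Longrightarrow> chart_inv c z \<in> chart_dom c"
  using homeomorphism_image2[OF chart_homeo] by blast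

lemma chart_map_image: "x \<in> chart_dom c \<Longrightarrow> chart_map c x \<in> chart_image c"
  by (simp add: chart_image_def)

lemma continuous_chart_map: "continuous_on (chart_dom c) (chart_map c)"
  by (rule homeomorphism_cont1[OF chart_homeo])

lemma continuous_chart_inv: "continuous_on (chart_image c) (chart_inv c)"
  by (rule homeomorphism_cont2[OF chart_homeo])

lemma chart_region_iff: "z \<in> chart_region c W \<longleftrightarrow> z \<in> chart_image c \<and> chart_inv c z \<in> W"
proof
  assume "z \<in> chart_region c W"
  then obtain x where "x \<in> chart_dom c" "x \<in> W" "z = chart_map c x" unfolding chart_region_def by auto
  then show "z \<in> chart_image c \<and> chart_inv c z \<in> W" using chart_inv_map chart_map_image by simp
next
  assume "z \<in> chart_image c \<and> chart_inv c z \<in> W"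
  then show "z \<in> chart_region c W"
    unfolding chart_region_def using chart_map_inv[of z] chart_inv_dom[of z] by (metis IntI imageI)
qed

lemma chart_region_subset: "chart_region c W \<subseteq> chart_image c"
  using chart_region_iff by blast

lemma chart_region_mono: "W \<subseteq> W' \<Longrightarrow> chart_region c W \<subseteq> chart_region c W'"
  unfolding chart_region_def by blast

lemma map_in_region: "x \<in> chart_dom c \<Longrightarrow> x \<in> W \<Longrightarrow> chart_map c x \<in> chart_region c W"
  unfolding chart_region_def by blast

lemma open_chart_region: "open W \<Longrightarrow> open (chart_region c W)"
proof -
  assume W: "open W"
  have "chart_region c W = chart_image c \<inter> chart_inv c -` W" using chart_region_iff by auto
  then show ?thesis
    using continuous_open_preimage[OF continuous_chart_inv open_image W] by simp
qed

lemma metric_pos_def: "x \<in> chart_dom c \<Longrightarrow> pos_def_form (chart_metric c (chart_map c x))"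
  using riemannian_metric_onD(1)[OF chart_metric chart_map_image] .

lemma metric_region: "riemannian_metric_on (chart_region c W) (chart_metric c)"
  unfolding riemannian_metric_on_def
proof (intro conjI ballI allI)
  fix u v
  show "smooth_on (chart_region c W) (\<lambda>z. chart_metric c z u v)"
    using riemannian_metric_onD(2)[OF chart_metric] chart_region_subset by (rule smooth_on_subset)
qed (use chart_metric chart_region_subset[of W] in \<open>auto simp: riemannian_metric_on_def subset_iff\<close>)

lemma compact_chart_image: "compact K \<Longrightarrow> K \<subseteq> chart_dom c \<Longrightarrow> compact (chart_map c ` K)"
  using compact_continuous_image continuous_on_subset[OF continuous_chart_map] by blast

end

context
  fixes c d assumes c: "c \<in> A" and d: "d \<in> A"
begin

lemma transition_compat: "riem_compatible c d"
  using mfd c d unfolding riemannian_manifold_def by blast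

lemma region_dom: "chart_map c ` (chart_dom c \<inter> chart_dom d) = chart_region c (chart_dom d)"
  by (simp add: chart_region_def)

lemma transition_smooth: "smooth_on (chart_region c (chart_dom d)) (transition c d)"
  using transition_compat unfolding riem_compatible_def Let_def region_dom transition_def by blast

lemma transition_metric:
  assumes "z \<in> chart_region c (chart_dom d)"
  shows "chart_metric c z u v = chart_metric d (transition c d z)
    (frechet_derivative (transition c d) (at z) u) (frechet_derivative (transition c d) (at z) v)"
  using transition_compat assms unfolding riem_compatible_def Let_def region_dom transition_def by blast

lemma transition_apply: "x \<in> chart_dom c \<Longrightarrow> transition c d (chart_map c x) = chart_map d x"
  using chart_inv_map[OF c] by (simp add: transition_def)

lemma transition_has_derivative:
  assumes "x \<in> chart_dom c" "x \<in> chart_dom d"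
  shows "(transition c d has_derivative frechet_derivative (transition c d) (at (chart_map c x))) (at (chart_map c x))"
  using smooth_on_differentiable[OF transition_smooth map_in_region[OF c assms]] frechet_derivative_works by blast

end

lemma transition_derivative_inverse:
  assumes c: "c \<in> A" and d: "d \<in> A" and x: "x \<in> chart_dom c" "x \<in> chart_dom d"
  shows "frechet_derivative (transition d c) (at (chart_map d x)) (frechet_derivative (transition c d) (at (chart_map c x)) v) = v"
proof -
  note t1 = transition_has_derivative[OF c d x] and t2 = transition_has_derivative[OF d c x(2,1)]
  have "((\<lambda>z. transition d c (transition c d z)) has_derivative
      (\<lambda>v. frechet_derivative (transition d c) (at (chart_map d x)) (frechet_derivative (transition c d) (at (chart_map c x)) v)))
      (at (chart_map c x))"
    using has_derivative_compose[OF t1, of "transition d c"] t2 by (simp add: transition_apply[OF c d x(1)])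
  moreover have "((\<lambda>z. z) has_derivative (\<lambda>v. v)) (at (chart_map c x))" by simp
  moreover have "transition d c (transition c d z) = z" if "z \<in> chart_region c (chart_dom d)" for z
    using that chart_region_iff[OF c, of z "chart_dom d"] chart_inv_map[OF d] chart_map_inv[OF c]
    by (simp add: transition_def)
  ultimately have "((\<lambda>z. z) has_derivative
      (\<lambda>v. frechet_derivative (transition d c) (at (chart_map d x)) (frechet_derivative (transition c d) (at (chart_map c x)) v)))
      (at (chart_map c x))"
    using has_derivative_cong_open[OF open_chart_region[OF c open_dom[OF d]] map_in_region[OF c x], of "\<lambda>z. transition d c (transition c d z)" "\<lambda>z. z"]
    by blast
  from has_derivative_unique[OF this has_derivative_ident] show ?thesis by (rule fun_cong)
qed

lemma transition_det:
  assumes c: "c \<in> A" and d: "d \<in> A" and x: "x \<in> chart_dom c" "x \<in> chart_dom d"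
  shows "det (matrix (frechet_derivative (transition c d) (at (chart_map c x)))) \<noteq> 0"
proof -
  let ?T = "frechet_derivative (transition c d) (at (chart_map c x))"
  have l: "linear ?T" using transition_has_derivative[OF c d x] has_derivative_linear by blast
  have "inj ?T" by (rule inj_on_inverseI) (rule transition_derivative_inverse[OF c d x])
  then show ?thesis using l det_nz_iff_inj by blast
qed

lemma differential_transition:
  assumes c: "c \<in> A" and d: "d \<in> A" and x: "x \<in> chart_dom c" "x \<in> chart_dom d"
    and f: "(f \<circ> chart_inv d) differentiable (at (chart_map d x))"
  shows "((f \<circ> chart_inv c) has_derivative
      (\<lambda>v. differential d f x (frechet_derivative (transition c d) (at (chart_map c x)) v))) (at (chart_map c x))"
    and "differential c f x = (\<lambda>v. differential d f x (frechet_derivative (transition c d) (at (chart_map c x)) v))"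
proof -
  have fd: "((f \<circ> chart_inv d) has_derivative differential d f x) (at (transition c d (chart_map c x)))"
    using frechet_derivative_works[THEN iffD1, OF f] by (simp add: differential_def transition_apply[OF c d x(1)])
  have comp: "((\<lambda>z. (f \<circ> chart_inv d) (transition c d z)) has_derivative
      (\<lambda>v. differential d f x (frechet_derivative (transition c d) (at (chart_map c x)) v))) (at (chart_map c x))"
    by (rule has_derivative_compose[OF transition_has_derivative[OF c d x] fd])
  have e: "(f \<circ> chart_inv d) (transition c d z) = (f \<circ> chart_inv c) z" if "z \<in> chart_region c (chart_dom d)" for z
    using that chart_region_iff[OF c] chart_inv_map[OF d] by (simp add: transition_def)
  show 1: "((f \<circ> chart_inv c) has_derivative
      (\<lambda>v. differential d f x (frechet_derivative (transition c d) (at (chart_map c x)) v))) (at (chart_map c x))"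
    by (rule has_derivative_cong_open[THEN iffD1, OF open_chart_region[OF c open_dom[OF d]] map_in_region[OF c x] e comp])
  show "differential c f x = (\<lambda>v. differential d f x (frechet_derivative (transition c d) (at (chart_map c x)) v))"
    unfolding differential_def[of c] using frechet_derivative_at[OF 1] by simp
qed

section \<open>Continuously differentiable maps on the manifold\<close>

definition C1_map :: "'a set \<Rightarrow> ('a \<Rightarrow> 'b::real_normed_vector) \<Rightarrow> bool" where
  "C1_map W w \<longleftrightarrow> (\<forall>c\<in>A. C1_on (chart_region c W) (w \<circ> chart_inv c))"

lemma C1_mapD:
  assumes "C1_map W w" "c \<in> A"
  shows "C1_on (chart_region c W) (w \<circ> chart_inv c)"
    and "x \<in> chart_dom c \<Longrightarrow> x \<in> W \<Longrightarrow> ((w \<circ> chart_inv c) has_derivative differential c w x) (at (chart_map c x))"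
    and "x \<in> chart_dom c \<Longrightarrow> x \<in> W \<Longrightarrow> (w \<circ> chart_inv c) differentiable (at (chart_map c x))"
    and "x \<in> chart_dom c \<Longrightarrow> x \<in> W \<Longrightarrow> linear (differential c w x)"
proof -
  show 1: "C1_on (chart_region c W) (w \<circ> chart_inv c)" using assms unfolding C1_map_def by blast
  show 2: "x \<in> chart_dom c \<Longrightarrow> x \<in> W \<Longrightarrow> ((w \<circ> chart_inv c) has_derivative differential c w x) (at (chart_map c x))"
    unfolding differential_def using C1_onD(1)[OF 1 map_in_region[OF assms(2)]] .
  show "x \<in> chart_dom c \<Longrightarrow> x \<in> W \<Longrightarrow> (w \<circ> chart_inv c) differentiable (at (chart_map c x))"
    using 2 differentiableI by blast
  show "x \<in> chart_dom c \<Longrightarrow> x \<in> W \<Longrightarrow> linear (differential c w x)"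
    using 2 has_derivative_linear by blast
qed

lemma smooth_map_imp_C1_map: "smooth_map_on A W f \<Longrightarrow> C1_map W f"
  unfolding smooth_map_on_def C1_map_def chart_region_def using smooth_on_imp_C1_on by blast

lemma C1_map_subset: "C1_map W f \<Longrightarrow> V \<subseteq> W \<Longrightarrow> C1_map V f"
  unfolding C1_map_def using C1_on_subset chart_region_mono by blast

lemma differential_region:
  assumes "c \<in> A" "z \<in> chart_image c"
  shows "differential c w (chart_inv c z) = frechet_derivative (w \<circ> chart_inv c) (at z)"
  using chart_map_inv[OF assms] by (simp add: differential_def)

lemma flux_transition:
  fixes f w :: "'a \<Rightarrow> 'b::real_inner"
  assumes c: "c \<in> A" and d: "d \<in> A" and x: "x \<in> chart_dom c" "x \<in> chart_dom d" "x \<in> W"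
    and f: "C1_map W f" and w: "C1_map W w"
  shows "flux (chart_metric c (chart_map c x)) (differential c f x) (differential c w x)
     = \<bar>det (matrix (frechet_derivative (transition c d) (at (chart_map c x))))\<bar>
        * flux (chart_metric d (chart_map d x)) (differential d f x) (differential d w x)"
proof -
  let ?T = "frechet_derivative (transition c d) (at (chart_map c x))"
  have T: "linear ?T" using transition_has_derivative[OF c d x(1,2)] has_derivative_linear by blast
  have g: "chart_metric c (chart_map c x) = (\<lambda>u v. chart_metric d (chart_map d x) (?T u) (?T v))"
    using transition_metric[OF c d map_in_region[OF c x(1,2)]] transition_apply[OF c d x(1)] by (simp add: fun_eq_iff)
  show ?thesis
    unfolding g differential_transition(2)[OF c d x(1,2) C1_mapD(3)[OF f d x(2,3)]]
      differential_transition(2)[OF c d x(1,2) C1_mapD(3)[OF w d x(2,3)]]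
    by (rule flux_pullback[OF metric_pos_def[OF d x(2)] C1_mapD(4)[OF f d x(2,3)] C1_mapD(4)[OF w d x(2,3)] T
          transition_det[OF c d x(1,2)]])
qed

end


section \<open>Singular values and minimal maps in charts\<close>

context riem_mfd
begin

text \<open>Coordinate changes are isometries that intertwine the differentials, so they carry
  singular frames to singular frames with the same values.\<close>

lemma svd_transition:
  fixes f :: "'a \<Rightarrow> 'b::real_inner"
  assumes c: "c \<in> A" and d: "d \<in> A" and x: "x \<in> chart_dom c" "x \<in> chart_dom d" "x \<in> W"
    and f: "C1_map W f" and s: "svd (chart_metric c (chart_map c x)) (differential c f x) b l"
  shows "svd (chart_metric d (chart_map d x)) (differential d f x)
    (\<lambda>i. frechet_derivative (transition c d) (at (chart_map c x)) (b i)) l"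
proof -
  let ?T = "frechet_derivative (transition c d) (at (chart_map c x))"
  have g: "chart_metric d (chart_map d x) (?T u) (?T v) = chart_metric c (chart_map c x) u v" for u v
    using transition_metric[OF c d map_in_region[OF c x(1,2)]] transition_apply[OF c d x(1)] by simp
  have D: "differential d f x (?T v) = differential c f x v" for v
    unfolding differential_transition(2)[OF c d x(1,2) C1_mapD(3)[OF f d x(2,3)]] ..
  show ?thesis using s unfolding svd_def g D .
qed

text \<open>Resolves the \<open>THE\<close>: the values \<open>l i\<close> in decreasing order have
  the required multiplicities in every chart around \<open>x\<close>, and
  \<open>sorted_list_squares_unique\<close> gives uniqueness.\<close>

lemma singular_values_mset:
  fixes f :: "'a \<Rightarrow> 'b::real_inner" and b :: "'m \<Rightarrow> real^'m"
  assumes c: "c \<in> A" and x: "x \<in> chart_dom c" "x \<in> W"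
    and f: "C1_map W f" and s: "svd (chart_metric c (chart_map c x)) (differential c f x) b l"
  shows "mset (singular_values A f x) = image_mset l (mset_set UNIV)"
proof -
  define ls where "ls = rev (sorted_list_of_multiset (image_mset l (mset_set (UNIV :: 'm set))))"
  have ms: "mset ls = image_mset l (mset_set UNIV)" by (simp add: ls_def)
  have cnt: "count_list (map (\<lambda>r. r\<^sup>2) ls) \<mu> = card {i. (l i)\<^sup>2 = \<mu>}" for \<mu>
  proof -
    have "count_list (map (\<lambda>r. r\<^sup>2) ls) \<mu> = count (image_mset (\<lambda>r. r\<^sup>2) (mset ls)) \<mu>"
      by (metis count_mset mset_map)
    also have "\<dots> = count (image_mset (\<lambda>i. (l i)\<^sup>2) (mset_set UNIV)) \<mu>"
      unfolding ms by (simp add: multiset.map_comp o_def)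
    also have "\<dots> = card {i. (l i)\<^sup>2 = \<mu>}"
      by (simp add: count_image_mset vimage_def Int_def)
    finally show ?thesis .
  qed
  have em: "eigen_multiplicity d f x \<mu> = card {i. (l i)\<^sup>2 = \<mu>}" if d: "d \<in> A" "x \<in> chart_dom d" for d \<mu>
    unfolding eigen_multiplicity_def
    by (rule dim_eigenspace_svd[OF metric_pos_def[OF d] C1_mapD(4)[OF f d x(2)] svd_transition[OF c d(1) x(1) d(2) x(2) f s]])
  have "singular_values A f x = ls"
    unfolding singular_values_def
  proof (rule the_equality)
    have "sorted_wrt (\<ge>) ls" unfolding ls_def by (simp add: sorted_wrt_rev)
    moreover have "length ls = DIM(real^'m)"
      using arg_cong[OF ms, of size] by simp
    moreover have "\<forall>r\<in>set ls. 0 \<le> r"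
      using arg_cong[OF ms, of set_mset] svdD(1)[OF s] by auto
    ultimately show "length ls = DIM(real^'m) \<and> sorted_wrt (\<ge>) ls \<and> (\<forall>l\<in>set ls. 0 \<le> l) \<and>
     (\<forall>c\<in>A. x \<in> chart_dom c \<longrightarrow> (\<forall>\<mu>. count_list (map (\<lambda>l. l\<^sup>2) ls) \<mu> = eigen_multiplicity c f x \<mu>))"
      using cnt em by simp
    then have 1: "sorted_wrt (\<ge>) ls" "\<forall>l\<in>set ls. 0 \<le> l" by auto
    fix ls'
    assume 2: "length ls' = DIM(real^'m) \<and> sorted_wrt (\<ge>) ls' \<and> (\<forall>l\<in>set ls'. 0 \<le> l) \<and>
     (\<forall>c\<in>A. x \<in> chart_dom c \<longrightarrow> (\<forall>\<mu>. count_list (map (\<lambda>l. l\<^sup>2) ls') \<mu> = eigen_multiplicity c f x \<mu>))"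
    then have "count_list (map (\<lambda>l. l\<^sup>2) ls') \<mu> = eigen_multiplicity c f x \<mu>" for \<mu>
      using c x(1) by blast
    then have "count_list (map (\<lambda>l. l\<^sup>2) ls') \<mu> = count_list (map (\<lambda>l. l\<^sup>2) ls) \<mu>" for \<mu>
      using cnt em[OF c x(1)] by simp
    with 1 2 show "ls' = ls" by (intro sorted_list_squares_unique) auto
  qed
  then show ?thesis using ms by simp
qed

lemma singular_values_sum:
  fixes f :: "'a \<Rightarrow> 'b::real_inner" and b :: "'m \<Rightarrow> real^'m"
  assumes "c \<in> A" "x \<in> chart_dom c" "x \<in> W" "C1_map W f"
    "svd (chart_metric c (chart_map c x)) (differential c f x) b l"
  shows "(\<Sum>r\<leftarrow>singular_values A f x. h r) = (\<Sum>i\<in>UNIV. h (l i))"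
    and "set (singular_values A f x) = range l"
proof -
  note m = singular_values_mset[OF assms]
  have "(\<Sum>r\<leftarrow>singular_values A f x. h r) = sum_mset (image_mset h (mset (singular_values A f x)))"
    by (metis mset_map sum_mset_sum_list)
  also have "\<dots> = (\<Sum>i\<in>UNIV. h (l i))"
    unfolding m by (simp add: multiset.map_comp o_def sum_unfold_sum_mset)
  finally show "(\<Sum>r\<leftarrow>singular_values A f x. h r) = (\<Sum>i\<in>UNIV. h (l i))" .
  show "set (singular_values A f x) = range l"
    using arg_cong[OF m, of set_mset] by simp
qed

text \<open>Minimality is a statement about all local parametrisations of the graph; this supplies
  the one by the coordinates of \<open>c\<close>. In a product chart over \<open>d\<close> its first
  component is the transition map, whose derivative is already injective.\<close>

lemma graph_local_parametrisation:
  fixes f :: "'a \<Rightarrow> 'n::euclidean_space"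
  assumes c: "c \<in> A" and D: "open D" and f: "smooth_map_on A D f"
  shows "local_parametrisation (product_with_euclidean (restrict_manifold D A)) {(x, f x) | x. x \<in> D}
     (chart_region c D) (\<lambda>z. (chart_inv c z, f (chart_inv c z)))"
  unfolding local_parametrisation_def
proof (intro conjI ballI impI)
  let ?F = "\<lambda>z. (chart_inv c z, f (chart_inv c z))" and ?S = "{(x, f x) | x. x \<in> D}" and ?\<Omega> = "chart_region c D"
  note reg = chart_region_iff[OF c]
  have sf: "smooth_on ?\<Omega> (f \<circ> chart_inv c)"
    using f c unfolding smooth_map_on_def chart_region_def by blast
  show "open ?\<Omega>" by (rule open_chart_region[OF c D])
  have "?F ` ?\<Omega> = ?S \<inter> ((chart_dom c \<inter> D) \<times> UNIV)"
  proof (intro equalityI subsetI)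
    fix p assume "p \<in> ?S \<inter> ((chart_dom c \<inter> D) \<times> UNIV)"
    then obtain x where x: "x \<in> D" "x \<in> chart_dom c" "p = (x, f x)" by auto
    then show "p \<in> ?F ` ?\<Omega>"
      using map_in_region[OF c] chart_inv_map[OF c] by (intro image_eqI[of _ _ "chart_map c x"]) auto
  qed (use reg chart_inv_dom[OF c] in auto)
  moreover have "open ((chart_dom c \<inter> D) \<times> (UNIV :: 'n set))"
    by (intro open_Times open_Int open_dom[OF c] D open_UNIV)
  ultimately show "openin (top_of_set ?S) (?F ` ?\<Omega>)" by (auto simp: openin_open)
  show "\<exists>G. homeomorphism ?\<Omega> (?F ` ?\<Omega>) ?F G"
  proof (rule exI[of _ "\<lambda>p. chart_map c (fst p)"], rule homeomorphismI)
    show "continuous_on ?\<Omega> ?F"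
      using continuous_on_subset[OF continuous_chart_inv[OF c] chart_region_subset[OF c]] smooth_on_imp_continuous_on[OF sf]
      by (intro continuous_on_Pair) (auto simp: o_def)
    have "continuous_on (fst ` (?F ` ?\<Omega>)) (chart_map c)"
      by (rule continuous_on_subset[OF continuous_chart_map[OF c]]) (use reg chart_inv_dom[OF c] in auto)
    then show "continuous_on (?F ` ?\<Omega>) (\<lambda>p. chart_map c (fst p))"
      by (rule continuous_on_compose2[OF _ continuous_on_fst[OF continuous_on_id]]) auto
  qed (use reg chart_map_inv[OF c] in auto)
  fix C :: "('a \<times> 'n, (real^'m) \<times> 'n) riem_chart"
  assume "C \<in> product_with_euclidean (restrict_manifold D A)"
  then obtain d where d: "d \<in> A" and Cd: "chart_dom C = (chart_dom d \<inter> D) \<times> UNIV" "chart_map C = (\<lambda>(x, y). (chart_map d x, y))"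
    unfolding product_with_euclidean_def restrict_manifold_def by auto
  let ?U = "chart_region c (D \<inter> chart_dom d)"
  have U: "{z \<in> ?\<Omega>. ?F z \<in> chart_dom C} = ?U" using reg by (auto simp: Cd)
  have oU: "open ?U" by (intro open_chart_region[OF c] open_Int D open_dom[OF d])
  have CF: "chart_map C \<circ> ?F = (\<lambda>z. (transition c d z, (f \<circ> chart_inv c) z))"
    by (auto simp: Cd transition_def)
  have st: "smooth_on ?U (transition c d)"
    by (rule smooth_on_subset[OF transition_smooth[OF c d] chart_region_mono[OF c]]) auto
  have sf': "smooth_on ?U (f \<circ> chart_inv c)"
    by (rule smooth_on_subset[OF sf chart_region_mono[OF c]]) auto
  show "smooth_on {z \<in> ?\<Omega>. ?F z \<in> chart_dom C} (chart_map C \<circ> ?F)"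
    unfolding U CF by (rule smooth_on_Pair[OF oU st sf'])
  fix z assume z: "z \<in> ?\<Omega>" "?F z \<in> chart_dom C"
  then have zU: "z \<in> ?U" using U by blast
  define x where "x = chart_inv c z"
  have x: "x \<in> chart_dom c" "x \<in> chart_dom d" "z = chart_map c x"
    using zU reg chart_inv_dom[OF c] chart_map_inv[OF c] by (auto simp: x_def)
  have "inj (frechet_derivative (transition c d) (at z))"
    unfolding x(3) by (rule inj_on_inverseI) (rule transition_derivative_inverse[OF c d x(1,2)])
  then show "inj (frechet_derivative (chart_map C \<circ> ?F) (at z))"
    unfolding CF frechet_derivative_Pair[OF smooth_on_differentiable[OF st zU] smooth_on_differentiable[OF sf' zU]]
    by (auto simp: inj_def)
qed

lemma minimal_map_graph_eq:
  fixes f :: "'a \<Rightarrow> real^'n"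
  assumes c: "c \<in> A" and D: "open D" and f: "smooth_map_on A D f" and m: "minimal_map A D f"
    and z: "z \<in> chart_region c D"
  shows "minimal_graph_eq (chart_metric c) (f \<circ> chart_inv c) z"
proof -
  let ?F = "\<lambda>z. (chart_inv c z, f (chart_inv c z))"
  let ?B = "product_with_euclidean (restrict_manifold D A) :: ('a \<times> (real^'n), (real^'m) \<times> (real^'n)) riem_chart set"
  \<comment> \<open>The product chart over \<open>c\<close> itself, in which the parametrisation
    becomes the graph of the coordinate expression of \<open>f\<close>.\<close>
  define C :: "('a \<times> (real^'n), (real^'m) \<times> (real^'n)) riem_chart" where
    "C = RChart ((chart_dom c \<inter> D) \<times> UNIV) (\<lambda>(x, y). (chart_map c x, y))
        (\<lambda>(z, y) (u, a) (v, b). chart_metric c z u v + a \<bullet> b)"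
  have C: "C \<in> ?B"
    unfolding product_with_euclidean_def restrict_manifold_def image_image C_def
    by (rule image_eqI[OF _ c]) simp
  have sf: "smooth_on (chart_region c D) (f \<circ> chart_inv c)"
    using f c unfolding smooth_map_on_def chart_region_def by blast
  note reg = chart_region_iff[OF c]
  have "?F z \<in> chart_dom C" using z reg chart_inv_dom[OF c] by (auto simp: C_def)
  then have "mean_curvature_vector (chart_metric C) (chart_map C \<circ> ?F) z = 0"
    using m graph_local_parametrisation[OF c D f] C z
    unfolding minimal_map_def minimal_submanifold_def by blast
  moreover have "chart_metric C = product_metric (chart_metric c)" by (simp add: C_def product_metric_def)
  moreover have "mean_curvature_vector h (chart_map C \<circ> ?F) z = mean_curvature_vector h (\<lambda>z. (z, (f \<circ> chart_inv c) z)) z" for h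
    by (rule mean_curvature_vector_cong[OF open_chart_region[OF c D] z])
      (use reg chart_map_inv[OF c] in \<open>auto simp: C_def\<close>)
  ultimately show ?thesis
    by (intro mean_curvature_zero_graph[OF metric_region[OF c] open_chart_region[OF c D] z sf]) simp
qed

end


section \<open>Integration over the manifold\<close>

lemma C1_on_open_Un:
  assumes "open S" "open T" "C1_on S f" "C1_on T f"
  shows "C1_on (S \<union> T) f"
  unfolding C1_on_def
proof (intro conjI allI ballI)
  show "f differentiable (at x)" if "x \<in> S \<union> T" for x using assms(3,4) that unfolding C1_on_def by blast
  show "continuous_on (S \<union> T) (\<lambda>x. frechet_derivative f (at x) v)" for v
    by (rule continuous_on_open_Un[OF assms(1,2) C1_onD(2)[OF assms(3)] C1_onD(2)[OF assms(4)]])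
qed

text \<open>Test functions need only be C1, so bumps and cutoffs are built from this square. At
  \<open>0\<close> the difference quotient is bounded by \<open>|h|\<close>.\<close>

lemma DERIV_pos_part_square: "((\<lambda>t. (max 0 t)\<^sup>2) has_real_derivative 2 * max 0 x) (at x)"
proof -
  consider "x < 0" | "x = 0" | "x > 0" by linarith
  then show ?thesis
  proof cases
    case 1
    have "((\<lambda>t. 0) has_real_derivative 2 * max 0 x) (at x)" using 1 by simp
    then show ?thesis
      by (rule has_field_derivative_transform_within_open[where S = "{..<0}"]) (use 1 in auto)
  next
    case 2
    have a: "\<bar>(max 0 h)\<^sup>2 / h\<bar> \<le> \<bar>h\<bar>" for h :: real
      by (cases "h > 0") (auto simp: power2_eq_square max_def)
    have b: "((\<lambda>h::real. \<bar>h\<bar>) \<longlongrightarrow> 0) (at 0)"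
      using tendsto_rabs[OF tendsto_ident_at, of 0 UNIV] by simp
    have "((\<lambda>h. (max 0 h)\<^sup>2 / h) \<longlongrightarrow> 0) (at (0::real))"
      by (rule Lim_null_comparison[OF always_eventually b]) (simp only: a real_norm_def simp_thms)
    then show ?thesis using 2 by (simp add: DERIV_def)
  next
    case 3
    have "((\<lambda>t. t\<^sup>2) has_real_derivative 2 * max 0 x) (at x)" using 3 by (auto intro!: derivative_eq_intros)
    then show ?thesis
      by (rule has_field_derivative_transform_within_open[where S = "{0<..}"]) (use 3 in auto)
  qed
qed

lemma C1_on_pos_part_square:
  fixes f :: "'a::real_normed_vector \<Rightarrow> real"
  assumes "C1_on S f"
  shows "C1_on S (\<lambda>x. (max 0 (f x))\<^sup>2)"
  by (rule C1_on_real_compose[OF assms DERIV_pos_part_square]) (intro continuous_intros)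

context riem_mfd
begin

definition chart_integral :: "'a set \<Rightarrow> ('a, real^'m) riem_chart \<Rightarrow> (('a, real^'m) riem_chart \<Rightarrow> 'a \<Rightarrow> real) \<Rightarrow> real" where
  "chart_integral D c \<theta> = (LINT z|lborel. (if z \<in> chart_region c D then \<theta> c (chart_inv c z) else 0))"

text \<open>A density has one value per chart at each point. With the absolute value of the Jacobian
  determinant its integral is the same in all charts that contain the support, whatever the
  orientation.\<close>

definition density_on :: "'a set \<Rightarrow> (('a, real^'m) riem_chart \<Rightarrow> 'a \<Rightarrow> real) \<Rightarrow> bool" where
  "density_on D \<theta> \<longleftrightarrow>
     (\<forall>c\<in>A. continuous_on (chart_region c D) (\<lambda>z. \<theta> c (chart_inv c z))) \<and>
     (\<forall>c\<in>A. \<forall>d\<in>A. \<forall>x\<in>chart_dom c \<inter> chart_dom d \<inter> D.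
        \<theta> c x = \<bar>det (matrix (frechet_derivative (transition c d) (at (chart_map c x))))\<bar> * \<theta> d x)"

lemma density_on_mult:
  assumes "density_on D \<theta>" "C1_map D \<rho>"
  shows "density_on D (\<lambda>c x. \<rho> x * \<theta> c x)"
  unfolding density_on_def
proof (intro conjI ballI)
  fix c assume c: "c \<in> A"
  show "continuous_on (chart_region c D) (\<lambda>z. \<rho> (chart_inv c z) * \<theta> c (chart_inv c z))"
    using assms(1) c C1_on_continuous[OF C1_mapD(1)[OF assms(2) c]]
    unfolding density_on_def comp_def by (intro continuous_on_mult) simp_all
  fix d x assume "d \<in> A" "x \<in> chart_dom c \<inter> chart_dom d \<inter> D"
  then have "\<theta> c x = \<bar>det (matrix (frechet_derivative (transition c d) (at (chart_map c x))))\<bar> * \<theta> d x"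
    using assms(1) c unfolding density_on_def by blast
  then show "\<rho> x * \<theta> c x = \<bar>det (matrix (frechet_derivative (transition c d) (at (chart_map c x))))\<bar> * (\<rho> x * \<theta> d x)"
    by simp
qed

lemma chart_integral_integrable:
  assumes c: "c \<in> A" and D: "open D" and \<theta>: "density_on D \<theta>"
    and K: "compact K" "K \<subseteq> chart_dom c \<inter> D" "\<And>x. x \<in> chart_dom c \<inter> D - K \<Longrightarrow> \<theta> c x = 0"
  shows "integrable lborel (\<lambda>z. if z \<in> chart_region c D then \<theta> c (chart_inv c z) else 0)"
proof (rule compact_support_integrable)
  have ck: "compact (chart_map c ` K)" by (rule compact_chart_image[OF c K(1)]) (use K in auto)
  have sub: "chart_map c ` K \<subseteq> chart_region c D" using K(2) by (auto simp: chart_region_def)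
  have z: "\<theta> c (chart_inv c z) = 0" if "z \<in> chart_region c D - chart_map c ` K" for z
  proof (rule K(3))
    show "chart_inv c z \<in> chart_dom c \<inter> D - K"
      using that chart_region_iff[OF c] chart_inv_dom[OF c] chart_map_inv[OF c] by (auto simp: image_iff)
  qed
  show "continuous_on UNIV (\<lambda>z. if z \<in> chart_region c D then \<theta> c (chart_inv c z) else 0)"
    by (rule zero_extension(1)[OF open_chart_region[OF c D] compact_imp_closed[OF ck] sub z])
      (use \<theta> c in \<open>auto simp: density_on_def\<close>)
  show "compact (chart_map c ` K)" by (rule ck)
  show "(if z \<in> chart_region c D then \<theta> c (chart_inv c z) else 0) = 0" if "z \<notin> chart_map c ` K" for z
    using that z by auto
qed

text \<open>Change of variables along the transition map on the overlap of the charts; outside the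
  overlap both integrands vanish because \<open>K\<close> lies inside it.\<close>

lemma chart_integral_transfer:
  assumes c: "c \<in> A" and d: "d \<in> A" and D: "open D" and \<theta>: "density_on D \<theta>"
    and K: "compact K" "K \<subseteq> chart_dom c \<inter> chart_dom d \<inter> D"
    and z: "\<And>x. x \<in> chart_dom c \<inter> D - K \<Longrightarrow> \<theta> c x = 0" "\<And>x. x \<in> chart_dom d \<inter> D - K \<Longrightarrow> \<theta> d x = 0"
  shows "chart_integral D c \<theta> = chart_integral D d \<theta>"
proof -
  let ?U = "chart_region c (chart_dom d \<inter> D)" and ?\<tau> = "transition c d"
  note rc = chart_region_iff[OF c] and rd = chart_region_iff[OF d]
  have im: "?\<tau> ` ?U = chart_region d (chart_dom c \<inter> D)"
  proof (intro equalityI subsetI)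
    fix y assume "y \<in> ?\<tau> ` ?U"
    then obtain x where "x \<in> chart_dom c" "x \<in> chart_dom d" "x \<in> D" "y = ?\<tau> (chart_map c x)"
      by (auto simp: chart_region_def)
    then show "y \<in> chart_region d (chart_dom c \<inter> D)"
      using transition_apply[OF c d] map_in_region[OF d] by simp
  next
    fix y assume "y \<in> chart_region d (chart_dom c \<inter> D)"
    then obtain x where x: "x \<in> chart_dom c" "x \<in> chart_dom d" "x \<in> D" "y = chart_map d x"
      by (auto simp: chart_region_def)
    then show "y \<in> ?\<tau> ` ?U"
      using transition_apply[OF c d x(1)] map_in_region[OF c x(1)] by (intro image_eqI[of _ _ "chart_map c x"]) auto
  qed
  define F where "F y = \<theta> d (chart_inv d y)" for y
  define T where "T z = frechet_derivative ?\<tau> (at z)" for z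
  have e1: "(if z \<in> ?U then \<bar>det (matrix (T z))\<bar> * F (?\<tau> z) else 0) = (if z \<in> chart_region c D then \<theta> c (chart_inv c z) else 0)" for z
  proof (cases "z \<in> ?U")
    case True
    then have x: "chart_inv c z \<in> chart_dom c \<inter> chart_dom d \<inter> D" "chart_map c (chart_inv c z) = z" "z \<in> chart_region c D"
      using rc chart_inv_dom[OF c] chart_map_inv[OF c] by auto
    have "chart_inv d (?\<tau> z) = chart_inv c z"
      using x chart_inv_map[OF d] by (simp add: transition_def)
    moreover have "\<theta> c (chart_inv c z) = \<bar>det (matrix (T z))\<bar> * \<theta> d (chart_inv c z)"
      using \<theta> c d x unfolding density_on_def T_def by metis
    ultimately show ?thesis using True x by (simp add: F_def)
  next
    case False
    have "\<theta> c (chart_inv c z) = 0" if "z \<in> chart_region c D"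
      using that False rc chart_inv_dom[OF c] K(2) by (intro z(1)) auto
    then show ?thesis using False by simp
  qed
  have e2: "(if y \<in> ?\<tau> ` ?U then F y else 0) = (if y \<in> chart_region d D then \<theta> d (chart_inv d y) else 0)" for y
  proof (cases "y \<in> chart_region d (chart_dom c \<inter> D)")
    case True
    then show ?thesis using rd by (simp add: im F_def)
  next
    case False
    have "\<theta> d (chart_inv d y) = 0" if "y \<in> chart_region d D"
      using that False rd chart_inv_dom[OF d] K(2) by (intro z(2)) auto
    then show ?thesis using False by (simp add: im)
  qed
  have "(LINT z|lborel. (if z \<in> ?U then \<bar>det (matrix (T z))\<bar> * F (?\<tau> z) else 0)) = (LINT y|lborel. (if y \<in> ?\<tau> ` ?U then F y else 0))"
  proof (rule lborel_change_of_variables)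
    show "open ?U" by (intro open_chart_region[OF c] open_Int open_dom[OF d] D)
    show "open (?\<tau> ` ?U)" unfolding im by (intro open_chart_region[OF d] open_Int open_dom[OF c] D)
    show "(?\<tau> has_derivative T z) (at z)" if "z \<in> ?U" for z
    proof -
      have "z \<in> chart_region c (chart_dom d)" using that rc by auto
      from smooth_on_differentiable[OF transition_smooth[OF c d] this] show ?thesis
        unfolding T_def by (rule frechet_derivative_works[THEN iffD1])
    qed
    show "inj_on ?\<tau> ?U"
    proof (rule inj_on_inverseI[of _ "transition d c"])
      fix z assume "z \<in> ?U"
      then show "transition d c (?\<tau> z) = z"
        using rc chart_inv_map[OF d] chart_map_inv[OF c] by (simp add: transition_def)
    qed
    show "integrable lborel (\<lambda>z. if z \<in> ?U then \<bar>det (matrix (T z))\<bar> * F (?\<tau> z) else 0)"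
      unfolding e1 by (rule chart_integral_integrable[OF c D \<theta> K(1) _ z(1)]) (use K in auto)
    show "integrable lborel (\<lambda>y. if y \<in> ?\<tau> ` ?U then F y else 0)"
      unfolding e2 by (rule chart_integral_integrable[OF d D \<theta> K(1) _ z(2)]) (use K in auto)
  qed
  then show ?thesis unfolding e1 e2 chart_integral_def .
qed

section \<open>Bump functions and partitions of unity\<close>

lemma chart_bump:
  assumes c: "c \<in> A" and p: "p \<in> chart_dom c" "p \<in> W" and W: "open W"
  shows "\<exists>\<beta> K V. C1_map UNIV \<beta> \<and> compact K \<and> K \<subseteq> chart_dom c \<inter> W \<and> open V \<and> p \<in> V \<and>
    (\<forall>x. x \<notin> K \<longrightarrow> \<beta> x = 0) \<and> (\<forall>x. \<beta> x \<ge> 0) \<and> (\<forall>x\<in>V. \<beta> x > (0::real))"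
proof -
  note rc = chart_region_iff[OF c]
  define a where "a = chart_map c p"
  obtain r where r: "r > 0" "cball a r \<subseteq> chart_region c W"
    using open_contains_cball[THEN iffD1, OF open_chart_region[OF c W]] map_in_region[OF c p] unfolding a_def by blast
  \<comment> \<open>Positive exactly on the ball of radius \<open>r\<close>, so the squared positive
    part is a bump supported in the closed ball.\<close>
  define q where "q z = r\<^sup>2 - (z - a) \<bullet> (z - a)" for z
  define \<beta> where "\<beta> x = (if x \<in> chart_dom c then (max 0 (q (chart_map c x)))\<^sup>2 else 0)" for x
  define K where "K = chart_inv c ` cball a r"
  define V where "V = chart_dom c \<inter> chart_map c -` ball a r"
  have q: "q z > 0 \<longleftrightarrow> z \<in> ball a r" for z
  proof -
    have "(z - a) \<bullet> (z - a) = (dist a z)\<^sup>2" by (simp only: power2_norm_eq_inner[symmetric] dist_norm norm_minus_commute)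
    then show ?thesis
      using power_strict_mono[of "dist a z" r 2] power2_less_imp_less[of "dist a z" r] r(1) by (auto simp: q_def)
  qed
  have K: "compact K" unfolding K_def
    by (rule compact_continuous_image[OF continuous_on_subset[OF continuous_chart_inv[OF c]] compact_cball])
      (use r rc in auto)
  have KW: "K \<subseteq> chart_dom c \<inter> W" unfolding K_def using r rc chart_inv_dom[OF c] by auto
  have z: "\<beta> x = 0" if "x \<notin> K" for x
  proof (cases "x \<in> chart_dom c")
    case True
    then have "chart_map c x \<notin> cball a r"
      using that chart_inv_map[OF c True] unfolding K_def by (metis image_eqI)
    then have "\<not> q (chart_map c x) > 0" unfolding q by auto
    then show ?thesis by (simp add: \<beta>_def)
  qed (simp add: \<beta>_def)
  have "C1_map UNIV \<beta>"
    unfolding C1_map_def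
  proof
    fix d assume d: "d \<in> A"
    \<comment> \<open>The two regions cover the image of \<open>d\<close>, since \<open>K\<close>
      lies in \<open>chart_dom c\<close>. On the first the bump is a C1 expression in the transition
      map, on the second it is zero.\<close>
    let ?S = "chart_region d (chart_dom c)" and ?T = "chart_region d (- K)"
    note rd = chart_region_iff[OF d]
    have oS: "open ?S" by (rule open_chart_region[OF d open_dom[OF c]])
    have oT: "open ?T" by (rule open_chart_region[OF d open_Compl[OF compact_imp_closed[OF K]]])
    have "C1_on ?S (\<lambda>z. transition d c z - a)"
      using C1_on_add[OF smooth_on_imp_C1_on[OF transition_smooth[OF d c]] C1_on_const[of _ "- a"]] by simp
    then have "C1_on ?S (\<lambda>z. - 1 * ((transition d c z - a) \<bullet> (transition d c z - a)) + r\<^sup>2)"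
      by (intro C1_on_add C1_on_mult C1_on_inner C1_on_const)
    then have "C1_on ?S (\<lambda>z. q (transition d c z))" by (simp add: q_def)
    then have "C1_on ?S (\<lambda>z. (max 0 (q (transition d c z)))\<^sup>2)" by (rule C1_on_pos_part_square)
    then have 1: "C1_on ?S (\<beta> \<circ> chart_inv d)"
      by (rule C1_on_cong[OF oS, rotated]) (use rd in \<open>auto simp: \<beta>_def transition_def\<close>)
    have 2: "C1_on ?T (\<beta> \<circ> chart_inv d)"
      by (rule C1_on_cong[OF oT _ C1_on_const[of _ 0]]) (use rd z in auto)
    have "chart_region d UNIV = ?S \<union> ?T" using rd KW by auto
    then show "C1_on (chart_region d UNIV) (\<beta> \<circ> chart_inv d)" using C1_on_open_Un[OF oS oT 1 2] by simp
  qed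
  moreover have "open V"
    unfolding V_def by (rule continuous_open_preimage[OF continuous_chart_map[OF c] open_dom[OF c] open_ball])
  moreover have "p \<in> V" using p r by (simp add: V_def a_def)
  moreover have "\<beta> x > 0" if "x \<in> V" for x
    using that q[of "chart_map c x"] by (auto simp: V_def \<beta>_def)
  moreover have "\<beta> x \<ge> 0" for x by (simp add: \<beta>_def)
  ultimately show ?thesis using K KW z by blast
qed

lemma C1_map_sum: "(\<And>i. i \<in> I \<Longrightarrow> C1_map W (f i)) \<Longrightarrow> C1_map W (\<lambda>x. \<Sum>i\<in>I. f i x)"
  unfolding C1_map_def comp_def by (intro ballI C1_on_sum) simp

lemma C1_map_scaleR: "C1_map W r \<Longrightarrow> C1_map W f \<Longrightarrow> C1_map W (\<lambda>x. r x *\<^sub>R f x)"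
  unfolding C1_map_def comp_def by (intro ballI C1_on_scaleR) simp_all

lemma C1_map_real_compose:
  assumes f: "C1_map W f" and \<phi>: "\<And>x. x \<in> W \<Longrightarrow> (\<phi> has_real_derivative \<phi>' (f x)) (at (f x))" "continuous_on (f ` W) \<phi>'"
  shows "C1_map W (\<lambda>x. \<phi> (f x))"
  unfolding C1_map_def comp_def
proof
  fix c assume c: "c \<in> A"
  show "C1_on (chart_region c W) (\<lambda>z. \<phi> (f (chart_inv c z)))"
    by (rule C1_on_real_compose[OF C1_mapD(1)[OF f c, unfolded comp_def] \<phi>(1)])
      (use chart_region_iff[OF c] in \<open>auto intro!: continuous_on_subset[OF \<phi>(2)]\<close>)
qed

text \<open>Finitely many bumps cover the compact closure, and division by their sum is legitimate
  on \<open>D\<close>, where it is positive. The supports may leave \<open>D\<close> but stay in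
  \<open>W\<close>, so quantities defined on \<open>W\<close> are bounded on them up to the
  frontier.\<close>

lemma partition_of_unity:
  assumes D: "compact (closure D)" "closure D \<subseteq> W" "open W"
  shows "\<exists>(P :: 'a set) ch \<rho> K. finite P \<and>
    (\<forall>p\<in>P. ch p \<in> A \<and> compact (K p) \<and> K p \<subseteq> chart_dom (ch p) \<inter> W \<and> C1_map D (\<rho> p) \<and>
       (\<forall>x. x \<notin> K p \<longrightarrow> \<rho> p x = 0) \<and> (\<forall>x. 0 \<le> \<rho> p x)) \<and>
    (\<forall>x\<in>D. (\<Sum>p\<in>P. \<rho> p x) = (1::real))"
proof -
  have "\<exists>c \<beta> K V. c \<in> A \<and> C1_map UNIV \<beta> \<and> compact K \<and> K \<subseteq> chart_dom c \<inter> W \<and> open V \<and> p \<in> V \<and>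
    (\<forall>x. x \<notin> K \<longrightarrow> \<beta> x = 0) \<and> (\<forall>x. \<beta> x \<ge> 0) \<and> (\<forall>x\<in>V. \<beta> x > (0::real))" if p: "p \<in> closure D" for p
  proof -
    obtain c where c: "c \<in> A" "p \<in> chart_dom c" using chart_cover by blast
    have "p \<in> W" using p D(2) by blast
    from chart_bump[OF c this D(3)] show ?thesis using c(1) by (intro exI[of _ c]) simp
  qed
  then obtain ch \<beta> K V where
    b: "\<And>p. p \<in> closure D \<Longrightarrow> ch p \<in> A \<and> C1_map UNIV (\<beta> p) \<and> compact (K p) \<and> K p \<subseteq> chart_dom (ch p) \<inter> W \<and> open (V p) \<and> p \<in> V p \<and>
    (\<forall>x. x \<notin> K p \<longrightarrow> \<beta> p x = 0) \<and> (\<forall>x. \<beta> p x \<ge> 0) \<and> (\<forall>x\<in>V p. \<beta> p x > (0::real))"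
    by metis
  obtain P where P: "P \<subseteq> closure D" "finite P" "closure D \<subseteq> (\<Union>p\<in>P. V p)"
    using compactE_image[OF D(1), of "closure D" V] b by (metis (no_types, lifting) UN_I subsetI)
  define B where "B x = (\<Sum>p\<in>P. \<beta> p x)" for x
  have B: "B x > 0" if "x \<in> D" for x
  proof -
    have "x \<in> closure D" using that closure_subset by (rule subsetD[rotated])
    then obtain p where p: "p \<in> P" "x \<in> V p" using P(3) by blast
    then show ?thesis unfolding B_def using P b by (intro sum_pos2[OF P(2) p(1)]) auto
  qed
  have C1B: "C1_map D B"
    unfolding B_def
  proof (rule C1_map_sum)
    fix p assume "p \<in> P"
    then have "C1_map UNIV (\<beta> p)" using b[of p] P(1) by blast
    then show "C1_map D (\<beta> p)" by (rule C1_map_subset) simp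
  qed
  have C1i: "C1_map D (\<lambda>x. inverse (B x))"
    by (rule C1_map_real_compose[OF C1B, of inverse "\<lambda>s. - inverse s * inverse s"])
      (use B in \<open>auto intro!: DERIV_inverse[unfolded power2_eq_square] continuous_intros derivative_eq_intros simp: less_imp_neq[symmetric] power2_eq_square\<close>)
  define \<rho> where "\<rho> p x = inverse (B x) *\<^sub>R \<beta> p x" for p x
  have "C1_map D (\<rho> p)" if "p \<in> P" for p
    unfolding \<rho>_def using C1_map_scaleR[OF C1i C1_map_subset[of UNIV "\<beta> p" D]] b that P by blast
  moreover have "(\<Sum>p\<in>P. \<rho> p x) = 1" if "x \<in> D" for x
    using B[OF that] by (simp add: \<rho>_def sum_distrib_left[symmetric] B_def[symmetric])
  moreover have "\<rho> p x = 0" if "p \<in> P" "x \<notin> K p" for p x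
  proof -
    have "\<beta> p x = 0" using b[of p] that P by blast
    then show ?thesis by (simp add: \<rho>_def)
  qed
  moreover have "0 \<le> \<rho> p x" if "p \<in> P" for p x
  proof -
    have b0: "\<beta> q x \<ge> 0" if "q \<in> P" for q using b[of q] that P by blast
    then have "B x \<ge> 0" unfolding B_def by (rule sum_nonneg)
    then show ?thesis using b0[OF that] by (simp add: \<rho>_def)
  qed
  moreover have "ch p \<in> A" "compact (K p)" "K p \<subseteq> chart_dom (ch p) \<inter> W" if "p \<in> P" for p
    using b[of p] P(1) that by blast+
  ultimately show ?thesis
    using P(2) by (intro exI[of _ P] exI[of _ ch] exI[of _ \<rho>] exI[of _ K] conjI ballI allI impI) blast+
qed

end


section \<open>The global weak form\<close>

context riem_mfd
begin

text \<open>The increment of the first variation of area from \<open>f0\<close> to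
  \<open>f1\<close>, tested on \<open>w\<close>. For minimal maps it integrates to zero against
  compactly supported \<open>w\<close>, while the spectral bounds make it nonnegative for
  \<open>w = f1 - f0\<close>.\<close>

definition flux_diff :: "('a \<Rightarrow> 'b::real_inner) \<Rightarrow> ('a \<Rightarrow> 'b) \<Rightarrow> ('a \<Rightarrow> 'b) \<Rightarrow> ('a, real^'m) riem_chart \<Rightarrow> 'a \<Rightarrow> real" where
  "flux_diff f1 f0 w c x =
     flux (chart_metric c (chart_map c x)) (differential c f1 x) (differential c w x)
     - flux (chart_metric c (chart_map c x)) (differential c f0 x) (differential c w x)"

definition flux_diff_field :: "('a \<Rightarrow> 'b::real_inner) \<Rightarrow> ('a \<Rightarrow> 'b) \<Rightarrow> ('a, real^'m) riem_chart \<Rightarrow> 'm \<Rightarrow> real^'m \<Rightarrow> 'b" where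
  "flux_diff_field f1 f0 c i z =
     flux_field (chart_metric c) (f1 \<circ> chart_inv c) i z - flux_field (chart_metric c) (f0 \<circ> chart_inv c) i z"

lemma flux_diff_region:
  assumes c: "c \<in> A" and z: "z \<in> chart_image c"
  shows "flux_diff f1 f0 w c (chart_inv c z)
     = (\<Sum>i\<in>UNIV. flux_diff_field f1 f0 c i z \<bullet> differential c w (chart_inv c z) (axis i 1))"
  unfolding flux_diff_def flux_diff_field_def chart_map_inv[OF c z] differential_region[OF c z] flux_eq_flux_field
  by (simp add: inner_diff_left sum_subtractf)

lemma flux_diff_field_C1:
  fixes f0 f1 :: "'a \<Rightarrow> 'b::euclidean_space"
  assumes c: "c \<in> A" and W: "open W" and f: "smooth_map_on A W f0" "smooth_map_on A W f1"
  shows "C1_on (chart_region c W) (flux_diff_field f1 f0 c i)"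
proof -
  have s: "smooth_on (chart_region c W) (f0 \<circ> chart_inv c)" "smooth_on (chart_region c W) (f1 \<circ> chart_inv c)"
    using f c unfolding smooth_map_on_def chart_region_def by blast+
  note fc = flux_field_C1[OF metric_region[OF c] open_chart_region[OF c W]]
  have "C1_on (chart_region c W) (\<lambda>z. flux_field (chart_metric c) (f1 \<circ> chart_inv c) i z
      + - 1 *\<^sub>R flux_field (chart_metric c) (f0 \<circ> chart_inv c) i z)"
    by (rule C1_on_add[OF fc[OF s(2)] C1_on_scaleR[OF C1_on_const fc[OF s(1)]]])
  then show ?thesis by (simp add: flux_diff_field_def[abs_def])
qed

lemma differential_continuous:
  assumes c: "c \<in> A" and w: "C1_map W w"
  shows "continuous_on (chart_region c W) (\<lambda>z. differential c w (chart_inv c z) v)"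
proof (rule continuous_on_eq[OF C1_onD(2)[OF C1_mapD(1)[OF w c], of v]])
  fix z assume "z \<in> chart_region c W"
  then show "frechet_derivative (w \<circ> chart_inv c) (at z) v = differential c w (chart_inv c z) v"
    using differential_region[OF c] chart_region_subset[OF c] by (metis subsetD)
qed

lemma flux_diff_density:
  fixes f0 f1 w :: "'a \<Rightarrow> 'b::euclidean_space"
  assumes D: "open D" and f: "smooth_map_on A D f0" "smooth_map_on A D f1" and w: "C1_map D w"
  shows "density_on D (flux_diff f1 f0 w)"
  unfolding density_on_def
proof (intro conjI ballI)
  fix c assume c: "c \<in> A"
  have "continuous_on (chart_region c D)
     (\<lambda>z. \<Sum>i\<in>UNIV. flux_diff_field f1 f0 c i z \<bullet> differential c w (chart_inv c z) (axis i 1))"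
    by (intro continuous_on_sum continuous_on_inner differential_continuous[OF c w]
        C1_on_continuous[OF flux_diff_field_C1[OF c D f]])
  then show "continuous_on (chart_region c D) (\<lambda>z. flux_diff f1 f0 w c (chart_inv c z))"
    by (rule continuous_on_eq) (rule flux_diff_region[OF c subsetD[OF chart_region_subset[OF c]], symmetric])
  fix d x assume d: "d \<in> A" and x: "x \<in> chart_dom c \<inter> chart_dom d \<inter> D"
  then have x': "x \<in> chart_dom c" "x \<in> chart_dom d" "x \<in> D" by auto
  show "flux_diff f1 f0 w c x = \<bar>det (matrix (frechet_derivative (transition c d) (at (chart_map c x))))\<bar> * flux_diff f1 f0 w d x"
    unfolding flux_diff_def flux_transition[OF c d x' smooth_map_imp_C1_map[OF f(1)] w]
      flux_transition[OF c d x' smooth_map_imp_C1_map[OF f(2)] w] by (simp add: right_diff_distrib)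
qed

lemma differential_cong:
  assumes c: "c \<in> A" and D: "open D" and x: "x \<in> chart_dom c" "x \<in> D" and e: "\<And>y. y \<in> D \<Longrightarrow> f y = g y"
  shows "differential c f x = differential c g x"
  unfolding differential_def
  by (rule frechet_derivative_cong_open[OF open_chart_region[OF c D] map_in_region[OF c x]])
    (use chart_region_iff[OF c] e in auto)

lemma differential_const: "differential c (\<lambda>_. k) x = (\<lambda>_. 0)"
  by (simp add: differential_def comp_def)

lemma differential_zero:
  assumes c: "c \<in> A" and D: "open D" and K: "closed K" and x: "x \<in> chart_dom c" "x \<in> D - K"
    and z: "\<And>y. y \<in> D - K \<Longrightarrow> w y = 0"
  shows "differential c w x = (\<lambda>_. 0)"
  using differential_cong[OF c open_Diff[OF D K] x, of w "\<lambda>_. 0"] z differential_const by metis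

lemma differential_sum:
  assumes c: "c \<in> A" and D: "open D" and x: "x \<in> chart_dom c" "x \<in> D"
    and e: "\<And>y. y \<in> D \<Longrightarrow> w y = (\<Sum>q\<in>P. V q y)" and V: "\<And>q. q \<in> P \<Longrightarrow> C1_map D (V q)"
  shows "differential c w x = (\<lambda>v. \<Sum>q\<in>P. differential c (V q) x v)"
proof -
  have "((\<lambda>z. \<Sum>q\<in>P. (V q \<circ> chart_inv c) z) has_derivative (\<lambda>v. \<Sum>q\<in>P. differential c (V q) x v)) (at (chart_map c x))"
    by (intro has_derivative_sum C1_mapD(2)[OF V c x])
  from frechet_derivative_at[OF this] have "differential c (\<lambda>y. \<Sum>q\<in>P. V q y) x = (\<lambda>v. \<Sum>q\<in>P. differential c (V q) x v)"
    by (simp add: differential_def comp_def)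
  then show ?thesis using differential_cong[OF c D x e] by simp
qed

lemma chart_weak_form:
  fixes f0 f1 w :: "'a \<Rightarrow> 'b::euclidean_space"
  assumes c: "c \<in> A" and D: "open D" and f: "smooth_map_on A D f0" "smooth_map_on A D f1" and w: "C1_map D w"
    and m: "\<And>z. z \<in> chart_region c D \<Longrightarrow> minimal_graph_eq (chart_metric c) (f0 \<circ> chart_inv c) z"
      "\<And>z. z \<in> chart_region c D \<Longrightarrow> minimal_graph_eq (chart_metric c) (f1 \<circ> chart_inv c) z"
    and K: "compact K" "K \<subseteq> chart_dom c \<inter> D" "\<And>x. x \<in> D - K \<Longrightarrow> w x = 0"
  shows "chart_integral D c (flux_diff f1 f0 w) = 0"
proof -
  have s: "smooth_on (chart_region c D) (f0 \<circ> chart_inv c)" "smooth_on (chart_region c D) (f1 \<circ> chart_inv c)"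
    using f c unfolding smooth_map_on_def chart_region_def by blast+
  have ck: "compact (chart_map c ` K)" by (rule compact_chart_image[OF c K(1)]) (use K in auto)
  have sub: "chart_map c ` K \<subseteq> chart_region c D" using K(2) by (auto simp: chart_region_def)
  have z: "(w \<circ> chart_inv c) z = 0" if "z \<in> chart_region c D - chart_map c ` K" for z
  proof -
    have "chart_inv c z \<in> D - K"
      using that chart_region_iff[OF c] chart_map_inv[OF c] by (auto simp: image_iff)
    then show ?thesis using K(3) by simp
  qed
  note W0 = flux_weak[OF metric_region[OF c] open_chart_region[OF c D] s(1) m(1) C1_mapD(1)[OF w c] ck sub z]
  note W1 = flux_weak[OF metric_region[OF c] open_chart_region[OF c D] s(2) m(2) C1_mapD(1)[OF w c] ck sub z]
  have "(if z \<in> chart_region c D then flux_diff f1 f0 w c (chart_inv c z) else 0) =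
     (if z \<in> chart_region c D then flux (chart_metric c z) (frechet_derivative (f1 \<circ> chart_inv c) (at z)) (frechet_derivative (w \<circ> chart_inv c) (at z)) else 0)
   - (if z \<in> chart_region c D then flux (chart_metric c z) (frechet_derivative (f0 \<circ> chart_inv c) (at z)) (frechet_derivative (w \<circ> chart_inv c) (at z)) else 0)" for z
  proof (cases "z \<in> chart_region c D")
    case True
    then have "z \<in> chart_image c" using chart_region_subset[OF c] by blast
    then show ?thesis by (simp add: flux_diff_def chart_map_inv[OF c] differential_region[OF c])
  qed simp
  then show ?thesis
    unfolding chart_integral_def using W0 W1 by simp
qed

text \<open>The partition of unity is used twice: \<open>\<rho> p\<close> defines the global
  integral, and \<open>\<rho> q\<close> splits the test map into pieces supported in one chart. Each
  mixed term lives in two charts and is moved from that of \<open>p\<close> to that of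
  \<open>q\<close>. The factors \<open>\<rho> p\<close> then sum to \<open>1\<close>, and
  \<open>chart_weak_form\<close> applies to each piece.\<close>

lemma global_weak_form:
  fixes f0 f1 w :: "'a \<Rightarrow> 'b::euclidean_space"
  assumes D: "open D" and f: "smooth_map_on A D f0" "smooth_map_on A D f1" and w: "C1_map D w"
    and m: "\<And>c z. c \<in> A \<Longrightarrow> z \<in> chart_region c D \<Longrightarrow> minimal_graph_eq (chart_metric c) (f0 \<circ> chart_inv c) z"
      "\<And>c z. c \<in> A \<Longrightarrow> z \<in> chart_region c D \<Longrightarrow> minimal_graph_eq (chart_metric c) (f1 \<circ> chart_inv c) z"
    and K: "compact K" "K \<subseteq> D" "\<And>x. x \<in> D - K \<Longrightarrow> w x = 0"
    and P: "finite P" "\<And>p. p \<in> P \<Longrightarrow> ch p \<in> A" "\<And>p. p \<in> P \<Longrightarrow> compact (Kp p)" "\<And>p. p \<in> P \<Longrightarrow> Kp p \<subseteq> chart_dom (ch p)"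
      "\<And>p. p \<in> P \<Longrightarrow> C1_map D (\<rho> p)" "\<And>p x. p \<in> P \<Longrightarrow> x \<notin> Kp p \<Longrightarrow> \<rho> p x = 0" "\<And>x. x \<in> D \<Longrightarrow> (\<Sum>p\<in>P. \<rho> p x) = 1"
  shows "(\<Sum>p\<in>P. chart_integral D (ch p) (\<lambda>c x. \<rho> p x * flux_diff f1 f0 w c x)) = 0"
proof -
  define V where "V q x = \<rho> q x *\<^sub>R w x" for q x
  have V: "C1_map D (V q)" if "q \<in> P" for q
    unfolding V_def by (rule C1_map_scaleR[OF P(5)[OF that] w])
  have wV: "w x = (\<Sum>q\<in>P. V q x)" if "x \<in> D" for x
    unfolding V_def using P(7)[OF that] by (simp add: scaleR_sum_left[symmetric])
  define \<theta> where "\<theta> q = flux_diff f1 f0 (V q)" for q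
  have dens: "density_on D (\<theta> q)" if "q \<in> P" for q
    unfolding \<theta>_def by (rule flux_diff_density[OF D f V[OF that]])
  have cK: "compact (K \<inter> Kp q)" "closed (K \<inter> Kp q)" if "q \<in> P" for q
    using compact_Int_closed[OF K(1) compact_imp_closed[OF P(3)[OF that]]] compact_imp_closed by auto
  have Vz: "V q x = 0" if "q \<in> P" "x \<in> D - (K \<inter> Kp q)" for q x
    using that K(3)[of x] P(6)[of q x] by (auto simp: V_def)
  have \<theta>z: "\<theta> q c x = 0" if "q \<in> P" "c \<in> A" "x \<in> chart_dom c" "x \<in> D - (K \<inter> Kp q)" for q c x
    using differential_zero[OF that(2) D cK(2)[OF that(1)] that(3,4) Vz[OF that(1)]]
    by (simp add: \<theta>_def flux_diff_def flux_zero)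
  have sum\<theta>: "flux_diff f1 f0 w c x = (\<Sum>q\<in>P. \<theta> q c x)" if "c \<in> A" "x \<in> chart_dom c" "x \<in> D" for c x
  proof -
    have d: "differential c w x = (\<lambda>v. \<Sum>q\<in>P. differential c (V q) x v)"
      by (rule differential_sum[OF that(1) D that(2,3) wV V])
    show ?thesis unfolding flux_diff_def \<theta>_def d flux_sum_right sum_subtractf by simp
  qed
  define I where "I p q c = chart_integral D c (\<lambda>c x. \<rho> p x * \<theta> q c x)" for p q c
  have dens2: "density_on D (\<lambda>c x. \<rho> p x * \<theta> q c x)" if "p \<in> P" "q \<in> P" for p q
    by (rule density_on_mult[OF dens[OF that(2)] P(5)[OF that(1)]])
  have cKpq: "compact (K \<inter> Kp q \<inter> Kp p)" if "p \<in> P" "q \<in> P" for p q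
    using compact_Int_closed[OF cK(1)[OF that(2)] compact_imp_closed[OF P(3)[OF that(1)]]] .
  have z2: "\<rho> p x * \<theta> q c x = 0" if "p \<in> P" "q \<in> P" "c \<in> A" "x \<in> chart_dom c \<inter> D - (K \<inter> Kp q \<inter> Kp p)" for p q c x
    using that P(6)[of p x] \<theta>z[of q c x] by auto
  have sub: "K \<inter> Kp q \<inter> Kp p \<subseteq> chart_dom (ch p) \<inter> chart_dom (ch q) \<inter> D" if "p \<in> P" "q \<in> P" for p q
    using K(2) P(4)[OF that(1)] P(4)[OF that(2)] by auto
  have int: "integrable lborel (\<lambda>z. if z \<in> chart_region (ch r) D then \<rho> p (chart_inv (ch r) z) * \<theta> q (ch r) (chart_inv (ch r) z) else 0)"
    if "p \<in> P" "q \<in> P" "r = p \<or> r = q" for p q r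
    by (rule chart_integral_integrable[OF _ D dens2[OF that(1,2)] cKpq[OF that(1,2)] _ z2[OF that(1,2)]])
      (use sub[OF that(1,2)] that P(2) in auto)
  have "(\<Sum>p\<in>P. chart_integral D (ch p) (\<lambda>c x. \<rho> p x * flux_diff f1 f0 w c x)) = (\<Sum>p\<in>P. \<Sum>q\<in>P. I p q (ch p))"
  proof (rule sum.cong[OF refl])
    fix p assume p: "p \<in> P"
    have "(if z \<in> chart_region (ch p) D then \<rho> p (chart_inv (ch p) z) * flux_diff f1 f0 w (ch p) (chart_inv (ch p) z) else 0)
       = (\<Sum>q\<in>P. if z \<in> chart_region (ch p) D then \<rho> p (chart_inv (ch p) z) * \<theta> q (ch p) (chart_inv (ch p) z) else 0)" for z
      using chart_region_iff[OF P(2)[OF p], of z D] chart_inv_dom[OF P(2)[OF p], of z] sum\<theta>[OF P(2)[OF p]]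
      by (cases "z \<in> chart_region (ch p) D") (simp_all add: sum_distrib_left)
    then show "chart_integral D (ch p) (\<lambda>c x. \<rho> p x * flux_diff f1 f0 w c x) = (\<Sum>q\<in>P. I p q (ch p))"
      unfolding I_def chart_integral_def using int[OF p] by (simp add: Bochner_Integration.integral_sum)
  qed
  also have "\<dots> = (\<Sum>p\<in>P. \<Sum>q\<in>P. I p q (ch q))"
    unfolding I_def
    by (intro sum.cong refl chart_integral_transfer[OF P(2) P(2) D dens2 cKpq sub z2 z2] P(2))
  also have "\<dots> = (\<Sum>q\<in>P. \<Sum>p\<in>P. I p q (ch q))" by (rule sum.swap)
  also have "\<dots> = (\<Sum>q\<in>P. chart_integral D (ch q) (\<theta> q))"
  proof (rule sum.cong[OF refl])
    fix q assume q: "q \<in> P"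
    have "(if z \<in> chart_region (ch q) D then \<theta> q (ch q) (chart_inv (ch q) z) else 0)
       = (\<Sum>p\<in>P. if z \<in> chart_region (ch q) D then \<rho> p (chart_inv (ch q) z) * \<theta> q (ch q) (chart_inv (ch q) z) else 0)" for z
      using chart_region_iff[OF P(2)[OF q], of z D] P(7)
      by (cases "z \<in> chart_region (ch q) D") (simp_all add: sum_distrib_right[symmetric])
    then show "(\<Sum>p\<in>P. I p q (ch q)) = chart_integral D (ch q) (\<theta> q)"
      unfolding I_def chart_integral_def using int[OF _ q] by (simp add: Bochner_Integration.integral_sum)
  qed
  also have "\<dots> = 0"
  proof (rule sum.neutral, rule ballI)
    fix q assume q: "q \<in> P"
    show "chart_integral D (ch q) (\<theta> q) = 0"
      unfolding \<theta>_def
      by (rule chart_weak_form[OF P(2)[OF q] D f V[OF q] m(1)[OF P(2)[OF q]] m(2)[OF P(2)[OF q]] cK(1)[OF q] _ Vz[OF q]])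
        (use K(2) P(4)[OF q] in auto)
  qed
  finally show ?thesis .
qed

end


section \<open>Truncation\<close>

text \<open>Zero up to \<open>1\<close> and tending to \<open>1\<close>, with one continuous
  derivative. The decay of the rational expression makes \<open>t * cutoff' t\<close> bounded and
  convergent to zero, which is what controls the derivative of the truncation.\<close>

definition cutoff :: "real \<Rightarrow> real" where
  "cutoff t = (max 0 (t - 1))\<^sup>2 / (1 + (max 0 (t - 1))\<^sup>2)"

definition cutoff' :: "real \<Rightarrow> real" where
  "cutoff' t = 2 * max 0 (t - 1) / (1 + (max 0 (t - 1))\<^sup>2)\<^sup>2"

lemma cutoff_pos: "1 + (max 0 (t - 1 :: real))\<^sup>2 > 0"
  by (simp add: add_pos_nonneg)

lemma DERIV_cutoff: "(cutoff has_real_derivative cutoff' t) (at t)"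
proof -
  define q where "q t = (max 0 (t - 1 :: real))\<^sup>2" for t
  have q: "(q has_real_derivative 2 * max 0 (t - 1)) (at t)"
  proof -
    have "((\<lambda>t. t - 1) has_real_derivative 1) (at t)" by (auto intro!: derivative_eq_intros)
    from DERIV_chain2[OF DERIV_pos_part_square this] show ?thesis by (simp add: q_def[abs_def])
  qed
  have p: "1 + q t > 0" for t by (simp add: q_def add_pos_nonneg)
  have "((\<lambda>t. q t / (1 + q t)) has_real_derivative
      (2 * max 0 (t - 1) * (1 + q t) - q t * (0 + 2 * max 0 (t - 1))) / ((1 + q t) * (1 + q t))) (at t)"
    by (intro DERIV_divide q DERIV_add DERIV_const) (use p[of t] in simp)
  then show ?thesis
    by (simp add: cutoff_def[abs_def] cutoff'_def q_def[abs_def] power2_eq_square algebra_simps)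
qed

lemma continuous_cutoff': "continuous_on S cutoff'"
proof -
  have "(1 + (max 0 (t - 1 :: real))\<^sup>2)\<^sup>2 \<noteq> 0" for t using cutoff_pos[of t] by simp
  then show ?thesis unfolding cutoff'_def[abs_def] by (intro continuous_intros) simp
qed

lemma cutoff_bounds:
  "0 \<le> cutoff t" "cutoff t \<le> 1" "t \<le> 1 \<Longrightarrow> cutoff t = 0"
  "0 \<le> t * cutoff' t" "t * cutoff' t \<le> 2 / (1 + max 0 (t - 1))"
proof -
  define q where "q = max 0 (t - 1)"
  have q: "q \<ge> 0" "1 + q\<^sup>2 > 0" by (simp_all add: q_def add_pos_nonneg)
  show "0 \<le> cutoff t" unfolding cutoff_def q_def[symmetric] using q by simp
  show "cutoff t \<le> 1" unfolding cutoff_def q_def[symmetric] using q by simp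
  show "t \<le> 1 \<Longrightarrow> cutoff t = 0" by (simp add: cutoff_def)
  \<comment> \<open>Both sides vanish for \<open>t \<le> 1\<close>; beyond that
    \<open>t = 1 + q\<close>.\<close>
  have tq: "t * q = (1 + q) * q" by (auto simp: q_def max_def)
  have e: "t * cutoff' t = 2 * ((1 + q) * q) / (1 + q\<^sup>2)\<^sup>2"
    unfolding cutoff'_def q_def[symmetric] tq[symmetric] by simp
  show "0 \<le> t * cutoff' t" unfolding e using q by simp
  \<comment> \<open>Used twice: directly, and in the form
    \<open>(1 + q)^2 \<le> 2 (1 + q^2)\<close>.\<close>
  have "2 * q \<le> 1 + q\<^sup>2" using zero_le_power2[of "q - 1"] by (simp add: power2_eq_square algebra_simps)
  then have "2 * q * (1 + q)\<^sup>2 \<le> (1 + q\<^sup>2) * (1 + q)\<^sup>2" by (rule mult_right_mono) simp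
  also have "\<dots> \<le> (1 + q\<^sup>2) * (2 * (1 + q\<^sup>2))"
    using \<open>2 * q \<le> 1 + q\<^sup>2\<close> by (intro mult_left_mono) (auto simp: power2_eq_square algebra_simps)
  also have "2 * q * (1 + q)\<^sup>2 = 2 * ((1 + q) * q) * (1 + q)" by (simp add: power2_eq_square)
  also have "(1 + q\<^sup>2) * (2 * (1 + q\<^sup>2)) = 2 * (1 + q\<^sup>2)\<^sup>2" by (simp add: power2_eq_square)
  finally have "2 * ((1 + q) * q) * (1 + q) \<le> 2 * (1 + q\<^sup>2)\<^sup>2" .
  then show "t * cutoff' t \<le> 2 / (1 + max 0 (t - 1))"
    unfolding e q_def[symmetric] using q by (simp add: field_simps)
qed

lemma cutoff_limits:
  assumes s: "s > 0"
  shows "(\<lambda>n. cutoff (real n * s)) \<longlonglongrightarrow> 1" and "(\<lambda>n. real n * s * cutoff' (real n * s)) \<longlonglongrightarrow> 0"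
proof -
  have ns: "filterlim (\<lambda>n. real n * s) at_top sequentially"
    using s filterlim_tendsto_pos_mult_at_top[OF tendsto_const[of s] s filterlim_real_sequentially] by (simp add: mult.commute)
  have q: "filterlim (\<lambda>n. max 0 (real n * s - 1)) at_top sequentially"
  proof (rule filterlim_at_top_mono)
    show "filterlim (\<lambda>n. - 1 + real n * s) at_top sequentially"
      by (rule filterlim_tendsto_add_at_top[OF tendsto_const ns])
  qed (auto intro!: always_eventually)
  have q1: "filterlim (\<lambda>n. 1 + max 0 (real n * s - 1)) at_top sequentially"
    by (rule filterlim_tendsto_add_at_top[OF tendsto_const q])
  have q2: "filterlim (\<lambda>n. 1 + (max 0 (real n * s - 1))\<^sup>2) at_top sequentially"
    by (rule filterlim_tendsto_add_at_top[OF tendsto_const])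
      (use filterlim_pow_at_top[OF _ q, of 2] in simp)
  have "(\<lambda>n. 1 - inverse (1 + (max 0 (real n * s - 1))\<^sup>2)) \<longlonglongrightarrow> 1 - 0"
    by (intro tendsto_diff tendsto_const tendsto_inverse_0_at_top q2)
  moreover have "1 - inverse (1 + (max 0 (real n * s - 1))\<^sup>2) = cutoff (real n * s)" for n
    using cutoff_pos[of "real n * s"] by (simp add: cutoff_def field_simps)
  ultimately show "(\<lambda>n. cutoff (real n * s)) \<longlonglongrightarrow> 1" by simp
  have "(\<lambda>n. 2 * inverse (1 + max 0 (real n * s - 1))) \<longlonglongrightarrow> 2 * 0"
    by (intro tendsto_mult tendsto_const tendsto_inverse_0_at_top q1)
  then have "(\<lambda>n. 2 / (1 + max 0 (real n * s - 1))) \<longlonglongrightarrow> 0" by (simp add: divide_inverse)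
  then show "(\<lambda>n. real n * s * cutoff' (real n * s)) \<longlonglongrightarrow> 0"
    by (rule tendsto_sandwich[OF _ _ tendsto_const, rotated 2]) (auto intro!: always_eventually cutoff_bounds)
qed

text \<open>The set where \<open>h\<close> is nonzero is open, and a nonempty open set is not
  negligible.\<close>

lemma AE_zero_continuous:
  fixes h :: "'a::euclidean_space \<Rightarrow> real"
  assumes S: "open S" and h: "continuous_on S h" and AE: "AE x in lborel. x \<in> S \<longrightarrow> h x = 0" and x: "x \<in> S"
  shows "h x = 0"
proof (rule ccontr)
  assume nz: "h x \<noteq> 0"
  define T where "T = S \<inter> h -` (- {0})"
  have T: "open T" unfolding T_def by (rule continuous_open_preimage[OF h S]) auto
  have "T \<noteq> {}" using nz x by (auto simp: T_def)
  obtain N where N: "{x \<in> space lborel. \<not> (x \<in> S \<longrightarrow> h x = 0)} \<subseteq> N" "N \<in> null_sets lborel"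
    using AE by (auto elim!: AE_E simp: null_sets_def)
  have "N \<in> null_sets lebesgue" using N(2) null_sets_completionI by blast
  then have "negligible N" by (simp add: negligible_iff_null_sets)
  moreover have "T \<subseteq> N" using N(1) by (auto simp: T_def)
  ultimately have "negligible T" using negligible_subset by blast
  then show False using open_not_negligible[OF T \<open>T \<noteq> {}\<close>] by blast
qed

section \<open>Truncated test maps\<close>

context riem_mfd
begin

lemma C1_map_continuous:
  assumes W: "open W" and w: "C1_map W w"
  shows "continuous_on W w"
proof (rule continuous_at_imp_continuous_on, rule ballI)
  fix x assume x: "x \<in> W"
  obtain c where c: "c \<in> A" "x \<in> chart_dom c" using chart_cover by blast
  let ?U = "chart_dom c \<inter> W"
  have oU: "open ?U" by (intro open_Int open_dom[OF c(1)] W)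
  have "continuous_on ?U (\<lambda>y. (w \<circ> chart_inv c) (chart_map c y))"
    by (rule continuous_on_compose2[OF C1_on_continuous[OF C1_mapD(1)[OF w c(1)]]
          continuous_on_subset[OF continuous_chart_map[OF c(1)]]]) (auto simp: chart_region_def)
  then have "continuous_on ?U w" by (rule continuous_on_eq) (use chart_inv_map[OF c(1)] in auto)
  then show "isCont w x" using oU c(2) x by (simp add: continuous_on_eq_continuous_at)
qed

lemma C1_map_inner: "C1_map W f \<Longrightarrow> C1_map W g \<Longrightarrow> C1_map W (\<lambda>x. f x \<bullet> g x)"
  unfolding C1_map_def comp_def by (intro ballI C1_on_inner) simp_all

lemma C1_map_diff: "C1_map W f \<Longrightarrow> C1_map W g \<Longrightarrow> C1_map W (\<lambda>x. f x - g x)"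
  unfolding C1_map_def comp_def
proof
  fix c assume c: "c \<in> A" and f: "\<forall>c\<in>A. C1_on (chart_region c W) (\<lambda>x. f (chart_inv c x))"
    and g: "\<forall>c\<in>A. C1_on (chart_region c W) (\<lambda>x. g (chart_inv c x))"
  have "C1_on (chart_region c W) (\<lambda>x. f (chart_inv c x) + - 1 *\<^sub>R g (chart_inv c x))"
    using f g c by (intro C1_on_add C1_on_scaleR C1_on_const) simp_all
  then show "C1_on (chart_region c W) (\<lambda>x. f (chart_inv c x) - g (chart_inv c x))" by simp
qed

lemma differential_diff:
  assumes c: "c \<in> A" and x: "x \<in> chart_dom c" "x \<in> W" and f: "C1_map W f" and g: "C1_map W g"
  shows "differential c (\<lambda>y. f y - g y) x = (\<lambda>v. differential c f x v - differential c g x v)"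
  using frechet_derivative_at[OF has_derivative_diff[OF C1_mapD(2)[OF f c x] C1_mapD(2)[OF g c x]]]
  by (simp add: differential_def comp_def)

lemma differential_norm_sq:
  assumes c: "c \<in> A" and x: "x \<in> chart_dom c" "x \<in> W" and f: "C1_map W f"
  shows "((\<lambda>z. (f \<circ> chart_inv c) z \<bullet> (f \<circ> chart_inv c) z) has_derivative
     (\<lambda>v. 2 * (f x \<bullet> differential c f x v))) (at (chart_map c x))"
  using has_derivative_inner[OF C1_mapD(2)[OF f c x] C1_mapD(2)[OF f c x]] chart_inv_map[OF c x(1)]
  by (simp add: inner_commute)

text \<open>Vanishes near the zeros of \<open>u\<close> and tends to \<open>u\<close>, with derivative bounded uniformly in \<open>n\<close> by that of \<open>u\<close>.\<close>

definition truncate :: "nat \<Rightarrow> ('a \<Rightarrow> 'b::real_inner) \<Rightarrow> 'a \<Rightarrow> 'b" where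
  "truncate n u x = cutoff (real n * (u x \<bullet> u x)) *\<^sub>R u x"

lemma truncate_C1: "C1_map W u \<Longrightarrow> C1_map W (truncate n u)"
proof -
  assume u: "C1_map W u"
  have "C1_map W (\<lambda>x. real n * (u x \<bullet> u x))"
    using C1_map_inner[OF u u] unfolding C1_map_def comp_def by (intro ballI C1_on_mult C1_on_const) simp
  from C1_map_real_compose[OF this DERIV_cutoff continuous_cutoff']
  show ?thesis unfolding truncate_def[abs_def] by (rule C1_map_scaleR[OF _ u])
qed

lemma differential_truncate:
  assumes c: "c \<in> A" and x: "x \<in> chart_dom c" "x \<in> W" and u: "C1_map W u"
  shows "differential c (truncate n u) x v = cutoff (real n * (u x \<bullet> u x)) *\<^sub>R differential c u x v
     + (cutoff' (real n * (u x \<bullet> u x)) * (real n * (2 * (u x \<bullet> differential c u x v)))) *\<^sub>R u x"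
proof -
  have 1: "((\<lambda>z. real n * ((u \<circ> chart_inv c) z \<bullet> (u \<circ> chart_inv c) z)) has_derivative
      (\<lambda>v. real n * (2 * (u x \<bullet> differential c u x v)))) (at (chart_map c x))"
    by (rule has_derivative_mult_right[OF differential_norm_sq[OF c x u]])
  have 2: "((\<lambda>z. cutoff (real n * ((u \<circ> chart_inv c) z \<bullet> (u \<circ> chart_inv c) z))) has_derivative
      (\<lambda>v. cutoff' (real n * (u x \<bullet> u x)) * (real n * (2 * (u x \<bullet> differential c u x v))))) (at (chart_map c x))"
    using has_derivative_compose[OF 1 DERIV_cutoff[unfolded has_field_derivative_def]] chart_inv_map[OF c x(1)]
    by simp
  have "((\<lambda>z. cutoff (real n * ((u \<circ> chart_inv c) z \<bullet> (u \<circ> chart_inv c) z)) *\<^sub>R (u \<circ> chart_inv c) z) has_derivative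
     (\<lambda>v. cutoff (real n * (u x \<bullet> u x)) *\<^sub>R differential c u x v
     + (cutoff' (real n * (u x \<bullet> u x)) * (real n * (2 * (u x \<bullet> differential c u x v)))) *\<^sub>R u x)) (at (chart_map c x))"
    using has_derivative_scaleR[OF 2 C1_mapD(2)[OF u c x]] chart_inv_map[OF c x(1)] by simp
  from fun_cong[OF frechet_derivative_at[OF this], of v] show ?thesis
    unfolding differential_def[of c "truncate n u"] by (simp add: comp_def truncate_def[abs_def])
qed

text \<open>The constant is \<open>1 + 4\<close>: the factor \<open>cutoff\<close> is at most
  \<open>1\<close>, and its derivative contributes the \<open>2\<close> from differentiating
  \<open>u \<bullet> u\<close> times the bound \<open>2\<close> on
  \<open>t * cutoff' t\<close>.\<close>

lemma norm_differential_truncate: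
  assumes c: "c \<in> A" and x: "x \<in> chart_dom c" "x \<in> W" and u: "C1_map W u"
  shows "norm (differential c (truncate n u) x v) \<le> 5 * norm (differential c u x v)"
proof -
  define D where "D = differential c u x v"
  define s where "s = u x \<bullet> u x"
  define t where "t = real n * s"
  have s: "s = norm (u x) * norm (u x)" by (simp add: s_def power2_norm_eq_inner[symmetric] power2_eq_square)
  have "norm ((cutoff' t * (real n * (2 * (u x \<bullet> D)))) *\<^sub>R u x) = \<bar>cutoff' t\<bar> * real n * 2 * \<bar>u x \<bullet> D\<bar> * norm (u x)"
    by (simp add: abs_mult)
  also have "\<dots> \<le> \<bar>cutoff' t\<bar> * real n * 2 * (norm (u x) * norm D) * norm (u x)"
    by (intro mult_right_mono mult_left_mono Cauchy_Schwarz_ineq2) auto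
  also have "\<dots> = 2 * \<bar>t * cutoff' t\<bar> * norm D" by (simp add: t_def s abs_mult)
  also have "\<dots> \<le> 2 * 2 * norm D"
  proof (intro mult_right_mono mult_left_mono)
    have "2 / (1 + max 0 (t - 1)) \<le> 2" by (simp add: field_simps)
    then show "\<bar>t * cutoff' t\<bar> \<le> 2" using cutoff_bounds(4,5)[of t] by linarith
  qed auto
  finally have 2: "norm ((cutoff' t * (real n * (2 * (u x \<bullet> D)))) *\<^sub>R u x) \<le> 4 * norm D" by simp
  have "norm (cutoff t *\<^sub>R D) \<le> 1 * norm D"
    unfolding norm_scaleR using cutoff_bounds(1,2)[of t] by (intro mult_right_mono) auto
  then show ?thesis
    using norm_triangle_ineq[of "cutoff t *\<^sub>R D" "(cutoff' t * (real n * (2 * (u x \<bullet> D)))) *\<^sub>R u x"] 2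
    unfolding differential_truncate[OF c x u] D_def[symmetric] s_def[symmetric] t_def[symmetric] by linarith
qed

text \<open>At a zero of \<open>u\<close> all truncations have zero differential, so the limit there
  is \<open>0\<close> whatever the differential of \<open>u\<close> is. The limiting integral
  therefore sees only the set where \<open>u\<close> is nonzero.\<close>

lemma differential_truncate_limit:
  assumes c: "c \<in> A" and x: "x \<in> chart_dom c" "x \<in> W" and u: "C1_map W u"
  shows "(\<lambda>n. differential c (truncate n u) x v) \<longlonglongrightarrow> (if u x = 0 then 0 else differential c u x v)"
proof (cases "u x = 0")
  case True
  then show ?thesis by (simp add: differential_truncate[OF c x u] cutoff_bounds(3))
next
  case False
  define D where "D = differential c u x v"
  define s where "s = u x \<bullet> u x"
  have s: "s > 0" using False by (simp add: s_def)
  have "(\<lambda>n. cutoff (real n * s) *\<^sub>R D + (real n * s * cutoff' (real n * s) * (2 * (u x \<bullet> D) / s)) *\<^sub>R u x)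
     \<longlonglongrightarrow> 1 *\<^sub>R D + (0 * (2 * (u x \<bullet> D) / s)) *\<^sub>R u x"
    by (intro tendsto_intros cutoff_limits[OF s])
  moreover have "real n * s * cutoff' (real n * s) * (2 * (u x \<bullet> D) / s) = cutoff' (real n * s) * (real n * (2 * (u x \<bullet> D)))" for n
    using s by (simp add: field_simps)
  ultimately show ?thesis
    unfolding differential_truncate[OF c x u] D_def[symmetric] s_def[symmetric] using False by simp
qed

end


section \<open>Uniqueness\<close>

context riem_mfd
begin

text \<open>The weak form for the truncations passes to the limit by dominated convergence. The
  limiting integrands are nonnegative with zero total integral, so each vanishes almost everywhere
  and, by continuity, at \<open>x0\<close> in a chart with
  \<open>\<rho> p x0 \<noteq> 0\<close>.\<close>

lemma flux_diff_vanishes: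
  fixes f0 f1 :: "'a \<Rightarrow> 'b::euclidean_space"
  assumes D: "open D" "compact (closure D)" and W: "open W" "closure D \<subseteq> W"
    and f: "smooth_map_on A W f0" "smooth_map_on A W f1"
    and m: "\<And>c z. c \<in> A \<Longrightarrow> z \<in> chart_region c D \<Longrightarrow> minimal_graph_eq (chart_metric c) (f0 \<circ> chart_inv c) z"
      "\<And>c z. c \<in> A \<Longrightarrow> z \<in> chart_region c D \<Longrightarrow> minimal_graph_eq (chart_metric c) (f1 \<circ> chart_inv c) z"
    and bd: "\<And>x. x \<in> frontier D \<Longrightarrow> f0 x = f1 x"
    and nn: "\<And>c x. c \<in> A \<Longrightarrow> x \<in> chart_dom c \<Longrightarrow> x \<in> D \<Longrightarrow> 0 \<le> flux_diff f1 f0 (\<lambda>x. f1 x - f0 x) c x"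
    and x0: "x0 \<in> D" "f0 x0 \<noteq> f1 x0"
  shows "\<exists>c\<in>A. x0 \<in> chart_dom c \<and> flux_diff f1 f0 (\<lambda>x. f1 x - f0 x) c x0 = 0"
proof -
  define u where "u x = f1 x - f0 x" for x
  have DW: "D \<subseteq> W" using closure_subset W(2) by (rule subset_trans)
  have fD: "smooth_map_on A D f0" "smooth_map_on A D f1"
  proof -
    have "smooth_map_on A D h" if "smooth_map_on A W h" for h :: "'a \<Rightarrow> 'b"
      using that DW unfolding smooth_map_on_def by (blast intro: smooth_on_subset)
    then show "smooth_map_on A D f0" "smooth_map_on A D f1" using f by blast+
  qed
  have uW: "C1_map W u"
    unfolding u_def by (intro C1_map_diff smooth_map_imp_C1_map f)
  have uD: "C1_map D u" by (rule C1_map_subset[OF uW DW])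
  have cu: "continuous_on W u" by (rule C1_map_continuous[OF W(1) uW])
  obtain P :: "'a set" and ch \<rho> Kp where fin: "finite P"
    and each: "\<forall>p\<in>P. ch p \<in> A \<and> compact (Kp p) \<and> Kp p \<subseteq> chart_dom (ch p) \<inter> W \<and> C1_map D (\<rho> p) \<and>
       (\<forall>x. x \<notin> Kp p \<longrightarrow> \<rho> p x = 0) \<and> (\<forall>x. 0 \<le> \<rho> p x)"
    and one: "\<forall>x\<in>D. (\<Sum>p\<in>P. \<rho> p x) = (1::real)"
    using partition_of_unity[OF D(2) W(2,1)] by (elim exE conjE)
  have P: "finite P" "\<And>p. p \<in> P \<Longrightarrow> ch p \<in> A" "\<And>p. p \<in> P \<Longrightarrow> compact (Kp p)"
      "\<And>p. p \<in> P \<Longrightarrow> Kp p \<subseteq> chart_dom (ch p) \<inter> W" "\<And>p. p \<in> P \<Longrightarrow> C1_map D (\<rho> p)"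
      "\<And>p x. p \<in> P \<Longrightarrow> x \<notin> Kp p \<Longrightarrow> \<rho> p x = (0::real)" "\<And>p x. p \<in> P \<Longrightarrow> 0 \<le> \<rho> p x"
      "\<And>x. x \<in> D \<Longrightarrow> (\<Sum>p\<in>P. \<rho> p x) = 1"
    using fin each one by simp_all
  have Pd: "\<And>p. p \<in> P \<Longrightarrow> Kp p \<subseteq> chart_dom (ch p)" using P(4) by blast
  have \<rho>1: "\<rho> p x \<le> 1" if "p \<in> P" "x \<in> D" for p x
    using member_le_sum[of p P "\<lambda>p. \<rho> p x"] P(1,7) P(8)[OF that(2)] that by simp
  define V where "V n = truncate n u" for n
  have V: "C1_map D (V n)" for n unfolding V_def by (rule truncate_C1[OF uD])
  have weak: "(\<Sum>p\<in>P. chart_integral D (ch p) (\<lambda>c x. \<rho> p x * flux_diff f1 f0 (V n) c x)) = 0"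
    and Vsupp: "\<exists>K. compact K \<and> K \<subseteq> D \<and> (\<forall>x\<in>D - K. V n x = 0)" for n
  proof -
    \<comment> \<open>Contains every point of the closure where the \<open>n\<close>-th truncation
      is nonzero. It misses the frontier because \<open>u = 0\<close> there, hence it is a compact
      subset of \<open>D\<close>.\<close>
    define K where "K = closure D \<inter> (\<lambda>x. real n * (u x \<bullet> u x)) -` {1..}"
    have "continuous_on (closure D) (\<lambda>x. real n * (u x \<bullet> u x))"
      by (intro continuous_intros continuous_on_subset[OF cu W(2)])
    then have "closedin (top_of_set (closure D)) K"
      unfolding K_def by (rule continuous_closedin_preimage) simp
    then have K: "compact K" using closedin_compact[OF D(2)] by blast
    have KD: "K \<subseteq> D"
    proof
      fix x assume x: "x \<in> K"
      have "u x = 0" if "x \<in> frontier D" using bd[OF that] by (simp add: u_def)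
      then have "x \<notin> frontier D" using x by (auto simp: K_def)
      then show "x \<in> D" using x D(1) by (auto simp: K_def frontier_def interior_open)
    qed
    have Vz: "V n x = 0" if "x \<in> D - K" for x
    proof -
      have "x \<in> closure D" using that closure_subset by blast
      then have "real n * (u x \<bullet> u x) \<le> 1" using that by (auto simp: K_def)
      then show ?thesis by (simp add: V_def truncate_def cutoff_bounds(3))
    qed
    show "\<exists>K. compact K \<and> K \<subseteq> D \<and> (\<forall>x\<in>D - K. V n x = 0)" using K KD Vz by blast
    show "(\<Sum>p\<in>P. chart_integral D (ch p) (\<lambda>c x. \<rho> p x * flux_diff f1 f0 (V n) c x)) = 0"
      by (rule global_weak_form[OF D(1) fD V m K KD Vz P(1,2,3) Pd P(5,6,8)])
  qed
  define g where "g p n z = (if z \<in> chart_region (ch p) D then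
     \<rho> p (chart_inv (ch p) z) * flux_diff f1 f0 (V n) (ch p) (chart_inv (ch p) z) else 0)" for p n z
  \<comment> \<open>The pointwise limit of \<open>g p n\<close>; the condition
    \<open>u \<noteq> 0\<close> reflects the limit \<open>0\<close> of the truncated differentials
    at zeros of \<open>u\<close>.\<close>
  define h where "h p z = (if z \<in> chart_region (ch p) D \<and> u (chart_inv (ch p) z) \<noteq> 0 then
     \<rho> p (chart_inv (ch p) z) * flux_diff f1 f0 u (ch p) (chart_inv (ch p) z) else 0)" for p z
  have g_int: "integrable lborel (g p n)" if p: "p \<in> P" for p n
  proof -
    obtain K where "compact K \<and> K \<subseteq> D \<and> (\<forall>x\<in>D - K. V n x = 0)" using Vsupp[of n] ..
    then have K: "compact K" "K \<subseteq> D" "\<And>x. x \<in> D - K \<Longrightarrow> V n x = 0" by auto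
    have cK: "compact (K \<inter> Kp p)" using compact_Int_closed[OF K(1) compact_imp_closed[OF P(3)[OF p]]] .
    have "flux_diff f1 f0 (V n) (ch p) x = 0" if "x \<in> chart_dom (ch p)" "x \<in> D - K" for x
      using differential_zero[OF P(2)[OF p] D(1) compact_imp_closed[OF K(1)] that K(3)] by (simp add: flux_diff_def flux_zero)
    then have z: "\<rho> p x * flux_diff f1 f0 (V n) (ch p) x = 0" if "x \<in> chart_dom (ch p) \<inter> D - K \<inter> Kp p" for x
      using that P(6)[OF p, of x] by auto
    show ?thesis
      unfolding g_def
      by (rule chart_integral_integrable[OF P(2)[OF p] D(1) density_on_mult[OF flux_diff_density[OF D(1) fD V] P(5)[OF p]] cK _ z])
        (use K(2) Pd[OF p] in auto)
  qed
  have reg: "chart_inv (ch p) z \<in> chart_dom (ch p)" "chart_inv (ch p) z \<in> D" "z \<in> chart_image (ch p)"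
    if "p \<in> P" "z \<in> chart_region (ch p) D" for p z
    using that chart_region_iff[OF P(2)] chart_inv_dom[OF P(2)] by auto
  have lim: "(\<lambda>n. g p n z) \<longlonglongrightarrow> h p z" if p: "p \<in> P" for p z
  proof (cases "z \<in> chart_region (ch p) D")
    case True
    let ?x = "chart_inv (ch p) z"
    note r = reg[OF p True]
    have "(\<lambda>n. flux_diff f1 f0 (V n) (ch p) ?x) \<longlonglongrightarrow>
       (\<Sum>i\<in>UNIV. flux_diff_field f1 f0 (ch p) i z \<bullet> (if u ?x = 0 then 0 else differential (ch p) u ?x (axis i 1)))"
      unfolding flux_diff_region[OF P(2)[OF p] r(3)] V_def
      by (intro tendsto_sum tendsto_inner tendsto_const differential_truncate_limit[OF P(2)[OF p] r(1,2) uD])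
    also have "(\<Sum>i\<in>UNIV. flux_diff_field f1 f0 (ch p) i z \<bullet> (if u ?x = 0 then 0 else differential (ch p) u ?x (axis i 1)))
       = (if u ?x = 0 then 0 else flux_diff f1 f0 u (ch p) ?x)"
      unfolding flux_diff_region[OF P(2)[OF p] r(3)] by simp
    finally have "(\<lambda>n. \<rho> p ?x * flux_diff f1 f0 (V n) (ch p) ?x) \<longlonglongrightarrow> \<rho> p ?x * (if u ?x = 0 then 0 else flux_diff f1 f0 u (ch p) ?x)"
      by (intro tendsto_mult tendsto_const)
    then show ?thesis using True by (auto simp: g_def h_def)
  qed (simp add: g_def h_def)
  have dom: "\<exists>B. integrable lborel B \<and> (\<forall>n z. norm (g p n z) \<le> B z)" if p: "p \<in> P" for p
  proof -
    note c = P(2)[OF p]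
    \<comment> \<open>The bound is continuous on the region of \<open>W\<close>, past the frontier
      of \<open>D\<close>, and hence integrable over the compact set that supports
      \<open>\<rho> p\<close>. Smoothness up to the boundary provides this.\<close>
    define b where "b z = (\<Sum>i\<in>UNIV. norm (flux_diff_field f1 f0 (ch p) i z) * (5 * norm (differential (ch p) u (chart_inv (ch p) z) (axis i 1))))" for z
    define K where "K = chart_map (ch p) ` Kp p"
    have K: "compact K" unfolding K_def by (rule compact_chart_image[OF c P(3)[OF p] Pd[OF p]])
    have KW: "K \<subseteq> chart_region (ch p) W" using P(4)[OF p] by (auto simp: K_def chart_region_def)
    have "continuous_on (chart_region (ch p) W) b"
      unfolding b_def
      by (intro continuous_on_sum continuous_on_mult continuous_on_norm continuous_on_const differential_continuous[OF c uW]
          C1_on_continuous[OF flux_diff_field_C1[OF c W(1) f]])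
    then have int: "integrable lborel (\<lambda>z. indicator K z *\<^sub>R b z)"
      by (intro borel_integrable_compact[OF K] continuous_on_subset[OF _ KW])
    have "norm (g p n z) \<le> indicator K z *\<^sub>R b z" for n z
    proof (cases "z \<in> chart_region (ch p) D \<and> z \<in> K")
      case True
      let ?x = "chart_inv (ch p) z"
      note r = reg[OF p conjunct1[OF True]]
      have "norm (flux_diff f1 f0 (V n) (ch p) ?x) \<le> b z"
        unfolding flux_diff_region[OF c r(3)] b_def
      proof (rule sum_norm_le)
        fix i
        have "norm (flux_diff_field f1 f0 (ch p) i z \<bullet> differential (ch p) (V n) ?x (axis i 1))
          \<le> norm (flux_diff_field f1 f0 (ch p) i z) * norm (differential (ch p) (V n) ?x (axis i 1))"
          using Cauchy_Schwarz_ineq2 by simp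
        also have "\<dots> \<le> norm (flux_diff_field f1 f0 (ch p) i z) * (5 * norm (differential (ch p) u ?x (axis i 1)))"
          unfolding V_def by (intro mult_left_mono norm_differential_truncate[OF c r(1,2) uD]) auto
        finally show "norm (flux_diff_field f1 f0 (ch p) i z \<bullet> differential (ch p) (V n) ?x (axis i 1))
          \<le> norm (flux_diff_field f1 f0 (ch p) i z) * (5 * norm (differential (ch p) u ?x (axis i 1)))" .
      qed
      then have "\<bar>\<rho> p ?x\<bar> * norm (flux_diff f1 f0 (V n) (ch p) ?x) \<le> 1 * b z"
        using \<rho>1[OF p r(2)] P(7)[OF p, of ?x] by (intro mult_mono) auto
      then show ?thesis using True by (simp add: g_def abs_mult)
    next
      case False
      have "\<rho> p (chart_inv (ch p) z) = 0" if "z \<in> chart_region (ch p) D" "z \<notin> K"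
      proof (rule P(6)[OF p])
        show "chart_inv (ch p) z \<notin> Kp p"
          using that chart_map_inv[OF c reg(3)[OF p that(1)]] unfolding K_def by (metis image_eqI)
      qed
      moreover have "0 \<le> b z" unfolding b_def by (intro sum_nonneg) simp
      ultimately show ?thesis using False by (auto simp: g_def indicator_def)
    qed
    with int show ?thesis by blast
  qed
  have h: "integrable lborel (h p)" "(\<lambda>n. integral\<^sup>L lborel (g p n)) \<longlonglongrightarrow> integral\<^sup>L lborel (h p)" if p: "p \<in> P" for p
  proof -
    obtain B where B: "integrable lborel B" "\<And>n z. norm (g p n z) \<le> B z" using dom[OF p] by blast
    have gm: "g p n \<in> borel_measurable lborel" for n using g_int[OF p] by (rule borel_measurable_integrable)
    have hm: "h p \<in> borel_measurable lborel" by (rule borel_measurable_LIMSEQ_metric[OF gm lim[OF p]])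
    show "integrable lborel (h p)"
      by (rule integrable_dominated_convergence[where s = "g p", OF hm gm B(1)]) (use lim[OF p] B(2) in auto)
    show "(\<lambda>n. integral\<^sup>L lborel (g p n)) \<longlonglongrightarrow> integral\<^sup>L lborel (h p)"
      by (rule integral_dominated_convergence[where s = "g p", OF hm gm B(1)]) (use lim[OF p] B(2) in auto)
  qed
  have hn: "0 \<le> h p z" if p: "p \<in> P" for p z
    unfolding h_def u_def using nn[OF P(2)[OF p]] reg[OF p] P(7)[OF p] by simp
  have "(\<lambda>n. \<Sum>p\<in>P. integral\<^sup>L lborel (g p n)) \<longlonglongrightarrow> (\<Sum>p\<in>P. integral\<^sup>L lborel (h p))"
    by (intro tendsto_sum h(2))
  moreover have "(\<Sum>p\<in>P. integral\<^sup>L lborel (g p n)) = 0" for n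
    using weak[of n] unfolding chart_integral_def g_def[abs_def] .
  ultimately have "(\<Sum>p\<in>P. integral\<^sup>L lborel (h p)) = 0" by (simp add: LIMSEQ_const_iff)
  moreover have "0 \<le> integral\<^sup>L lborel (h p)" if "p \<in> P" for p
    by (intro Bochner_Integration.integral_nonneg hn that)
  ultimately have h0: "integral\<^sup>L lborel (h p) = 0" if "p \<in> P" for p
    using that P(1) by (simp add: sum_nonneg_eq_0_iff)
  obtain p where p: "p \<in> P" "\<rho> p x0 \<noteq> 0"
    using P(8)[OF x0(1)] by (metis sum.neutral zero_neq_one)
  note c = P(2)[OF p(1)]
  have xd: "x0 \<in> chart_dom (ch p)" using P(6)[OF p(1), of x0] p(2) Pd[OF p(1)] by blast
  \<comment> \<open>On \<open>U\<close> the function \<open>h p\<close> is the continuous density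
    itself, so vanishing almost everywhere improves to vanishing everywhere.\<close>
  define U where "U = D \<inter> u -` (- {0})"
  have U: "open U"
    unfolding U_def by (rule continuous_open_preimage[OF continuous_on_subset[OF cu DW] D(1)]) auto
  have UD: "U \<subseteq> D" by (auto simp: U_def)
  have ae: "AE z in lborel. h p z = 0"
    using integral_nonneg_eq_0_iff_AE[OF h(1)[OF p(1)]] hn[OF p(1)] h0[OF p(1)] by simp
  have "continuous_on (chart_region (ch p) U) (\<lambda>z. \<rho> p (chart_inv (ch p) z) * flux_diff f1 f0 u (ch p) (chart_inv (ch p) z))"
    using density_on_mult[OF flux_diff_density[OF D(1) fD uD] P(5)[OF p(1)]] c chart_region_mono[OF c UD]
    unfolding density_on_def by (blast intro: continuous_on_subset)
  moreover have "AE z in lborel. z \<in> chart_region (ch p) U \<longrightarrow>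
      \<rho> p (chart_inv (ch p) z) * flux_diff f1 f0 u (ch p) (chart_inv (ch p) z) = 0"
    using ae
  proof (rule AE_mp, intro AE_I2 impI)
    fix z assume "h p z = 0" "z \<in> chart_region (ch p) U"
    then show "\<rho> p (chart_inv (ch p) z) * flux_diff f1 f0 u (ch p) (chart_inv (ch p) z) = 0"
      using chart_region_iff[OF c] by (auto simp: h_def U_def)
  qed
  moreover have "chart_map (ch p) x0 \<in> chart_region (ch p) U"
    using x0 xd by (intro map_in_region[OF c]) (auto simp: U_def u_def)
  ultimately have "\<rho> p (chart_inv (ch p) (chart_map (ch p) x0)) * flux_diff f1 f0 u (ch p) (chart_inv (ch p) (chart_map (ch p) x0)) = 0"
    by (rule AE_zero_continuous[OF open_chart_region[OF c U]])
  then have "flux_diff f1 f0 u (ch p) x0 = 0" using p(2) chart_inv_map[OF c xd] by simp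
  then show ?thesis using c xd unfolding u_def[abs_def] by blast
qed

text \<open>A positive maximum of \<open>u \<bullet> u\<close> would be attained on a subset of
  \<open>D\<close> that is closed in \<open>D\<close>, and open because \<open>u \<bullet> u\<close>
  is locally constant where \<open>u \<noteq> 0\<close>. By connectedness this subset is
  \<open>D\<close>, and continuity carries the positive value to the nonempty frontier, where
  \<open>u\<close> vanishes.\<close>

lemma locally_constant_vanishes:
  fixes u :: "'a \<Rightarrow> 'b::euclidean_space"
  assumes D: "bounded_domain D" and W: "open W" "closure D \<subseteq> W" and u: "C1_map W u"
    and bd: "\<And>x. x \<in> frontier D \<Longrightarrow> u x = 0"
    and d: "\<And>c x. c \<in> A \<Longrightarrow> x \<in> chart_dom c \<Longrightarrow> x \<in> D \<Longrightarrow> u x \<noteq> 0 \<Longrightarrow> differential c u x = (\<lambda>_. 0)"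
    and x: "x \<in> D"
  shows "u x = 0"
proof -
  have D': "open D" "connected D" "compact (closure D)" "frontier D \<noteq> {}" using D unfolding bounded_domain_def by auto
  have DW: "D \<subseteq> W" using closure_subset W(2) by (rule subset_trans)
  have cu: "continuous_on W u" by (rule C1_map_continuous[OF W(1) u])
  define s where "s x = u x \<bullet> u x" for x
  have cs: "continuous_on (closure D) s"
    unfolding s_def by (intro continuous_on_inner continuous_on_subset[OF cu W(2)])
  have s0: "s x = 0" if "x \<in> frontier D" for x using bd[OF that] by (simp add: s_def)
  have "closure D \<noteq> {}" using x by auto
  then obtain p where p: "p \<in> closure D" "\<And>y. y \<in> closure D \<Longrightarrow> s y \<le> s p"
    using continuous_attains_sup[OF D'(3) _ cs] by blast
  have "s p \<le> 0"
  proof (rule ccontr)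
    assume "\<not> s p \<le> 0"
    then have sp: "s p > 0" by simp
    have pD: "p \<in> D"
      using p(1) s0[of p] sp D'(1) by (auto simp: frontier_def interior_open)
    define T where "T = {y \<in> D. s y = s p}"
    have "openin (top_of_set D) T"
    proof (subst openin_open_eq[OF D'(1)], intro conjI)
      show "open T"
      proof (subst open_subopen, rule ballI)
        fix y assume y: "y \<in> T"
        then have yD: "y \<in> D" "s y = s p" by (auto simp: T_def)
        obtain c where c: "c \<in> A" "y \<in> chart_dom c" using chart_cover by blast
        define U where "U = D \<inter> u -` (- {0})"
        have U: "open U"
          unfolding U_def by (rule continuous_open_preimage[OF continuous_on_subset[OF cu DW] D'(1)]) auto
        have "y \<in> U" using yD sp by (auto simp: U_def s_def)
        then obtain r where r: "r > 0" "ball (chart_map c y) r \<subseteq> chart_region c U"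
          using open_contains_ball[THEN iffD1, OF open_chart_region[OF c(1) U]] map_in_region[OF c] by blast
        let ?B = "ball (chart_map c y) r"
        have "\<exists>k. \<forall>z\<in>?B. (u \<circ> chart_inv c) z \<bullet> (u \<circ> chart_inv c) z = k"
        proof (rule has_derivative_zero_constant[OF convex_ball])
          fix z assume z: "z \<in> ?B"
          then have zU: "z \<in> chart_image c" "chart_inv c z \<in> U" using r(2) chart_region_iff[OF c(1)] by auto
          then have w: "chart_inv c z \<in> chart_dom c" "chart_inv c z \<in> D" "u (chart_inv c z) \<noteq> 0"
            using chart_inv_dom[OF c(1)] by (auto simp: U_def)
          have "((\<lambda>z. (u \<circ> chart_inv c) z \<bullet> (u \<circ> chart_inv c) z) has_derivative (\<lambda>v. 0)) (at z)"
            using differential_norm_sq[OF c(1) w(1) subsetD[OF DW w(2)] u] chart_map_inv[OF c(1) zU(1)]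
            by (simp add: d[OF c(1) w])
          then show "((\<lambda>z. (u \<circ> chart_inv c) z \<bullet> (u \<circ> chart_inv c) z) has_derivative (\<lambda>v. 0)) (at z within ?B)"
            by (rule has_derivative_at_withinI)
        qed
        then obtain k where k: "\<And>z. z \<in> ?B \<Longrightarrow> s (chart_inv c z) = k" by (auto simp: s_def)
        have ky: "k = s p" using k[of "chart_map c y"] r(1) chart_inv_map[OF c] yD by simp
        let ?N = "chart_dom c \<inter> chart_map c -` ?B"
        have "open ?N" by (rule continuous_open_preimage[OF continuous_chart_map[OF c(1)] open_dom[OF c(1)] open_ball])
        moreover have "y \<in> ?N" using c r by simp
        moreover have "?N \<subseteq> T"
        proof
          fix q assume q: "q \<in> ?N"
          then have "chart_map c q \<in> chart_region c U" using r(2) by auto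
          then have "q \<in> D" using q chart_region_iff[OF c(1)] chart_inv_map[OF c(1)] by (auto simp: U_def)
          moreover have "s q = s p" using k[of "chart_map c q"] q chart_inv_map[OF c(1)] ky by simp
          ultimately show "q \<in> T" by (simp add: T_def)
        qed
        ultimately show "\<exists>N. open N \<and> y \<in> N \<and> N \<subseteq> T" by blast
      qed
    qed (auto simp: T_def)
    moreover have "closedin (top_of_set D) T"
    proof -
      have "T = D \<inter> s -` {s p}" by (auto simp: T_def)
      then show ?thesis
        using continuous_closedin_preimage[OF continuous_on_subset[OF cs closure_subset], of "{s p}"] by simp
    qed
    ultimately have "T = D"
      using D'(2) pD unfolding connected_clopen by (auto simp: T_def)
    then have sD: "s y = s p" if "y \<in> D" for y using that by (auto simp: T_def)
    have "s y = s p" if "y \<in> closure D" for y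
      by (rule continuous_constant_on_closure[OF cs sD that])
    moreover obtain y where "y \<in> frontier D" using D'(4) by blast
    ultimately have "s p = 0" using s0[of y] by (auto simp: frontier_def)
    then show False using sp by simp
  qed
  then have "s x \<le> 0" using p(2)[of x] x closure_subset by fastforce
  then show ?thesis using inner_ge_zero[of "u x"] inner_eq_zero_iff[of "u x"] unfolding s_def by linarith
qed

end

theorem corollary1p4:
  fixes A :: "('a::{t2_space, second_countable_topology}, real^'m) riem_chart set"
    and D :: "'a set"
    and f0 f1 :: "'a \<Rightarrow> real^'n"
  assumes "riemannian_manifold A"
    and "bounded_domain D"
    and "minimal_map A D f0" and "minimal_map A D f1"
    and "\<forall>x\<in>frontier D. f0 x = f1 x"
    and "(\<forall>x\<in>D. \<forall>f\<in>{f0, f1}. \<forall>l\<in>set (singular_values A f x). l \<le> 1) \<or>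
         (\<forall>x\<in>D. \<forall>f\<in>{f0, f1}. (\<Sum>l\<leftarrow>singular_values A f x. l) \<le> 2) \<or>
         (\<forall>x\<in>D. \<forall>f\<in>{f0, f1}. (\<Sum>l\<leftarrow>singular_values A f x. l\<^sup>2) \<le> 2) \<or>
         (\<forall>x\<in>D. \<forall>f\<in>{f0, f1}. (\<Sum>l\<leftarrow>singular_values A f x. sqrt (1 + l\<^sup>2)) \<le> 2)"
  shows "\<forall>x\<in>D. f0 x = f1 x"
proof
  fix x assume x: "x \<in> D"
  interpret riem_mfd A by unfold_locales (rule assms(1))
  have D: "open D" "compact (closure D)" using assms(2) unfolding bounded_domain_def by auto
  \<comment> \<open>The given functions are controlled only on the closure, so the argument runs on
    the smooth extensions \<open>F0\<close> and \<open>F1\<close> over a common neighbourhood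
    \<open>W\<close>.\<close>
  obtain W0 F0 where W0: "open W0" "closure D \<subseteq> W0" "smooth_map_on A W0 F0" "\<And>x. x \<in> closure D \<Longrightarrow> f0 x = F0 x"
    using assms(3) unfolding minimal_map_def smooth_up_to_boundary_def by blast
  obtain W1 F1 where W1: "open W1" "closure D \<subseteq> W1" "smooth_map_on A W1 F1" "\<And>x. x \<in> closure D \<Longrightarrow> f1 x = F1 x"
    using assms(4) unfolding minimal_map_def smooth_up_to_boundary_def by blast
  define W where "W = W0 \<inter> W1"
  have W: "open W" "closure D \<subseteq> W" using W0 W1 by (auto simp: W_def)
  have DW: "D \<subseteq> W" using closure_subset W(2) by (rule subset_trans)
  have smW: "smooth_map_on A V F" if "smooth_map_on A V' F" "V \<subseteq> V'" for V V' and F :: "'a \<Rightarrow> real^'n"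
    using that unfolding smooth_map_on_def by (blast intro: smooth_on_subset)
  have F: "smooth_map_on A W F0" "smooth_map_on A W F1"
    using smW[OF W0(3)] smW[OF W1(3)] by (auto simp: W_def)
  have FD: "smooth_map_on A D F0" "smooth_map_on A D F1"
    using smW[OF F(1) DW] smW[OF F(2) DW] by auto
  have e0: "f0 x = F0 x" and e1: "f1 x = F1 x" if "x \<in> D" for x
    using W0(4) W1(4) that closure_subset by (meson subsetD)+
  have smD: "smooth_map_on A D f" if F: "smooth_map_on A D F" and e: "\<And>x. x \<in> D \<Longrightarrow> f x = F x" for f F :: "'a \<Rightarrow> real^'n"
    unfolding smooth_map_on_def
  proof
    fix c assume c: "c \<in> A"
    show "smooth_on (chart_map c ` (chart_dom c \<inter> D)) (f \<circ> chart_inv c)"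
      unfolding chart_region_def[symmetric]
      by (rule smooth_on_cong[OF open_chart_region[OF c D(1)], of "F \<circ> chart_inv c"])
        (use F c e chart_region_iff[OF c] in \<open>auto simp: smooth_map_on_def chart_region_def[symmetric]\<close>)
  qed
  have fD: "smooth_map_on A D f0" "smooth_map_on A D f1"
    using smD[OF FD(1) e0] smD[OF FD(2) e1] by auto
  \<comment> \<open>The graph equation at \<open>z\<close> involves only values near
    \<open>z\<close>, hence on the open set \<open>D\<close>, and so passes from \<open>f\<close> to
    its extension.\<close>
  have mgD: "minimal_graph_eq (chart_metric c) (F \<circ> chart_inv c) z"
    if c: "c \<in> A" and z: "z \<in> chart_region c D" and f: "smooth_map_on A D f" "minimal_map A D f" and e: "\<And>x. x \<in> D \<Longrightarrow> f x = F x"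
    for c z and f F :: "'a \<Rightarrow> real^'n"
  proof -
    note o = open_chart_region[OF c D(1)]
    have e': "(f \<circ> chart_inv c) y = (F \<circ> chart_inv c) y" if "y \<in> chart_region c D" for y
      using that e chart_region_iff[OF c] by simp
    have 1: "frechet_derivative (f \<circ> chart_inv c) (at y) = frechet_derivative (F \<circ> chart_inv c) (at y)" if "y \<in> chart_region c D" for y
      by (rule frechet_derivative_cong_open[OF o that e'])
    have 2: "frechet_derivative (\<lambda>y. frechet_derivative (f \<circ> chart_inv c) (at y) v) (at z)
        = frechet_derivative (\<lambda>y. frechet_derivative (F \<circ> chart_inv c) (at y) v) (at z)" for v
      by (rule frechet_derivative_cong_open[OF o z]) (simp add: 1)
    show ?thesis
      using minimal_map_graph_eq[OF c D(1) f z] unfolding minimal_graph_eq_def 1[OF z] 2 .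
  qed
  define u where "u x = F1 x - F0 x" for x
  have uW: "C1_map W u" unfolding u_def by (intro C1_map_diff smooth_map_imp_C1_map F)
  have mono: "flux_diff F1 F0 u c y \<ge> 0 \<and> (flux_diff F1 F0 u c y = 0 \<longrightarrow> differential c u y = (\<lambda>_. 0))"
    if c: "c \<in> A" and y: "y \<in> chart_dom c" "y \<in> D" for c y
  proof -
    let ?g = "chart_metric c (chart_map c y)"
    note g = metric_pos_def[OF c y(1)]
    define L0 where "L0 = differential c F0 y"
    define L1 where "L1 = differential c F1 y"
    have L: "linear L0" "linear L1"
      unfolding L0_def L1_def using C1_mapD(4)[OF smooth_map_imp_C1_map[OF FD(1)] c y] C1_mapD(4)[OF smooth_map_imp_C1_map[OF FD(2)] c y] by auto
    have du: "differential c u y = (\<lambda>v. L1 v - L0 v)"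
      unfolding u_def L0_def L1_def by (rule differential_diff[OF c y smooth_map_imp_C1_map[OF FD(2)] smooth_map_imp_C1_map[OF FD(1)]])
    obtain b0 l0 where s0: "svd ?g L0 (b0 :: 'm \<Rightarrow> real^'m) l0" using svd_exists[OF g L(1)] by blast
    obtain b1 l1 where s1: "svd ?g L1 (b1 :: 'm \<Rightarrow> real^'m) l1" using svd_exists[OF g L(2)] by blast
    \<comment> \<open>On \<open>D\<close> the extensions have the differentials of the given maps,
      so the hypotheses on the singular values of \<open>f0\<close> and \<open>f1\<close> apply to
      \<open>L0\<close> and \<open>L1\<close>.\<close>
    have d0: "differential c f0 y = L0" and d1: "differential c f1 y = L1"
      unfolding L0_def L1_def using differential_cong[OF c D(1) y e0] differential_cong[OF c D(1) y e1] by auto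
    note v0 = singular_values_sum[OF c y smooth_map_imp_C1_map[OF fD(1)] s0[folded d0]]
    note v1 = singular_values_sum[OF c y smooth_map_imp_C1_map[OF fD(2)] s1[folded d1]]
    have "spectral_bounds l0 l1"
      using assms(6)
    proof (elim disjE)
      assume "\<forall>x\<in>D. \<forall>f\<in>{f0, f1}. \<forall>l\<in>set (singular_values A f x). l \<le> 1"
      then show ?thesis using y(2) v0(2) v1(2) unfolding spectral_bounds_def by auto
    next
      assume "\<forall>x\<in>D. \<forall>f\<in>{f0, f1}. (\<Sum>l\<leftarrow>singular_values A f x. l) \<le> 2"
      then show ?thesis using y(2) v0(1)[of "\<lambda>l. l"] v1(1)[of "\<lambda>l. l"] unfolding spectral_bounds_def by auto
    next
      assume "\<forall>x\<in>D. \<forall>f\<in>{f0, f1}. (\<Sum>l\<leftarrow>singular_values A f x. l\<^sup>2) \<le> 2"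
      then show ?thesis using y(2) v0(1)[of "\<lambda>l. l\<^sup>2"] v1(1)[of "\<lambda>l. l\<^sup>2"] unfolding spectral_bounds_def by auto
    next
      assume "\<forall>x\<in>D. \<forall>f\<in>{f0, f1}. (\<Sum>l\<leftarrow>singular_values A f x. sqrt (1 + l\<^sup>2)) \<le> 2"
      then show ?thesis using y(2) v0(1)[of "\<lambda>l. sqrt (1 + l\<^sup>2)"] v1(1)[of "\<lambda>l. sqrt (1 + l\<^sup>2)"] unfolding spectral_bounds_def by auto
    qed
    note cs = convex_spectrum_segment[OF g L s0 s1 this]
    have "flux ?g L0 (\<lambda>v. L1 v - L0 v) \<le> flux ?g L1 (\<lambda>v. L1 v - L0 v)"
      "flux ?g L0 (\<lambda>v. L1 v - L0 v) = flux ?g L1 (\<lambda>v. L1 v - L0 v) \<Longrightarrow> L0 = L1"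
      by (rule flux_monotone[OF g L cs], assumption+)+
    then show ?thesis
      unfolding flux_diff_def du L0_def[symmetric] L1_def[symmetric] by auto
  qed
  have bd: "F0 x = F1 x" if "x \<in> frontier D" for x
    using that assms(5) W0(4)[of x] W1(4)[of x] by (auto simp: frontier_def)
  have du0: "differential c u y = (\<lambda>_. 0)" if c: "c \<in> A" and y: "y \<in> chart_dom c" "y \<in> D" "u y \<noteq> 0" for c y
  proof -
    have "F0 y \<noteq> F1 y" using y(3) by (auto simp: u_def)
    from flux_diff_vanishes[OF D W F mgD[OF _ _ fD(1) assms(3) e0] mgD[OF _ _ fD(2) assms(4) e1] bd _ y(2) this]
    obtain d where d: "d \<in> A" "y \<in> chart_dom d" "flux_diff F1 F0 u d y = 0"
      using mono unfolding u_def[abs_def] by blast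
    have "differential d u y = (\<lambda>_. 0)" using mono[OF d(1,2) y(2)] d(3) by blast
    \<comment> \<open>The vanishing is obtained in some chart \<open>d\<close> around
      \<open>y\<close>; the transition map carries a zero differential to the chart
      \<open>c\<close>.\<close>
    then show ?thesis
      using differential_transition(2)[OF c d(1) y(1) d(2) C1_mapD(3)[OF uW d(1,2) subsetD[OF DW y(2)]]] by simp
  qed
  have "u x = 0"
    by (rule locally_constant_vanishes[OF assms(2) W uW _ du0 x]) (use bd in \<open>auto simp: u_def\<close>)
  then show "f0 x = f1 x" using e0[OF x] e1[OF x] by (simp add: u_def)
qed


end
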